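(* There exists a finitely generated torsion group that is not unitarizable.
   Context: Groups are discrete. For a Hilbert space $H$, let $B(H)$ denote the algebra of bounded linear operators on $H$. A representation $\pi\colon G\to B(H)$ of a group $G$ (i.e., a homomorphism from $G$ to the group of invertible elements of $B(H)$) is uniformly bounded if $\sup_{g\in G}\|\pi(g)\|<\infty$. It is unitarizable if there exists an invertible operator $S\colon H\to H$ such that $g\mapsto S^{-1}\pi(g)S$ is a unitary representation of $G$. A group $G$ is unitarizable if every uniformly bounded representation $\pi\colon G\to B(H)$ on a Hilbert space $H$ is unitarizable. A group is torsion if each of its elements has finite order. *)

theory Defs
  imports Complex_Main "HOL-Algebra.Module" "HOL-Algebra.Generated_Groups"
begin

definition complex_ring :: "complex ring" where
  "complex_ring = \<lparr>carrier = UNIV, mult = (*), one = 1, zero = 0, add = (+)\<rparr>"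

(* Hilbert spaces are carrier-based, so that statements can quantify over them. As usual for
   HOL-Algebra modules, the fields mult and one inherited from the type of ring records are
   unused. *)
record 'h inner_space = "(complex, 'h) module" +
  ip :: "'h \<Rightarrow> 'h \<Rightarrow> complex"

definition hnorm :: "('h, 'm) inner_space_scheme \<Rightarrow> 'h \<Rightarrow> real" where
  "hnorm H x = sqrt (Re (ip H x x))"

(* Complex Hilbert spaces; the inner product is linear in the first argument. *)
locale hilbert_space = Module.module complex_ring H for H (structure) +
  assumes ip_add_left: "\<lbrakk>x \<in> carrier H; y \<in> carrier H; z \<in> carrier H\<rbrakk>
      \<Longrightarrow> ip H (x \<oplus> y) z = ip H x z + ip H y z"
    and ip_smult_left: "\<lbrakk>x \<in> carrier H; y \<in> carrier H\<rbrakk> \<Longrightarrow> ip H (a \<odot> x) y = a * ip H x y"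
    and ip_cnj: "\<lbrakk>x \<in> carrier H; y \<in> carrier H\<rbrakk> \<Longrightarrow> ip H y x = cnj (ip H x y)"
    and ip_pos: "\<lbrakk>x \<in> carrier H; x \<noteq> \<zero>\<rbrakk> \<Longrightarrow> Re (ip H x x) > 0"
    and complete: "\<lbrakk>\<And>n::nat. X n \<in> carrier H;
        \<And>e. e > 0 \<Longrightarrow> \<exists>N. \<forall>m\<ge>N. \<forall>n\<ge>N. hnorm H (X m \<ominus> X n) < e\<rbrakk>
      \<Longrightarrow> \<exists>x\<in>carrier H. (\<lambda>n. hnorm H (X n \<ominus> x)) \<longlonglongrightarrow> 0"

definition bounded_operator :: "('h, 'm) inner_space_scheme \<Rightarrow> ('h \<Rightarrow> 'h) \<Rightarrow> bool" where
  "bounded_operator H T \<longleftrightarrow>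
     T \<in> carrier H \<rightarrow> carrier H \<and>
     (\<forall>x\<in>carrier H. \<forall>y\<in>carrier H. T (x \<oplus>\<^bsub>H\<^esub> y) = T x \<oplus>\<^bsub>H\<^esub> T y) \<and>
     (\<forall>a. \<forall>x\<in>carrier H. T (a \<odot>\<^bsub>H\<^esub> x) = a \<odot>\<^bsub>H\<^esub> T x) \<and>
     (\<exists>C. \<forall>x\<in>carrier H. hnorm H (T x) \<le> C * hnorm H x)"

(* B(H) as a multiplicative monoid. Operators are extensional (undefined outside the carrier),
   so that equality of operators is equality on the carrier. *)
definition bounded_operators :: "('h, 'm) inner_space_scheme \<Rightarrow> ('h \<Rightarrow> 'h) monoid" where
  "bounded_operators H =
     \<lparr>carrier = {T \<in> extensional (carrier H). bounded_operator H T},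
      mult = compose (carrier H),
      one = (\<lambda>x\<in>carrier H. x)\<rparr>"

definition op_norm :: "('h, 'm) inner_space_scheme \<Rightarrow> ('h \<Rightarrow> 'h) \<Rightarrow> real" where
  "op_norm H T = (SUP x \<in> {x \<in> carrier H. hnorm H x \<le> 1}. hnorm H (T x))"

definition unitary_operator :: "('h, 'm) inner_space_scheme \<Rightarrow> ('h \<Rightarrow> 'h) \<Rightarrow> bool" where
  "unitary_operator H U \<longleftrightarrow>
     U \<in> carrier (bounded_operators H) \<and> U ` carrier H = carrier H \<and>
     (\<forall>x\<in>carrier H. \<forall>y\<in>carrier H. ip H (U x) (U y) = ip H x y)"

definition representation ::
    "('g, 'n) monoid_scheme \<Rightarrow> ('h, 'm) inner_space_scheme \<Rightarrow> ('g \<Rightarrow> 'h \<Rightarrow> 'h) \<Rightarrow> bool" where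
  "representation G H \<pi> \<longleftrightarrow> \<pi> \<in> hom G (units_of (bounded_operators H))"

definition unitary_representation ::
    "('g, 'n) monoid_scheme \<Rightarrow> ('h, 'm) inner_space_scheme \<Rightarrow> ('g \<Rightarrow> 'h \<Rightarrow> 'h) \<Rightarrow> bool" where
  "unitary_representation G H \<pi> \<longleftrightarrow>
     representation G H \<pi> \<and> (\<forall>g\<in>carrier G. unitary_operator H (\<pi> g))"

definition uniformly_bounded ::
    "('g, 'n) monoid_scheme \<Rightarrow> ('h, 'm) inner_space_scheme \<Rightarrow> ('g \<Rightarrow> 'h \<Rightarrow> 'h) \<Rightarrow> bool" where
  "uniformly_bounded G H \<pi> \<longleftrightarrow> bdd_above ((\<lambda>g. op_norm H (\<pi> g)) ` carrier G)"

definition unitarizable_representation ::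
    "('g, 'n) monoid_scheme \<Rightarrow> ('h, 'm) inner_space_scheme \<Rightarrow> ('g \<Rightarrow> 'h \<Rightarrow> 'h) \<Rightarrow> bool" where
  "unitarizable_representation G H \<pi> \<longleftrightarrow>
     (\<exists>S \<in> Units (bounded_operators H).
        unitary_representation G H
          (\<lambda>g. inv\<^bsub>bounded_operators H\<^esub> S \<otimes>\<^bsub>bounded_operators H\<^esub> \<pi> g \<otimes>\<^bsub>bounded_operators H\<^esub> S))"

(* HOL cannot quantify over all types, so the Hilbert spaces range over those with carrier in a
   given type. With 'h = nat => complex this covers, up to isomorphism, every Hilbert space of
   cardinality at most that of the continuum, in particular every separable one. A
   uniformly bounded representation that is not unitarizable over one choice of 'h remains one
   over every larger type, so negated instances imply the unrestricted negation. *)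
definition unitarizable :: "'h itself \<Rightarrow> ('g, 'n) monoid_scheme \<Rightarrow> bool" where
  "unitarizable (_ :: 'h itself) G \<longleftrightarrow>
     (\<forall>(H :: 'h inner_space) \<pi>.
        hilbert_space H \<and> representation G H \<pi> \<and> uniformly_bounded G H \<pi>
        \<longrightarrow> unitarizable_representation G H \<pi>)"

definition finitely_generated_group :: "('g, 'n) monoid_scheme \<Rightarrow> bool" where
  "finitely_generated_group G \<longleftrightarrow>
     group G \<and> (\<exists>A. finite A \<and> A \<subseteq> carrier G \<and> generate G A = carrier G)"

definition torsion_group :: "('g, 'n) monoid_scheme \<Rightarrow> bool" where
  "torsion_group G \<longleftrightarrow>
     group G \<and> (\<forall>x\<in>carrier G. \<exists>n::nat. n > 0 \<and> x [^]\<^bsub>G\<^esub> n = \<one>\<^bsub>G\<^esub>)"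

end

theory Submission
  imports "HOL-Complex_Analysis.Great_Picard" Defs
begin

text \<open>
  For each word \<open>w\<close> in two letters add the relator \<open>w ^ n\<^sub>w\<close>, where the \<open>n\<^sub>w\<close> are powers of 2 with
  \<open>\<Sum> 1 / n\<^sub>w \<le> 1 / 2\<close>. Starting from the trivial quotient, refine a finite quotient \<open>Q\<close> repeatedly by all
  1-cocycles over the field with two elements that respect the relators; the limit is a residually
  finite torsion group \<open>G\<close>. A relator whose element has order \<open>n\<^sub>w\<close> in \<open>Q\<close> costs \<open>|Q| / n\<^sub>w\<close> linear
  conditions, one for each orbit, and any other relator is a square modulo the kernel and costs
  nothing. So there are at least \<open>2 ^ (3 |Q| / 2)\<close> cocycles, which amounts to a positive first
  \<open>L\<^sup>2\<close>-Betti number.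

  For a finite-index normal subgroup of \<open>G\<close> with Schreier generators \<open>S\<close>, a set of edges that is
  independent for the cocycles meets the edges inside a finite vertex set \<open>X\<close> in at most \<open>|X|\<close> edges.
  Averaging a maximal independent set over the finite quotients gives arbitrarily large sets \<open>A\<close> for
  which every finite vertex set \<open>X\<close> of the Cayley graph of \<open>A\<close> spans at most \<open>8 |X|\<close> edges. Such a graph
  can be oriented with bounded degrees, so that a suitable weighted sum \<open>\<phi>\<close> of the indicators of the
  sets \<open>A\<close> is not square summable although \<open>\<phi> (y x\<inverse>) = f x y + g x y\<close> with \<open>f\<close> bounded on rows and
  \<open>g\<close> bounded on columns, both in the \<open>\<ell>\<^sup>1\<close> norm.

  The commutators of the matrix \<open>f\<close> with the regular representation are bounded on \<open>\<ell>\<^sup>2\<close> by the Schur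
  test and give a uniformly bounded triangular representation on \<open>\<ell>\<^sup>2 \<oplus> \<ell>\<^sup>2\<close>. If it were unitarizable,
  the complement of the first summand in the invariant inner product would be the graph of a bounded
  operator that differs from \<open>f\<close> by a convolution, and comparing a row with a column would show that
  \<open>\<phi>\<close> is square summable.
\<close>

section \<open>Linear families over the field with two elements\<close>

text \<open>Truth values stand for the field with two elements and \<open>\<noteq>\<close> is its
  addition, so a nonempty set of this kind is a linear subspace.\<close>

definition xor_closed :: "('a \<Rightarrow> bool) set \<Rightarrow> bool" where
  "xor_closed V \<longleftrightarrow> (\<forall>f\<in>V. \<forall>g\<in>V. (\<lambda>x. f x \<noteq> g x) \<in> V)"

lemma xor_closedD: "xor_closed V \<Longrightarrow> f \<in> V \<Longrightarrow> g \<in> V \<Longrightarrow> (\<lambda>x. f x \<noteq> g x) \<in> V"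
  by (auto simp: xor_closed_def)

text \<open>Adding a fixed \<open>v\<close> with \<open>l v\<close> maps the complement of the
  kernel injectively into the kernel.\<close>

lemma card_le_double_kernel:
  assumes "finite V" "xor_closed V"
    and l: "\<And>f g. f \<in> V \<Longrightarrow> g \<in> V \<Longrightarrow> l (\<lambda>x. f x \<noteq> g x) = (l f \<noteq> l g)"
  shows "card V \<le> 2 * card {f \<in> V. \<not> l f}"
proof (cases "\<exists>v\<in>V. l v")
  case True
  then obtain v where v: "v \<in> V" "l v" by auto
  have "card {f \<in> V. l f} \<le> card {f \<in> V. \<not> l f}"
  proof (rule card_inj_on_le[where f = "\<lambda>f x. f x \<noteq> v x"])
    show "inj_on (\<lambda>f x. f x \<noteq> v x) {f \<in> V. l f}"
      by (rule inj_onI) (auto simp: fun_eq_iff)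
    show "(\<lambda>f x. f x \<noteq> v x) ` {f \<in> V. l f} \<subseteq> {f \<in> V. \<not> l f}"
      using v l xor_closedD[OF assms(2)] by auto
  qed (use assms in auto)
  moreover have "card V = card {f \<in> V. l f} + card {f \<in> V. \<not> l f}"
    using assms(1) by (subst card_Un_disjoint[symmetric]) (auto intro: arg_cong[where f = card])
  ultimately show ?thesis by simp
next
  case False
  then have "{f \<in> V. \<not> l f} = V" by auto
  then show ?thesis by simp
qed

text \<open>Each functional at most halves what is left, and what is left is again closed under
  addition.\<close>

lemma card_le_common_kernel:
  assumes "finite J" "finite V" "xor_closed V"
    and l: "\<And>j f g. f \<in> V \<Longrightarrow> g \<in> V \<Longrightarrow> l j (\<lambda>x. f x \<noteq> g x) = (l j f \<noteq> l j g)"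
  shows "card V \<le> 2 ^ card J * card {f \<in> V. \<forall>j\<in>J. \<not> l j f}"
  using assms(1)
proof (induction J)
  case (insert a J)
  let ?V = "{f \<in> V. \<forall>j\<in>J. \<not> l j f}"
  have "xor_closed ?V"
    using l xor_closedD[OF assms(3)] unfolding xor_closed_def by auto
  then have "card ?V \<le> 2 * card {f \<in> ?V. \<not> l a f}"
    by (intro card_le_double_kernel) (use assms in auto)
  moreover have "{f \<in> ?V. \<not> l a f} = {f \<in> V. \<forall>j\<in>insert a J. \<not> l j f}" by auto
  ultimately have "card ?V \<le> 2 * card {f \<in> V. \<forall>j\<in>insert a J. \<not> l j f}" by simp
  then have "2 ^ card J * card ?V \<le> 2 ^ card J * (2 * card {f \<in> V. \<forall>j\<in>insert a J. \<not> l j f})"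
    by simp
  also have "\<dots> = 2 ^ card (insert a J) * card {f \<in> V. \<forall>j\<in>insert a J. \<not> l j f}"
    using insert.hyps by simp
  finally show ?case using insert.IH by (rule order_trans[rotated])
qed simp

text \<open>A subspace of dimension d takes all values on some d coordinates. Coordinates are
  deleted one at a time: either deleting \<open>e\<close> is injective on \<open>V\<close>, or
  \<open>V\<close> contains the indicator of \<open>e\<close> and \<open>e\<close> can join
  \<open>B\<close>.\<close>

lemma linear_shattering:
  assumes "finite Y" "xor_closed V" "V \<noteq> {}" "\<And>f x. f \<in> V \<Longrightarrow> f x \<Longrightarrow> x \<in> Y"
  shows "\<exists>B\<subseteq>Y. card V \<le> 2 ^ card B \<and> (\<forall>Z\<subseteq>B. \<exists>f\<in>V. \<forall>y\<in>B. f y \<longleftrightarrow> y \<in> Z)"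
  using assms
proof (induction Y arbitrary: V)
  case empty
  have "f = (\<lambda>_. False)" if "f \<in> V" for f using empty(3) that by blast
  with empty(2) have "V = {\<lambda>_. False}" by blast
  then show ?case by auto
next
  case (insert e Y)
  define r where "r f = (\<lambda>x. f x \<and> x \<in> Y)" for f :: "'a \<Rightarrow> bool"
  have rV: "xor_closed (r ` V)"
    unfolding xor_closed_def
  proof clarify
    fix f g assume "f \<in> V" "g \<in> V"
    then have "(\<lambda>x. f x \<noteq> g x) \<in> V" by (rule xor_closedD[OF insert.prems(1)])
    moreover have "(\<lambda>x. r f x \<noteq> r g x) = r (\<lambda>x. f x \<noteq> g x)" by (auto simp: r_def)
    ultimately show "(\<lambda>x. r f x \<noteq> r g x) \<in> r ` V" by auto
  qed
  have rV0: "r ` V \<noteq> {}" using insert.prems by simp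
  have rVY: "x \<in> Y" if "f \<in> r ` V" "f x" for f x using that by (auto simp: r_def)
  have "\<exists>B\<subseteq>Y. card (r ` V) \<le> 2 ^ card B \<and> (\<forall>Z\<subseteq>B. \<exists>f\<in>r ` V. \<forall>y\<in>B. f y \<longleftrightarrow> y \<in> Z)"
    by (rule insert.IH[OF rV rV0]) (rule rVY)
  then obtain B where
    B: "B \<subseteq> Y" "card (r ` V) \<le> 2 ^ card B"
      and B3: "\<forall>Z\<subseteq>B. \<exists>f\<in>r ` V. \<forall>y\<in>B. f y \<longleftrightarrow> y \<in> Z" by (elim exE conjE)
  have shat: "\<exists>f\<in>V. \<forall>y\<in>B. f y \<longleftrightarrow> y \<in> Z" if "Z \<subseteq> B" for Z
    using B3[rule_format, OF that] B(1) by (auto simp: r_def)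
  have fB: "finite B" using B(1) insert.hyps finite_subset by blast
  have eB: "e \<notin> B" using B(1) insert.hyps by blast
  show ?case
  proof (cases "inj_on r V")
    case True
    then have "card (r ` V) = card V" by (rule card_image)
    with B shat show ?thesis by (intro exI[of _ B]) auto
  next
    case False
    then obtain f g where fg: "f \<in> V" "g \<in> V" "r f = r g" "f \<noteq> g" by (auto simp: inj_on_def)
    \<comment> \<open>\<open>f\<close> and \<open>g\<close> differ only at \<open>e\<close>, so
      adding \<open>d\<close> flips the value at \<open>e\<close> and leaves all others
      alone.\<close>
    define d where "d = (\<lambda>x. f x \<noteq> g x)"
    have dV: "d \<in> V" unfolding d_def by (rule xor_closedD) (use insert fg in auto)
    have d0: "\<not> d x" if "x \<noteq> e" for x
      using fun_cong[OF fg(3), of x] insert.prems(3)[OF fg(1), of x] insert.prems(3)[OF fg(2), of x] that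
      by (auto simp: d_def r_def)
    have de: "d e"
    proof -
      obtain x where "f x \<noteq> g x" using fg(4) by blast
      then have "d x" by (simp add: d_def)
      with d0 show ?thesis by (cases "x = e") auto
    qed
    have finrV: "finite (r ` V)"
    proof (rule finite_subset)
      show "r ` V \<subseteq> (\<lambda>S x. x \<in> S) ` Pow Y"
      proof clarify
        fix h assume "h \<in> V"
        show "r h \<in> (\<lambda>S x. x \<in> S) ` Pow Y"
          by (rule image_eqI[where x = "{x \<in> Y. h x}"]) (auto simp: r_def)
      qed
    qed (use insert.hyps in simp)
    have "card V \<le> card (r ` V \<times> (UNIV :: bool set))"
    proof (rule card_inj_on_le[where f = "\<lambda>f. (r f, f e)"])
      show "inj_on (\<lambda>f. (r f, f e)) V"
      proof (rule inj_onI, rule ext)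
        fix h k x assume *: "h \<in> V" "k \<in> V" "(r h, h e) = (r k, k e)"
        then have "r h x = r k x" "h e = k e" by auto
        then show "h x = k x"
          using insert.prems(3)[OF *(1), of x] insert.prems(3)[OF *(2), of x]
          by (auto simp: r_def)
      qed
    qed (use finrV in auto)
    also have "\<dots> = 2 * card (r ` V)" by (simp add: card_cartesian_product)
    also have "\<dots> \<le> 2 ^ card (insert e B)" using B(2) fB eB by simp
    finally have "card V \<le> 2 ^ card (insert e B)" .
    moreover have "\<exists>f\<in>V. \<forall>y\<in>insert e B. f y \<longleftrightarrow> y \<in> Z" if Z: "Z \<subseteq> insert e B" for Z
    proof -
      have "Z - {e} \<subseteq> B" using Z by blast
      from shat[OF this] obtain h where h: "h \<in> V" "\<forall>y\<in>B. h y \<longleftrightarrow> y \<in> Z - {e}" ..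
      show ?thesis
      proof (cases "h e = (e \<in> Z)")
        case True then show ?thesis using h eB by (intro bexI[of _ h]) auto
      next
        case False
        have "(\<lambda>x. h x \<noteq> d x) \<in> V" by (rule xor_closedD) (use insert h dV in auto)
        moreover have "\<not> d y" if "y \<in> B" for y using d0[of y] eB that by blast
        ultimately show ?thesis using h eB False de
          by (intro bexI[of _ "\<lambda>x. h x \<noteq> d x"]) auto
      qed
    qed
    ultimately show ?thesis using B(1) by (intro exI[of _ "insert e B"]) auto
  qed
qed

section \<open>Words and relators\<close>

type_synonym word = "bool list"

definition word_power :: "'a list \<Rightarrow> nat \<Rightarrow> 'a list" where
  "word_power w n = concat (replicate n w)"

lemma word_power_0 [simp]: "word_power w 0 = []" and word_power_Suc: "word_power w (Suc n) = w @ word_power w n"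
  by (auto simp: word_power_def)

lemma word_power_add: "word_power w (m + n) = word_power w m @ word_power w n"
  by (simp add: word_power_def replicate_add)

lemma word_power_mult: "word_power w (m * n) = word_power (word_power w m) n"
  by (induction n) (simp_all add: word_power_Suc word_power_add)

lemma word_power_Nil [simp]: "word_power [] n = []"
  by (induction n) (simp_all add: word_power_Suc)

text \<open>A proper divisor of a power of 2 divides its half. As \<open>to_nat\<close> is
  injective, the reciprocals of all exponents add up to at most 1/2.\<close>

definition relator_exponent :: "word \<Rightarrow> nat" where
  "relator_exponent w = 2 ^ (to_nat w + 2)"

lemma relator_exponent_pos [simp]: "relator_exponent w > 0" by (simp add: relator_exponent_def)

text \<open>Words have positive letters only; the relator of \<open>w\<close> turns this power into
  an inverse of \<open>w\<close>.\<close>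

definition word_inv :: "word \<Rightarrow> word" where
  "word_inv w = word_power w (relator_exponent w - 1)"

lemma append_word_inv: "w @ word_inv w = word_power w (relator_exponent w)"
  using word_power_Suc[of w "relator_exponent w - 1"] by (simp add: word_inv_def)

lemma word_inv_append: "word_inv w @ w = word_power w (relator_exponent w)"
  using word_power_add[of w "relator_exponent w - 1" 1] by (simp add: word_inv_def word_power_Suc)

text \<open>Congruences on the free monoid in two letters whose quotient satisfies every relator.
  Such a quotient is a group, so quotient groups are handled as relations on words.\<close>

locale torsion_congruence =
  fixes E :: "word \<Rightarrow> word \<Rightarrow> bool"
  assumes equivp: "equivp E"
    and cong_append: "E x y \<Longrightarrow> E z w \<Longrightarrow> E (x @ z) (y @ w)"
    and torsion: "E (word_power w (relator_exponent w)) []"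
begin

lemma E_refl [simp, intro]: "E x x" using equivp by (rule equivp_reflp)
lemma E_sym: "E x y \<Longrightarrow> E y x" using equivp by (rule equivp_symp)
lemma E_trans [trans]: "E x y \<Longrightarrow> E y z \<Longrightarrow> E x z" using equivp by (rule equivp_transp)
lemma E_iff: "E x y \<longleftrightarrow> E x = E y" using equivp by (auto simp: equivp_def)

lemma inv_right: "E (w @ word_inv w) []" by (simp add: append_word_inv torsion)
lemma inv_left: "E (word_inv w @ w) []" by (simp add: word_inv_append torsion)

lemma cong_left: "E x y \<Longrightarrow> E (z @ x) (z @ y)" by (auto intro: cong_append)
lemma cong_right: "E x y \<Longrightarrow> E (x @ z) (y @ z)" by (auto intro: cong_append)

lemma cancel_left: "E (z @ x) (z @ y) \<longleftrightarrow> E x y"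
proof
  assume "E (z @ x) (z @ y)"
  then have "E ((word_inv z @ z) @ x) ((word_inv z @ z) @ y)" using cong_left[of "z @ x" "z @ y" "word_inv z"] by simp
  moreover have "E ((word_inv z @ z) @ x) x" for x using cong_right[OF inv_left, of z x] by simp
  ultimately show "E x y" by (meson E_sym E_trans)
qed (rule cong_left)

lemma cancel_right: "E (x @ z) (y @ z) \<longleftrightarrow> E x y"
proof
  assume "E (x @ z) (y @ z)"
  then have "E (x @ (z @ word_inv z)) (y @ (z @ word_inv z))" using cong_right[of "x @ z" "y @ z" "word_inv z"] by simp
  moreover have "E (x @ (z @ word_inv z)) x" for x using cong_left[OF inv_right, of x z] by simp
  ultimately show "E x y" by (meson E_sym E_trans)
qed (rule cong_right)

lemma cong_word_power: "E x y \<Longrightarrow> E (word_power x n) (word_power y n)"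
  by (induction n) (auto simp: word_power_Suc intro: cong_append)

lemma word_power_eq_Nil_mult: "E (word_power w m) [] \<Longrightarrow> E (word_power w (m * n)) []"
  using cong_word_power[of "word_power w m" "[]" n] by (simp add: word_power_mult)

lemma word_power_gcd: assumes "E (word_power w a) []" "E (word_power w b) []" shows "E (word_power w (gcd a b)) []"
proof (cases "a = 0")
  case True then show ?thesis using assms by simp
next
  case False
  then obtain x y where xy: "a * x = b * y + gcd a b" using bezout_nat by blast
  have "E (word_power w (b * y) @ word_power w (gcd a b)) []"
    using word_power_eq_Nil_mult[OF assms(1), of x] by (simp add: xy word_power_add)
  moreover have "E (word_power w (b * y) @ word_power w (gcd a b)) (word_power w (gcd a b))"
    using cong_right[OF word_power_eq_Nil_mult[OF assms(2), of y]] by simp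
  ultimately show ?thesis by (meson E_sym E_trans)
qed

text \<open>The order of \<open>w\<close> divides \<open>relator_exponent w\<close>, a power of 2.
  If it is smaller than that, it divides the half.\<close>

lemma word_power_half:
  assumes "E (word_power w k) []" "0 < k" "k < relator_exponent w"
  shows "E (word_power w (relator_exponent w div 2)) []"
proof -
  have g: "E (word_power w (gcd k (relator_exponent w))) []" by (rule word_power_gcd[OF assms(1) torsion])
  obtain i where i: "i \<le> to_nat w + 2" "gcd k (relator_exponent w) = 2 ^ i"
    using divides_primepow_nat[of 2 "gcd k (relator_exponent w)" "to_nat w + 2"] by (auto simp: relator_exponent_def)
  have "(2::nat) ^ i < 2 ^ (to_nat w + 2)"
    using i(2) assms gcd_le1_nat[of k "relator_exponent w"] by (simp add: relator_exponent_def)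
  then have "i < to_nat w + 2" by (rule power_less_imp_less_exp[rotated]) simp
  then have "relator_exponent w div 2 = 2 ^ i * 2 ^ (to_nat w + 1 - i)"
    by (simp add: relator_exponent_def flip: power_add)
  then show ?thesis using word_power_eq_Nil_mult[OF g, of "2 ^ (to_nat w + 1 - i)"] i by simp
qed

definition rep :: "word \<Rightarrow> word" where "rep x = (SOME y. E x y)"

lemma E_rep [simp, intro]: "E x (rep x)" unfolding rep_def by (rule someI[of _ x]) simp

lemma rep_eq_iff: "rep x = rep y \<longleftrightarrow> E x y"
proof
  assume "E x y" then have "E x = E y" by (simp add: E_iff)
  then show "rep x = rep y" by (simp add: rep_def)
qed (metis E_rep E_sym E_trans)

lemma rep_rep [simp]: "rep (rep x) = rep x" by (simp add: rep_eq_iff E_sym)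

lemma rep_in_range: "y \<in> range rep \<Longrightarrow> rep y = y" by auto

end

section \<open>Cocycles on finite quotients\<close>

text \<open>The label \<open>c (s, x)\<close> belongs to the edge from \<open>x\<close> to
  \<open>s # x\<close> of the Cayley graph. \<open>integ c x\<close> adds the labels on the path
  from the empty word to \<open>x\<close>, which follows the letters of \<open>x\<close> from the
  right.\<close>

primrec integ :: "(bool \<times> word \<Rightarrow> bool) \<Rightarrow> word \<Rightarrow> bool" where
  "integ c [] = False"
| "integ c (s # x) = (c (s, x) \<noteq> integ c x)"

definition invar :: "(word \<Rightarrow> word \<Rightarrow> bool) \<Rightarrow> (bool \<times> word \<Rightarrow> bool) set" where
  "invar E = {c. \<forall>s x y. E x y \<longrightarrow> c (s, x) = c (s, y)}"

text \<open>Edge labellings of the quotient graph that sum to zero around every relator from every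
  base point \<open>t\<close>: the 1-cocycles over the field with two elements.\<close>

definition cocyc :: "(word \<Rightarrow> word \<Rightarrow> bool) \<Rightarrow> (bool \<times> word \<Rightarrow> bool) set" where
  "cocyc E = {c \<in> invar E. \<forall>w t. integ c (word_power w (relator_exponent w) @ t) = integ c t}"

text \<open>The base point \<open>t\<close> ranges over all words to make the relation compatible
  with multiplication on the right.\<close>

definition refine :: "(word \<Rightarrow> word \<Rightarrow> bool) \<Rightarrow> word \<Rightarrow> word \<Rightarrow> bool" where
  "refine E x y \<longleftrightarrow> E x y \<and> (\<forall>c\<in>cocyc E. \<forall>t. integ c (x @ t) = integ c (y @ t))"

lemma integ_xor: "integ (\<lambda>z. c z = (\<not> d z)) x = (integ c x = (\<not> integ d x))"
  by (induction x) auto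

lemma xor_closed_invar: "xor_closed (invar E)"
  unfolding xor_closed_def invar_def by auto

lemma xor_closed_cocyc: "xor_closed (cocyc E)"
  unfolding xor_closed_def
proof (intro ballI)
  fix f g assume *: "f \<in> cocyc E" "g \<in> cocyc E"
  then have "(\<lambda>x. f x \<noteq> g x) \<in> invar E"
    by (intro xor_closedD[OF xor_closed_invar]) (auto simp: cocyc_def)
  then show "(\<lambda>x. f x \<noteq> g x) \<in> cocyc E" using * by (simp add: cocyc_def integ_xor)
qed

lemma False_in_cocyc: "(\<lambda>_. False) \<in> cocyc E"
proof -
  have "integ (\<lambda>_. False) x = False" for x by (induction x) auto
  then show ?thesis by (simp add: cocyc_def invar_def)
qed

locale finite_congruence = torsion_congruence +
  assumes finite_range: "finite (range E)"
begin

lemma finite_reps: "finite (range rep)"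
proof -
  have "range rep = (\<lambda>q. SOME y. q y) ` range E" by (auto simp: rep_def)
  then show ?thesis using finite_range by simp
qed

lemma card_reps: "card (range rep) = card (range E)"
proof -
  have "bij_betw E (range rep) (range E)"
    unfolding bij_betw_def
  proof
    show "inj_on E (range rep)"
    proof (rule inj_onI)
      fix x y assume *: "x \<in> range rep" "y \<in> range rep" "E x = E y"
      have "rep x = rep y" using *(3) by (intro rep_eq_iff[THEN iffD2] E_iff[THEN iffD2])
      then show "x = y" using *(1,2)[THEN rep_in_range] by simp
    qed
    have "E (rep x) = E x" for x by (rule E_iff[THEN iffD1, symmetric]) (rule E_rep)
    then show "E ` range rep = range E" by (simp add: image_image)
  qed
  then show ?thesis by (rule bij_betw_same_card)
qed

lemma card_pos: "card (range E) > 0"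
  using finite_range by (simp add: card_gt_0_iff)

lemma invarD: "c \<in> invar E \<Longrightarrow> E x y \<Longrightarrow> c (s, x) = c (s, y)"
  by (auto simp: invar_def)

text \<open>The sum along \<open>z\<close> from a base point uses only labels of edges whose classes
  are determined by the class of that point.\<close>

lemma integ_append_cong:
  assumes "c \<in> invar E" "E x y"
  shows "(integ c (z @ x) \<noteq> integ c x) = (integ c (z @ y) \<noteq> integ c y)"
proof (induction z)
  case (Cons s z)
  have "c (s, z @ x) = c (s, z @ y)" by (rule invarD[OF assms(1)]) (rule cong_left[OF assms(2)])
  with Cons show ?case by auto
qed simp

lemma invar_rep: "c \<in> invar E \<Longrightarrow> c (s, x) = c (s, rep x)"
  by (rule invarD) auto

lemma bij_invar: "bij_betw (\<lambda>c. {z \<in> UNIV \<times> range rep. c z}) (invar E) (Pow (UNIV \<times> range rep))"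
proof (rule bij_betwI[where g = "\<lambda>A z. (fst z, rep (snd z)) \<in> A"])
  show "(\<lambda>A z. (fst z, rep (snd z)) \<in> A) \<in> Pow (UNIV \<times> range rep) \<rightarrow> invar E"
    by (auto simp: invar_def rep_eq_iff[THEN iffD2])
  show "(\<lambda>z. (fst z, rep (snd z)) \<in> {z \<in> UNIV \<times> range rep. c z}) = c" if "c \<in> invar E" for c
    using invar_rep[OF that] by (auto simp: fun_eq_iff)
qed auto

lemma finite_invar: "finite (invar E)"
  using bij_betw_finite[OF bij_invar] finite_reps by simp

text \<open>A labelling is free on the edges at the representatives, and two edges start at each of
  them.\<close>

lemma card_invar: "card (invar E) = 2 ^ (2 * card (range E))"
  using bij_betw_same_card[OF bij_invar] finite_reps
  by (simp add: card_Pow card_cartesian_product card_reps)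

lemma finite_cocyc: "finite (cocyc E)"
  by (rule finite_subset[OF _ finite_invar]) (auto simp: cocyc_def)

end

lemma finite_range_factor:
  assumes "finite (range h)" "\<And>x y. h x = h y \<Longrightarrow> f x = f y"
  shows "finite (range f)"
proof -
  have "f (inv_into UNIV h (h x)) = f x" for x by (rule assms(2)) (simp add: f_inv_into_f)
  then have "range f = (\<lambda>z. f (inv_into UNIV h z)) ` range h" by (simp add: image_image)
  then show ?thesis using assms(1) by simp
qed

section \<open>Counting the cocycles of a finite quotient\<close>

context finite_congruence
begin

lemma relator_cong:
  assumes "c \<in> invar E" "E x y"
  shows "(integ c (z @ x) = integ c x) = (integ c (z @ y) = integ c y)"
  using integ_append_cong[OF assms, of z] by auto

text \<open>The word \<open>w ^ n\<^sub>w\<close> is then a square of an element of the kernel, on which a cocycle with values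
  in a group of order two vanishes.\<close>

lemma relator_trivial:
  assumes "c \<in> invar E" "E (word_power w (relator_exponent w div 2)) []"
  shows "integ c (word_power w (relator_exponent w) @ t) = integ c t"
proof -
  let ?v = "word_power w (relator_exponent w div 2)"
  have "relator_exponent w = relator_exponent w div 2 + relator_exponent w div 2" by (simp add: relator_exponent_def)
  then have v: "word_power w (relator_exponent w) = ?v @ ?v" by (metis word_power_add)
  have "E (?v @ t) t" using cong_right[OF assms(2), of t] by simp
  from integ_append_cong[OF assms(1) this, of ?v] show ?thesis by (auto simp: v)
qed

text \<open>In the quotient, the loop of \<open>w\<close> based at a point of the
  \<open>w\<close>-orbit of \<open>t\<close> is the loop based at \<open>t\<close> with another
  starting point, so both have the same sum.\<close>

lemma relator_orbit:
  assumes "c \<in> invar E" "integ c (word_power w (relator_exponent w) @ t) = integ c t"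
  shows "integ c (word_power w (relator_exponent w) @ word_power w j @ t) = integ c (word_power w j @ t)"
proof -
  have comm: "word_power w (relator_exponent w) @ word_power w j @ t = word_power w j @ word_power w (relator_exponent w) @ t"
    by (metis add.commute append_assoc word_power_add)
  have "E (word_power w (relator_exponent w) @ t) t" using cong_right[OF torsion, of w t] by simp
  from integ_append_cong[OF assms(1) this, of "word_power w j"] assms(2) show ?thesis
    unfolding comm by auto
qed

text \<open>If the half power is nontrivial, \<open>w\<close> has order exactly
  \<open>relator_exponent w\<close>, so left multiplication by \<open>w\<close> splits the quotient
  into orbits of that length. \<open>T\<close> picks one point from each.\<close>

lemma orbit_representatives:
  assumes w: "\<not> E (word_power w (relator_exponent w div 2)) []"
  shows "\<exists>T. finite T \<and> relator_exponent w * card T \<le> card (range E) \<and> (\<forall>t. \<exists>t'\<in>T. \<exists>j. E t (word_power w j @ t'))"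
proof -
  define orb where "orb t t' \<longleftrightarrow> (\<exists>j. E t (word_power w j @ t'))" for t t'
  have orb_refl: "orb t t" for t unfolding orb_def by (rule exI[of _ 0]) simp
  have orb_sym: "orb t' t" if tt: "orb t t'" for t t'
  proof -
    obtain j where j: "E t (word_power w j @ t')" using tt by (auto simp: orb_def)
    \<comment> \<open>The power with exponent \<open>(relator_exponent w - 1) * j\<close> inverts
      the power with exponent \<open>j\<close>, because the exponents add up to a multiple of
      \<open>relator_exponent w\<close>.\<close>
    have "E (word_power w ((relator_exponent w - 1) * j) @ t) (word_power w ((relator_exponent w - 1) * j) @ word_power w j @ t')"
      by (rule cong_left[OF j])
    moreover have "word_power w ((relator_exponent w - 1) * j) @ word_power w j @ t' = word_power w (relator_exponent w * j) @ t'"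
    proof -
      have "relator_exponent w * j = (relator_exponent w - 1) * j + j"
        using relator_exponent_pos[of w] by (cases "relator_exponent w") simp_all
      then show ?thesis by (metis append_assoc word_power_add)
    qed
    moreover have "E (word_power w (relator_exponent w * j) @ t') t'"
      using cong_right[OF word_power_eq_Nil_mult[OF torsion, of w j], of t'] by simp
    ultimately have "E t' (word_power w ((relator_exponent w - 1) * j) @ t)"
      using E_sym E_trans by metis
    then show ?thesis unfolding orb_def by blast
  qed
  have orb_trans: "orb t t''" if tt: "orb t t'" "orb t' t''" for t t' t''
  proof -
    obtain j k where "E t (word_power w j @ t')" "E t' (word_power w k @ t'')" using tt by (auto simp: orb_def)
    then have "E t (word_power w (j + k) @ t'')"
      using E_trans[OF _ cong_left[of t' "word_power w k @ t''" "word_power w j"]] by (simp add: word_power_add)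
    then show ?thesis unfolding orb_def by blast
  qed
  define r where "r t = (SOME t'. orb t t')" for t
  have r: "orb t (r t)" for t unfolding r_def using orb_refl by (rule someI)
  have r_eq: "r t = r t'" if "orb t t'" for t t'
  proof -
    have "orb t = orb t'" using that orb_sym orb_trans by blast
    then show ?thesis by (simp add: r_def)
  qed
  have r_fix: "r t = t" if "t \<in> range r" for t
    using that r_eq[OF r] by auto
  \<comment> \<open>This says that the powers of \<open>w\<close> act freely and that distinct
    representatives lie in distinct orbits.\<close>
  have inj: "inj_on (\<lambda>(j, t). E (word_power w j @ t)) ({..<relator_exponent w} \<times> range r)"
  proof (rule inj_onI, clarsimp)
    fix j k s t assume j: "j < relator_exponent w" "k < relator_exponent w"
      and "E (word_power w j @ r s) = E (word_power w k @ r t)"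
    then have eq: "E (word_power w j @ r s) (word_power w k @ r t)" by (simp only: E_iff)
    have "orb (word_power w j @ r s) (r t)" using eq unfolding orb_def by blast
    moreover have "orb (word_power w j @ r s) (r s)" unfolding orb_def by blast
    ultimately have "orb (r s) (r t)" using orb_sym orb_trans by blast
    then have "r (r s) = r (r t)" by (rule r_eq)
    then have st: "r s = r t" by (simp only: r_fix[OF rangeI])
    with eq have jk: "E (word_power w j) (word_power w k)" by (simp only: cancel_right)
    have less: "\<not> E (word_power w a) (word_power w b)" if "a < b" "b < relator_exponent w" for a b
    proof
      assume "E (word_power w a) (word_power w b)"
      moreover have "word_power w b = word_power w a @ word_power w (b - a)" using that word_power_add[of w a "b - a"] by simp
      ultimately have "E (word_power w a @ []) (word_power w a @ word_power w (b - a))" by simp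
      then have "E [] (word_power w (b - a))" by (simp only: cancel_left)
      then have "E (word_power w (b - a)) []" by (rule E_sym)
      then have "E (word_power w (relator_exponent w div 2)) []" by (rule word_power_half) (use that in auto)
      with w show False ..
    qed
    have "j = k" using less[of j k] less[of k j] jk E_sym[OF jk] j by (cases j k rule: linorder_cases) auto
    with st show "j = k \<and> r s = r t" by simp
  qed
  have sub: "(\<lambda>(j, t). E (word_power w j @ t)) ` ({..<relator_exponent w} \<times> range r) \<subseteq> range E" by auto
  have "finite ({..<relator_exponent w} \<times> range r)" by (rule inj_on_finite[OF inj sub finite_range])
  moreover have "{..<relator_exponent w} \<noteq> {}" using relator_exponent_pos[of w] by (metis empty_iff lessThan_iff)
  ultimately have "finite (range r)" by (auto dest: finite_cartesian_productD2)
  moreover have "relator_exponent w * card (range r) \<le> card (range E)"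
    using card_inj_on_le[OF inj sub finite_range] by (simp add: card_cartesian_product)
  moreover have "\<forall>t. \<exists>t'\<in>range r. \<exists>j. E t (word_power w j @ t')" using r unfolding orb_def by blast
  ultimately show ?thesis by blast
qed

text \<open>Two labels per vertex are available. Only words of full order impose conditions, one for
  each orbit, and the number \<open>k\<close> of conditions is at most half the order of the
  quotient because the reciprocals of the exponents sum to at most 1/2.\<close>

lemma card_cocyc:
  "\<exists>k. 2 * k \<le> card (range E) \<and> 2 ^ (2 * card (range E)) \<le> 2 ^ k * card (cocyc E)"
proof -
  define m where "m = card (range E)"
  define W where "W = {w. \<not> E (word_power w (relator_exponent w div 2)) []}"
  have "\<forall>w\<in>W. \<exists>T. finite T \<and> relator_exponent w * card T \<le> m \<and> (\<forall>t. \<exists>t'\<in>T. \<exists>j. E t (word_power w j @ t'))"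
    using orbit_representatives by (simp add: W_def m_def)
  then obtain T where T: "\<And>w. w \<in> W \<Longrightarrow> finite (T w)" "\<And>w. w \<in> W \<Longrightarrow> relator_exponent w * card (T w) \<le> m"
    "\<And>w t. w \<in> W \<Longrightarrow> \<exists>t'\<in>T w. \<exists>j. E t (word_power w j @ t')" by metis
  \<comment> \<open>A word of full order has an orbit of that length in the quotient, which bounds
    its exponent by \<open>m\<close>. Hence \<open>W\<close> is finite.\<close>
  have Wm: "to_nat w < m" if "w \<in> W" for w
  proof -
    have "card (T w) > 0" using T(1)[OF that] T(3)[OF that, of "[]"] by (auto simp: card_gt_0_iff)
    then have "relator_exponent w \<le> m" using T(2)[OF that] by (metis Suc_leI le_trans mult.right_neutral mult_le_mono2 One_nat_def)
    moreover have "to_nat w + 2 < relator_exponent w" unfolding relator_exponent_def by (rule less_exp)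
    ultimately show ?thesis by simp
  qed
  have injW: "inj_on to_nat W" by (rule inj_on_subset[OF inj_to_nat]) simp
  have finW: "finite W" by (rule inj_on_finite[OF injW, of "{..<m}"]) (use Wm in auto)
  define J where "J = Sigma W T"
  have finJ: "finite J" unfolding J_def using finW T(1) by auto
  have cardJ: "2 * card J \<le> m"
  proof -
    have "real (card J) = (\<Sum>w\<in>W. real (card (T w)))"
      unfolding J_def using finW T(1) by (simp add: card_SigmaI)
    \<comment> \<open>The reciprocal of \<open>relator_exponent w\<close> is
      \<open>1/4 * (1/2) ^ to_nat w\<close>, and a geometric series bounds the sum.\<close>
    also have "\<dots> \<le> (\<Sum>w\<in>W. real m / 4 * (1/2) ^ to_nat w)"
    proof (rule sum_mono)
      fix w assume "w \<in> W"
      then have "real (relator_exponent w * card (T w)) \<le> real m" using T(2) of_nat_le_iff by blast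
      then show "real (card (T w)) \<le> real m / 4 * (1/2) ^ to_nat w"
        by (simp add: relator_exponent_def field_simps power_add)
    qed
    also have "\<dots> = real m / 4 * (\<Sum>n\<in>to_nat ` W. (1/2) ^ n)"
      by (simp add: sum_distrib_left sum.reindex[OF injW])
    also have "\<dots> \<le> real m / 4 * (\<Sum>n<m. (1/2) ^ n)"
      by (intro mult_left_mono sum_mono2) (use Wm in auto)
    also have "\<dots> \<le> real m / 4 * 2"
      by (intro mult_left_mono) (simp_all add: sum_gp_strict)
    finally show ?thesis by simp
  qed
  let ?l = "\<lambda>(w, t) c. integ c (word_power w (relator_exponent w) @ t) \<noteq> integ c t"
  have "card (invar E) \<le> 2 ^ card J * card {c \<in> invar E. \<forall>j\<in>J. \<not> ?l j c}"
    by (rule card_le_common_kernel[OF finJ finite_invar xor_closed_invar])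
      (auto simp: integ_xor)
  moreover have "{c \<in> invar E. \<forall>j\<in>J. \<not> ?l j c} \<subseteq> cocyc E"
  proof
    fix c assume "c \<in> {c \<in> invar E. \<forall>j\<in>J. \<not> ?l j c}"
    then have c: "c \<in> invar E" and cJ: "\<And>w t. w \<in> W \<Longrightarrow> t \<in> T w \<Longrightarrow> integ c (word_power w (relator_exponent w) @ t) = integ c t"
      by (auto simp: J_def)
    have "integ c (word_power w (relator_exponent w) @ t) = integ c t" for w t
    proof (cases "w \<in> W")
      case True
      then obtain t' j where t: "t' \<in> T w" "E t (word_power w j @ t')" using T(3) by blast
      show ?thesis using relator_cong[OF c t(2)] relator_orbit[OF c cJ[OF True t(1)]] by simp
    next
      case False then show ?thesis using relator_trivial[OF c] by (simp add: W_def)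
    qed
    then show "c \<in> cocyc E" using c by (simp add: cocyc_def)
  qed
  then have "card {c \<in> invar E. \<forall>j\<in>J. \<not> ?l j c} \<le> card (cocyc E)"
    by (rule card_mono[OF finite_cocyc])
  ultimately have "card (invar E) \<le> 2 ^ card J * card (cocyc E)"
    by (meson le_trans mult_le_mono2)
  then show ?thesis using cardJ card_invar unfolding m_def by auto
qed

section \<open>The refined quotient\<close>

lemma cocyc_invar: "c \<in> cocyc E \<Longrightarrow> c \<in> invar E" by (simp add: cocyc_def)

lemma refineI: "E x y \<Longrightarrow> (\<And>c t. c \<in> cocyc E \<Longrightarrow> integ c (x @ t) = integ c (y @ t)) \<Longrightarrow> refine E x y"
  by (simp add: refine_def)

lemma refine_imp: "refine E x y \<Longrightarrow> E x y" by (simp add: refine_def)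

lemma refine_integ: "refine E x y \<Longrightarrow> c \<in> cocyc E \<Longrightarrow> integ c x = integ c y"
  unfolding refine_def by (metis append_Nil2)

lemma equivp_refine: "equivp (refine E)"
  by (rule equivpI) (auto simp: reflp_def symp_def transp_def refine_def intro: E_sym E_trans)

text \<open>The sum along \<open>x\<close> from \<open>t\<close> depends on \<open>t\<close> only
  through its class, so base points in a finite set of representatives suffice. This makes the
  refined quotient finite.\<close>

lemma refine_determined:
  assumes "E x = E y" "\<And>c t. c \<in> cocyc E \<Longrightarrow> t \<in> range rep \<Longrightarrow> integ c (x @ t) = integ c (y @ t)"
  shows "refine E x = refine E y"
proof -
  have xy: "E x y" using assms(1) by (simp only: E_iff)
  have "refine E x y"
  proof (rule refineI[OF xy])
    fix c t assume c: "c \<in> cocyc E"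
    show "integ c (x @ t) = integ c (y @ t)"
      using integ_append_cong[OF cocyc_invar[OF c] E_rep[of t], of x]
        integ_append_cong[OF cocyc_invar[OF c] E_rep[of t], of y]
        assms(2)[OF c, of "rep t"] by auto
  qed
  then show ?thesis using equivp_refine unfolding equivp_def by blast
qed

lemma finite_range_refine: "finite (range (refine E))"
proof -
  let ?h = "\<lambda>x. (E x, {(c, t) \<in> cocyc E \<times> range rep. integ c (x @ t)})"
  have "finite (range ?h)"
  proof (rule finite_subset)
    show "range ?h \<subseteq> range E \<times> Pow (cocyc E \<times> range rep)" by auto
  qed (use finite_range finite_cocyc finite_reps in auto)
  moreover have "refine E x = refine E y" if "?h x = ?h y" for x y
    by (rule refine_determined) (use that in \<open>auto simp: set_eq_iff\<close>)
  ultimately show ?thesis by (rule finite_range_factor)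
qed

lemma finite_congruence_refine: "finite_congruence (refine E)"
proof
  show "equivp (refine E)" by (rule equivp_refine)
  show "refine E (x @ z) (y @ w)" if "refine E x y" "refine E z w" for x y z w
  proof (rule refineI)
    show "E (x @ z) (y @ w)" using that cong_append by (auto simp: refine_def)
    fix c t assume c: "c \<in> cocyc E"
    have "E (z @ t) (w @ t)" using that cong_right by (auto simp: refine_def)
    from integ_append_cong[OF cocyc_invar[OF c] this, of x] that c
    have "integ c (x @ z @ t) = integ c (x @ w @ t)" by (auto simp: refine_def)
    also have "\<dots> = integ c (y @ w @ t)" using that c by (auto simp: refine_def)
    finally show "integ c ((x @ z) @ t) = integ c ((y @ w) @ t)" by simp
  qed
  show "refine E (word_power w (relator_exponent w)) []" for w
    by (rule refineI[OF torsion]) (simp add: cocyc_def)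
  show "finite (range (refine E))" by (rule finite_range_refine)
qed

text \<open>At most half as many conditions as vertices are imposed on twice as many labels as
  vertices.\<close>

lemma card_cocyc_gt: "2 ^ card (range E) < card (cocyc E)"
proof -
  obtain k where k: "2 * k \<le> card (range E)" "2 ^ (2 * card (range E)) \<le> 2 ^ k * card (cocyc E)"
    using card_cocyc by blast
  have "k < card (range E)" using k(1) card_pos by linarith
  then have "(2::nat) ^ k < 2 ^ card (range E)" by simp
  then have "2 ^ k * 2 ^ card (range E) < (2::nat) ^ (2 * card (range E))"
    by (simp add: mult_2 power_add)
  with k(2) have "(2::nat) ^ k * 2 ^ card (range E) < 2 ^ k * card (cocyc E)" by linarith
  then show ?thesis by simp
qed

text \<open>Otherwise every cocycle would be the coboundary of the function \<open>integ c\<close>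
  on the quotient, and a quotient with m elements carries only 2 to the power m such functions,
  fewer than there are cocycles.\<close>

lemma refine_proper: "\<exists>x y. E x y \<and> \<not> refine E x y"
proof (rule ccontr)
  assume "\<not> ?thesis"
  then have inv: "integ c x = integ c y" if "E x y" "c \<in> cocyc E" for c x y
    using refine_integ that by blast
  have "card (cocyc E) \<le> card (Pow (range rep))"
  proof (rule card_inj_on_le[where f = "\<lambda>c. {x \<in> range rep. integ c x}"])
    show "inj_on (\<lambda>c. {x \<in> range rep. integ c x}) (cocyc E)"
    proof (rule inj_onI, rule ext)
      fix c d and z :: "bool \<times> word" assume cd: "c \<in> cocyc E" "d \<in> cocyc E"
        and eq: "{x \<in> range rep. integ c x} = {x \<in> range rep. integ d x}"
      have eq': "integ c x = integ d x" for x
        using eq inv[OF E_rep[of x]] cd by (auto simp: set_eq_iff)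
      obtain s x where "z = (s, x)" by (cases z)
      then show "c z = d z" using eq'[of "s # x"] eq'[of x] by auto
    qed
  qed (use finite_reps in auto)
  then have "card (cocyc E) \<le> 2 ^ card (range E)" using finite_reps by (simp add: card_Pow card_reps)
  then show False using card_cocyc_gt by simp
qed

text \<open>The refined quotient maps onto the old one, and by \<open>refine_proper\<close> not
  injectively.\<close>

lemma card_refine: "card (range E) < card (range (refine E))"
proof -
  interpret refined: finite_congruence "refine E" by (rule finite_congruence_refine)
  let ?f = "\<lambda>q. E (SOME x. q = refine E x)"
  have f: "?f (refine E x) = E x" for x
  proof -
    have "refine E x = refine E (SOME y. refine E x = refine E y)" by (rule someI[of _ x]) simp
    then have "refine E x (SOME y. refine E x = refine E y)" by (simp only: refined.E_iff)
    from refine_imp[OF this] show ?thesis by (simp only: E_iff)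
  qed
  then have im: "?f ` range (refine E) = range E" by (simp add: image_image)
  have "\<not> inj_on ?f (range (refine E))"
  proof
    assume inj: "inj_on ?f (range (refine E))"
    obtain x y where xy: "E x y" "\<not> refine E x y" using refine_proper by blast
    have "?f (refine E x) = ?f (refine E y)" unfolding f using xy(1) by (simp only: E_iff)
    then have "refine E x = refine E y" using inj by (auto dest: inj_onD)
    then have "refine E x y" by (simp only: refined.E_iff)
    with xy(2) show False ..
  qed
  then show ?thesis
    using card_image_le[OF finite_range_refine, of ?f] eq_card_imp_inj_on[OF finite_range_refine, of ?f]
    unfolding im by linarith
qed

end

section \<open>The tower of finite quotients and its limit\<close>

primrec level :: "nat \<Rightarrow> word \<Rightarrow> word \<Rightarrow> bool" where
  "level 0 = (\<lambda>_ _. True)"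
| "level (Suc n) = refine (level n)"

interpretation level: finite_congruence "level n" for n
proof (induction n)
  case 0
  show ?case
    by unfold_locales (auto simp: equivp_def)
next
  case (Suc n)
  then interpret finite_congruence "level n" .
  show ?case by (simp add: finite_congruence_refine)
qed

lemma level_mono: "m \<le> n \<Longrightarrow> level n x y \<Longrightarrow> level m x y"
  by (induction n rule: dec_induct) (auto dest: level.refine_imp)

lemma card_level: "n < card (range (level n))"
proof (induction n)
  case 0 show ?case using level.card_pos[of 0] by simp
next
  case (Suc n) then show ?case using level.card_refine[of n] by simp
qed

text \<open>The intersection of the tower. Its quotient embeds into the product of the finite
  quotients, hence is residually finite.\<close>

definition limit_cong :: "word \<Rightarrow> word \<Rightarrow> bool" where
  "limit_cong x y \<longleftrightarrow> (\<forall>n. level n x y)"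

interpretation lim: torsion_congruence limit_cong
proof
  show "equivp limit_cong"
  proof (intro equivpI reflpI sympI transpI)
    show "limit_cong x x" for x by (simp add: limit_cong_def)
    show "limit_cong y x" if "limit_cong x y" for x y
      using that level.E_sym unfolding limit_cong_def by blast
    show "limit_cong x z" if "limit_cong x y" "limit_cong y z" for x y z
      using that level.E_trans unfolding limit_cong_def by blast
  qed
qed (auto simp: limit_cong_def level.torsion intro: level.cong_append)

section \<open>Independent sets of edges\<close>

text \<open>\<open>S\<close> plays the role of Schreier generators for the kernel of the quotient by
  \<open>E0\<close>: the edge from \<open>t\<close> by \<open>s\<close> ends in the coset of some
  \<open>t'\<close> and differs from \<open>t'\<close> by an element of \<open>S\<close>. Equality
  is taken modulo \<open>refine E\<close>, where all cocycles of \<open>E\<close> have well-defined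
  integrals.\<close>

locale congruence_pair =
  coarse: finite_congruence E0 + fine: finite_congruence E for E0 E +
  fixes S :: "word set"
  assumes le: "E x y \<Longrightarrow> E0 x y"
    and finite_S: "finite S"
    and S_kernel: "\<sigma> \<in> S \<Longrightarrow> E0 \<sigma> []"
    and S_generates: "t \<in> range coarse.rep \<Longrightarrow>
      \<exists>t'\<in>range coarse.rep. \<exists>\<sigma>\<in>S. refine E (s # t) (t' @ \<sigma>)"
begin

text \<open>Representatives of the kernel of the map from the quotient by \<open>E\<close> onto the
  quotient by \<open>E0\<close>.\<close>

definition kreps :: "word set" where "kreps = {h \<in> range fine.rep. E0 h []}"

lemma rep_kreps: "h \<in> kreps \<Longrightarrow> fine.rep h = h"
  unfolding kreps_def using fine.rep_in_range by blast

lemma finite_kreps: "finite kreps"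
  unfolding kreps_def using fine.finite_reps by (rule finite_subset[rotated]) auto

lemma rep_in_kreps: "E0 h [] \<Longrightarrow> fine.rep h \<in> kreps"
  unfolding kreps_def using le[OF fine.E_rep] coarse.E_sym coarse.E_trans by blast

lemma kreps_nonempty: "card kreps > 0"
  using rep_in_kreps[of "[]"] finite_kreps by (auto simp: card_gt_0_iff)

lemma E0_append_kernel: "E0 h [] \<Longrightarrow> E0 (t @ h) t"
  using coarse.cong_left[of h "[]" t] by simp

text \<open>Products of a coset representative and a kernel element are pairwise distinct in the
  quotient by \<open>E\<close>.\<close>

lemma card_product_le: "card (range E0) * card kreps \<le> card (range E)"
proof -
  have "card (range coarse.rep \<times> kreps) \<le> card (range E)"
  proof (rule card_inj_on_le[where f = "\<lambda>(t, h). E (t @ h)"])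
    show "inj_on (\<lambda>(t, h). E (t @ h)) (range coarse.rep \<times> kreps)"
    proof (rule inj_onI, clarify)
      fix s t h k assume hk: "h \<in> kreps" "k \<in> kreps"
        and "E (coarse.rep s @ h) = E (coarse.rep t @ k)"
      then have eq: "E (coarse.rep s @ h) (coarse.rep t @ k)" by (simp only: fine.E_iff)
      have "E0 (coarse.rep s @ h) (coarse.rep s)" "E0 (coarse.rep t @ k) (coarse.rep t)"
        using hk E0_append_kernel by (auto simp: kreps_def)
      with le[OF eq] have "E0 (coarse.rep s) (coarse.rep t)"
        using coarse.E_sym coarse.E_trans by blast
      then have "coarse.rep (coarse.rep s) = coarse.rep (coarse.rep t)" by (simp only: coarse.rep_eq_iff)
      then have st: "coarse.rep s = coarse.rep t" by simp
      with eq have "E h k" by (simp only: fine.cancel_left)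
      then have "fine.rep h = fine.rep k" by (simp only: fine.rep_eq_iff)
      then have "h = k" using hk by (simp only: rep_kreps)
      with st show "coarse.rep s = coarse.rep t \<and> h = k" by simp
    qed
  qed (use fine.finite_range in auto)
  then show ?thesis by (simp add: card_cartesian_product coarse.card_reps)
qed

text \<open>The values of a cocycle on the edges of the Cayley graph of the kernel with respect to
  \<open>S\<close>; the edge \<open>(h, \<sigma>)\<close> leads from \<open>h\<close> to
  \<open>\<sigma> @ h\<close>.\<close>

definition jump :: "(bool \<times> word \<Rightarrow> bool) \<Rightarrow> word \<times> word \<Rightarrow> bool" where
  "jump c z \<longleftrightarrow> z \<in> kreps \<times> S \<and> integ c (snd z @ fst z) \<noteq> integ c (fst z)"

text \<open>The sums along the paths that join kernel elements to the other points of the quotient,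
  recorded as a set in order to be counted by \<open>Pow\<close>.\<close>

definition spread :: "(bool \<times> word \<Rightarrow> bool) \<Rightarrow> (word \<times> word) set" where
  "spread c = {(t, h) \<in> range coarse.rep \<times> kreps. integ c (t @ h) \<noteq> integ c h}"

text \<open>An edge from \<open>t @ h\<close> by \<open>s\<close> ends at
  \<open>t' @ \<sigma> @ h\<close>. Its label is therefore fixed by the jump at
  \<open>(h, \<sigma>)\<close> and the spread values of \<open>t\<close> and \<open>t'\<close>.
  Applied to the difference \<open>e\<close> of the two cocycles, this shows that all labels of
  \<open>e\<close> vanish.\<close>

lemma cocyc_determined:
  assumes c: "c \<in> cocyc E" and d: "d \<in> cocyc E" and j: "jump c = jump d" and s: "spread c = spread d"
  shows "c = d"
proof -
  define e where "e = (\<lambda>z. c z \<noteq> d z)"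
  have e: "e \<in> cocyc E" unfolding e_def by (rule xor_closedD[OF xor_closed_cocyc c d])
  have integ_e: "integ e x = (integ c x \<noteq> integ d x)" for x by (simp add: e_def integ_xor)
  have jump0: "integ e (\<sigma> @ h) = integ e h" if "h \<in> kreps" "\<sigma> \<in> S" for h \<sigma>
    using fun_cong[OF j, of "(h, \<sigma>)"] that by (auto simp: jump_def integ_e)
  have spread0: "integ e (t @ h) = integ e h" if "h \<in> kreps" "t \<in> range coarse.rep" for h t
  proof -
    have "(t, h) \<in> spread c \<longleftrightarrow> (t, h) \<in> spread d" by (simp only: s)
    then show ?thesis using that unfolding spread_def integ_e by blast
  qed
  have lift: "integ e (z @ h) = integ e h"
    if "E0 h []" "\<And>h. h \<in> kreps \<Longrightarrow> integ e (z @ h) = integ e h" for z h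
    using fine.integ_append_cong[OF fine.cocyc_invar[OF e] fine.E_rep[of h], of z]
      that(2)[OF rep_in_kreps[OF that(1)]] by auto
  have "\<not> e (s, x)" for s x
  proof -
    define t where "t = coarse.rep x"
    \<comment> \<open>Every vertex \<open>x\<close> is congruent to \<open>t @ h\<close> with
      \<open>t\<close> its coarse representative and \<open>h\<close> in the kernel.\<close>
    define h where "h = word_inv t @ x"
    have tr: "t \<in> range coarse.rep" by (simp add: t_def)
    have h0: "E0 h []"
      using coarse.cong_left[OF coarse.E_rep[of x], of "word_inv t"] coarse.inv_left[of t] coarse.E_trans
      unfolding h_def t_def by blast
    have "E (t @ h) x" using fine.cong_right[OF fine.inv_right[of t], of x] by (simp add: h_def)
    then have "e (s, x) = e (s, t @ h)"
      using fine.invarD[OF fine.cocyc_invar[OF e]] fine.E_sym by blast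
    also have "\<dots> = (integ e (s # t @ h) \<noteq> integ e (t @ h))" by auto
    also have "integ e (t @ h) = integ e h" by (rule lift[OF h0]) (use spread0 tr in blast)
    also obtain t' \<sigma> where t': "t' \<in> range coarse.rep" and \<sigma>: "\<sigma> \<in> S" and gen: "refine E (s # t) (t' @ \<sigma>)"
      using S_generates[OF tr] by blast
    have "integ e ((s # t) @ h) = integ e ((t' @ \<sigma>) @ h)" using gen e by (auto simp: refine_def)
    then have "integ e (s # t @ h) = integ e (t' @ \<sigma> @ h)" by simp
    also have "\<dots> = integ e (\<sigma> @ h)"
    proof (rule lift)
      show "E0 (\<sigma> @ h) []" using coarse.cong_append[OF S_kernel[OF \<sigma>] h0] by simp
    qed (use spread0 t' in blast)
    also have "\<dots> = integ e h" by (rule lift[OF h0]) (use jump0 \<sigma> in blast)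
    finally show ?thesis by simp
  qed
  then show "c = d" by (auto simp: e_def fun_eq_iff)
qed

text \<open>A cocycle is a pair of jump and spread, and spreads are too few to account for all
  cocycles. So the jumps form a large space, and \<open>linear_shattering\<close> provides many
  edges on which jumps can be prescribed at will.\<close>

lemma shattered_edges:
  "\<exists>B \<subseteq> kreps \<times> S. card (range E0) * card kreps \<le> 2 * card B \<and>
     (\<forall>Z\<subseteq>B. \<exists>c\<in>cocyc E. \<forall>(h, \<sigma>)\<in>B. (integ c (\<sigma> @ h) \<noteq> integ c h) \<longleftrightarrow> (h, \<sigma>) \<in> Z)"
proof -
  define V where "V = jump ` cocyc E"
  define q where "q = card (range E0) * card kreps"
  have "xor_closed V"
    unfolding xor_closed_def V_def
  proof clarify
    fix c d assume "c \<in> cocyc E" "d \<in> cocyc E"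
    then have "(\<lambda>z. c z \<noteq> d z) \<in> cocyc E" by (rule xor_closedD[OF xor_closed_cocyc])
    moreover have "(\<lambda>z. jump c z \<noteq> jump d z) = jump (\<lambda>z. c z \<noteq> d z)"
      by (auto simp: jump_def integ_xor fun_eq_iff)
    ultimately show "(\<lambda>z. jump c z \<noteq> jump d z) \<in> jump ` cocyc E" by auto
  qed
  moreover have "V \<noteq> {}" using False_in_cocyc by (auto simp: V_def)
  moreover have "z \<in> kreps \<times> S" if "f \<in> V" "f z" for f z
    using that unfolding V_def jump_def by blast
  moreover have "finite (kreps \<times> S)" using finite_kreps finite_S by simp
  ultimately have "\<exists>B\<subseteq>kreps \<times> S. card V \<le> 2 ^ card B \<and> (\<forall>Z\<subseteq>B. \<exists>f\<in>V. \<forall>y\<in>B. f y \<longleftrightarrow> y \<in> Z)"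
    by (intro linear_shattering) auto
  then obtain B where B: "B \<subseteq> kreps \<times> S" "card V \<le> 2 ^ card B"
    and shat: "\<forall>Z\<subseteq>B. \<exists>f\<in>V. \<forall>y\<in>B. f y \<longleftrightarrow> y \<in> Z" by (elim exE conjE)
  have finV: "finite V" unfolding V_def using fine.finite_cocyc by simp
  have fin: "finite (range coarse.rep \<times> kreps)" using coarse.finite_reps finite_kreps by simp
  have "card (cocyc E) \<le> card (V \<times> Pow (range coarse.rep \<times> kreps))"
  proof (rule card_inj_on_le[where f = "\<lambda>c. (jump c, spread c)"])
    show "inj_on (\<lambda>c. (jump c, spread c)) (cocyc E)"
      by (rule inj_onI) (use cocyc_determined in blast)
    show "(\<lambda>c. (jump c, spread c)) ` cocyc E \<subseteq> V \<times> Pow (range coarse.rep \<times> kreps)"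
      by (auto simp: V_def spread_def)
  qed (use finV fin in blast)
  also have "\<dots> = card V * 2 ^ q"
    using fin by (simp add: card_cartesian_product card_Pow q_def coarse.card_reps)
  also have "\<dots> \<le> 2 ^ card B * 2 ^ q" using B(2) by simp
  finally have C: "card (cocyc E) \<le> 2 ^ (card B + q)" by (simp add: power_add)
  obtain k where k: "2 * k \<le> card (range E)" "2 ^ (2 * card (range E)) \<le> 2 ^ k * card (cocyc E)"
    using fine.card_cocyc by blast
  \<comment> \<open>Taking exponents gives \<open>2 * card (range E) \<le> k + card B + q\<close>.
    Since \<open>k\<close> is at most half of \<open>card (range E)\<close> and \<open>q\<close> at
    most all of it, \<open>q \<le> 2 * card B\<close> remains.\<close>
  have "(2::nat) ^ (2 * card (range E)) \<le> 2 ^ k * 2 ^ (card B + q)"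
    using k(2) C by (meson le_trans mult_le_mono2)
  then have "(2::nat) ^ (2 * card (range E)) \<le> 2 ^ (k + (card B + q))" by (simp add: power_add)
  then have "2 * card (range E) \<le> k + (card B + q)" by (rule power_le_imp_le_exp[rotated]) simp
  with k(1) card_product_le have "q \<le> 2 * card B" by (simp add: q_def)
  moreover have "\<exists>c\<in>cocyc E. \<forall>(h, \<sigma>)\<in>B. (integ c (\<sigma> @ h) \<noteq> integ c h) \<longleftrightarrow> (h, \<sigma>) \<in> Z" if "Z \<subseteq> B" for Z
  proof -
    from shat[rule_format, OF that] obtain f where "f \<in> V" and f: "\<forall>y\<in>B. f y \<longleftrightarrow> y \<in> Z" ..
    from \<open>f \<in> V\<close> obtain c where "c \<in> cocyc E" "f = jump c" by (auto simp: V_def)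
    then show ?thesis using f B(1) by (intro bexI[of _ c]) (auto simp: jump_def)
  qed
  ultimately show ?thesis using B(1) unfolding q_def by blast
qed

text \<open>\<open>A\<close> consists of the generators for which at least one eighth of the edges
  lie in the independent set \<open>B\<close>. Independent edges inside a vertex set
  \<open>X\<close> number at most \<open>card X\<close>, as jumps on them come from values at the
  vertices. Averaging over the right translates of \<open>X\<close> loses a factor of at most
  8.\<close>

lemma sparse_subset:
  assumes card_S: "card S \<le> 2 * card (range E0)"
  shows "\<exists>A\<subseteq>S. card (range E0) \<le> 4 * card A \<and>
    (\<forall>X x0. finite X \<longrightarrow> (\<forall>x\<in>X. E0 x x0) \<longrightarrow> (\<forall>x\<in>X. \<forall>y\<in>X. E x y \<longrightarrow> x = y) \<longrightarrow>
       card {(x, \<sigma>) \<in> X \<times> A. \<exists>y\<in>X. refine E (\<sigma> @ x) y} \<le> 8 * card X)"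
proof -
  obtain B where B: "B \<subseteq> kreps \<times> S" "card (range E0) * card kreps \<le> 2 * card B"
    and shat: "\<And>Z. Z \<subseteq> B \<Longrightarrow> \<exists>c\<in>cocyc E. \<forall>(h, \<sigma>)\<in>B. (integ c (\<sigma> @ h) \<noteq> integ c h) \<longleftrightarrow> (h, \<sigma>) \<in> Z"
    using shattered_edges by blast
  define p where "p = card kreps"
  have p: "p > 0" using kreps_nonempty by (simp add: p_def)
  have finB: "finite B" using B(1) finite_kreps finite_S finite_subset by blast
  define F where "F \<sigma> = card {h \<in> kreps. (h, \<sigma>) \<in> B}" for \<sigma>
  have F_le: "F \<sigma> \<le> p" for \<sigma> unfolding F_def p_def by (rule card_mono[OF finite_kreps]) auto
  define A where "A = {\<sigma> \<in> S. p \<le> 8 * F \<sigma>}"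
  have AS: "A \<subseteq> S" by (auto simp: A_def)
  have finA: "finite A" using AS finite_S by (rule finite_subset)
  have "card B = card (SIGMA \<sigma>:S. {h \<in> kreps. (h, \<sigma>) \<in> B})"
    by (rule bij_betw_same_card[of prod.swap], rule bij_betwI[where g = prod.swap]) (use B(1) in auto)
  also have "\<dots> = (\<Sum>\<sigma>\<in>S. F \<sigma>)" using finite_S finite_kreps by (simp add: card_SigmaI F_def)
  finally have "8 * card B = (\<Sum>\<sigma>\<in>S. 8 * F \<sigma>)" by (simp add: sum_distrib_left)
  \<comment> \<open>A generator outside \<open>A\<close> contributes less than \<open>p\<close>. All
    such contributions together are at most half of the lower bound for \<open>8 * card B\<close>,
    so the rest must come from \<open>A\<close>.\<close>
  also have "\<dots> \<le> (\<Sum>\<sigma>\<in>S. (if \<sigma> \<in> A then 8 * p else 0) + p)"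
  proof (rule sum_mono)
    fix \<sigma> assume "\<sigma> \<in> S"
    then show "8 * F \<sigma> \<le> (if \<sigma> \<in> A then 8 * p else 0) + p"
      using F_le[of \<sigma>] by (auto simp: A_def)
  qed
  also have "\<dots> = 8 * p * card A + card S * p"
    using AS finite_S by (simp add: sum.distrib sum.If_cases Int_absorb1)
  also have "card S * p \<le> 2 * card (range E0) * p" using card_S by simp
  finally have "8 * card B \<le> 8 * (p * card A) + 2 * (card (range E0) * p)"
    by (simp only: mult.assoc add_left_mono)
  moreover have "4 * (card (range E0) * p) \<le> 8 * card B" using B(2) by (simp add: p_def)
  ultimately have "card (range E0) * p \<le> 4 * (p * card A)" by linarith
  also have "\<dots> = 4 * card A * p" by simp
  finally have "card (range E0) \<le> 4 * card A" using p by (simp only: mult_le_cancel2)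
  moreover have "card {(x, \<sigma>) \<in> X \<times> A. \<exists>y\<in>X. refine E (\<sigma> @ x) y} \<le> 8 * card X"
    if finX: "finite X" and X0: "\<forall>x\<in>X. E0 x x0" and Xinj: "\<forall>x\<in>X. \<forall>y\<in>X. E x y \<longrightarrow> x = y" for X x0
  proof -
    define D where "D = {(x, \<sigma>) \<in> X \<times> A. \<exists>y\<in>X. refine E (\<sigma> @ x) y}"
    have finD: "finite D" by (rule finite_subset[of _ "X \<times> A"]) (use finX finA in \<open>auto simp: D_def\<close>)
    \<comment> \<open>Multiplication by \<open>word_inv x0\<close> on the right moves
      \<open>X\<close> into the kernel, and \<open>g\<close> then moves it around there. Right
      translations commute with the left multiplications that define the edges.\<close>
    define \<tau> where "\<tau> g x = x @ word_inv x0 @ g" for g x :: word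
    define \<rho> where "\<rho> g x = fine.rep (\<tau> g x)" for g x
    have \<tau>0: "E0 (\<tau> g x) []" if "x \<in> X" "g \<in> kreps" for g x
    proof -
      have "E0 (x @ word_inv x0 @ g) (x0 @ word_inv x0 @ [])"
        using that X0 by (intro coarse.cong_append) (auto simp: kreps_def)
      then show ?thesis using coarse.inv_right[of x0] coarse.E_trans unfolding \<tau>_def by auto
    qed
    have \<rho>_kreps: "\<rho> g x \<in> kreps" if "x \<in> X" "g \<in> kreps" for g x
      unfolding \<rho>_def by (rule rep_in_kreps) (rule \<tau>0[OF that])
    have E_\<rho>: "E (\<tau> g x) (\<rho> g x)" for g x unfolding \<rho>_def by (rule fine.E_rep)
    have \<rho>_inj1: "x = y" if "x \<in> X" "y \<in> X" "\<rho> g x = \<rho> g y" for x y g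
    proof -
      have "E (\<tau> g x) (\<tau> g y)" using that(3) by (simp only: \<rho>_def fine.rep_eq_iff)
      then have "E x y" by (simp only: \<tau>_def fine.cancel_right)
      with Xinj that show ?thesis by blast
    qed
    have \<rho>_inj2: "inj_on (\<lambda>g. \<rho> g x) kreps" for x
    proof (rule inj_onI)
      fix g h assume gh: "g \<in> kreps" "h \<in> kreps" and "\<rho> g x = \<rho> h x"
      then have "E (\<tau> g x) (\<tau> h x)" by (simp only: \<rho>_def fine.rep_eq_iff)
      then have "E g h" by (simp only: \<tau>_def fine.cancel_left)
      then have "fine.rep g = fine.rep h" by (simp only: fine.rep_eq_iff)
      then show "g = h" using gh by (simp only: rep_kreps)
    qed
    define Bg where "Bg g = {(x, \<sigma>) \<in> D. (\<rho> g x, \<sigma>) \<in> B}" for g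
    have finBg: "finite (Bg g)" for g by (rule finite_subset[OF _ finD]) (auto simp: Bg_def)
    \<comment> \<open>Every subset \<open>Z\<close> of the edges in \<open>Bg g\<close> is cut out
      by a cocycle \<open>c Z\<close>. The set \<open>I Z\<close> of vertices where its integral is
      odd already determines \<open>Z\<close>, so there are no more subsets of \<open>Bg g\<close>
      than subsets of \<open>X\<close>.\<close>
    have Bg_le: "card (Bg g) \<le> card X" if g: "g \<in> kreps" for g
    proof -
      define \<phi> where "\<phi> = (\<lambda>(x, \<sigma>). (\<rho> g x, \<sigma> :: word))"
      have \<phi>_inj: "inj_on \<phi> (Bg g)"
        by (rule inj_onI) (auto simp: \<phi>_def Bg_def D_def dest: \<rho>_inj1)
      have \<phi>B: "\<phi> ` Bg g \<subseteq> B" by (auto simp: \<phi>_def Bg_def)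
      have "\<forall>Z\<in>Pow (Bg g). \<exists>c. c \<in> cocyc E \<and>
          (\<forall>(h, \<sigma>)\<in>B. (integ c (\<sigma> @ h) \<noteq> integ c h) \<longleftrightarrow> (h, \<sigma>) \<in> \<phi> ` Z)"
      proof
        fix Z assume "Z \<in> Pow (Bg g)"
        then have "\<phi> ` Z \<subseteq> B" using \<phi>B by blast
        from shat[OF this] show "\<exists>c. c \<in> cocyc E \<and>
          (\<forall>(h, \<sigma>)\<in>B. (integ c (\<sigma> @ h) \<noteq> integ c h) \<longleftrightarrow> (h, \<sigma>) \<in> \<phi> ` Z)" by (simp only: Bex_def)
      qed
      from bchoice[OF this] obtain c where cZ': "\<forall>Z\<in>Pow (Bg g). c Z \<in> cocyc E \<and>
          (\<forall>(h, \<sigma>)\<in>B. (integ (c Z) (\<sigma> @ h) \<noteq> integ (c Z) h) \<longleftrightarrow> (h, \<sigma>) \<in> \<phi> ` Z)" ..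
      have c: "c Z \<in> cocyc E" if "Z \<in> Pow (Bg g)" for Z using bspec[OF cZ' that] by (rule conjunct1)
      have cZ: "\<forall>(h, \<sigma>)\<in>B. (integ (c Z) (\<sigma> @ h) \<noteq> integ (c Z) h) \<longleftrightarrow> (h, \<sigma>) \<in> \<phi> ` Z"
        if "Z \<in> Pow (Bg g)" for Z using bspec[OF cZ' that] by (rule conjunct2)
      have \<phi>x: "\<phi> (x, \<sigma>) = (\<rho> g x, \<sigma>)" for x \<sigma> by (simp add: \<phi>_def)
      define I where "I Z = {x \<in> X. integ (c Z) (\<tau> g x)}" for Z
      have mem: "(x, \<sigma>) \<in> Z \<longleftrightarrow> (y \<in> I Z) \<noteq> (x \<in> I Z)"
        if Z: "Z \<in> Pow (Bg g)" and x: "(x, \<sigma>) \<in> Bg g" and y: "y \<in> X" "refine E (\<sigma> @ x) y" for x \<sigma> y Z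
      proof -
        have xX: "x \<in> X" and hB: "(\<rho> g x, \<sigma>) \<in> B" using x by (auto simp: Bg_def D_def)
        have "(x, \<sigma>) \<in> Z \<longleftrightarrow> \<phi> (x, \<sigma>) \<in> \<phi> ` Z"
          by (rule inj_on_image_mem_iff[OF \<phi>_inj x, symmetric]) (use Z in blast)
        also have "\<dots> \<longleftrightarrow> (integ (c Z) (\<sigma> @ \<rho> g x) \<noteq> integ (c Z) (\<rho> g x))"
          using bspec[OF cZ[OF Z] hB] by (simp add: \<phi>x)
        also have "\<dots> \<longleftrightarrow> (integ (c Z) (\<sigma> @ \<tau> g x) \<noteq> integ (c Z) (\<tau> g x))"
          by (rule fine.integ_append_cong[OF fine.cocyc_invar[OF c[OF Z]] E_\<rho>, symmetric])
        \<comment> \<open>The end of the edge agrees with \<open>y\<close> modulo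
          \<open>refine E\<close>, which is what lets cocycles take the same value there.\<close>
        also have "integ (c Z) (\<sigma> @ \<tau> g x) = integ (c Z) (\<tau> g y)"
        proof -
          have "integ (c Z) ((\<sigma> @ x) @ word_inv x0 @ g) = integ (c Z) (y @ word_inv x0 @ g)"
            using y(2) c[OF Z] by (simp only: refine_def)
          then show ?thesis by (simp add: \<tau>_def)
        qed
        finally show ?thesis using xX y(1) by (auto simp: I_def)
      qed
      have "card (Pow (Bg g)) \<le> card (Pow X)"
      proof (rule card_inj_on_le[where f = I])
        show "inj_on I (Pow (Bg g))"
        proof (rule inj_onI)
          fix Z Z' assume Z: "Z \<in> Pow (Bg g)" "Z' \<in> Pow (Bg g)" "I Z = I Z'"
          have "z \<in> Z \<longleftrightarrow> z \<in> Z'" if "z \<in> Bg g" for z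
          proof -
            obtain x \<sigma> where z: "z = (x, \<sigma>)" by (cases z)
            with that obtain y where "y \<in> X" "refine E (\<sigma> @ x) y" by (auto simp: Bg_def D_def)
            with mem[OF Z(1), of x \<sigma> y] mem[OF Z(2), of x \<sigma> y] that z Z(3) show ?thesis by simp
          qed
          then show "Z = Z'" using Z(1,2) by blast
        qed
      qed (use finX in \<open>auto simp: I_def\<close>)
      then have "(2::nat) ^ card (Bg g) \<le> 2 ^ card X" using finX finBg by (simp add: card_Pow)
      then show ?thesis by (rule power_le_imp_le_exp[rotated]) simp
    qed
    \<comment> \<open>As \<open>g\<close> runs through the kernel, the translate of \<open>x\<close>
      meets each kernel element exactly once.\<close>
    have count: "card {g \<in> kreps. (\<rho> g x, \<sigma>) \<in> B} = F \<sigma>" if "x \<in> X" for x \<sigma>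
    proof -
      let ?f = "\<lambda>g. \<rho> g x"
      have surj: "?f ` kreps = kreps"
        by (rule endo_inj_surj[OF finite_kreps _ \<rho>_inj2]) (use \<rho>_kreps that in auto)
      have filter_image: "f ` {g \<in> K. P (f g)} = {h \<in> f ` K. P h}" for f :: "word \<Rightarrow> word" and K P
        by auto
      have "card {g \<in> kreps. (?f g, \<sigma>) \<in> B} = card (?f ` {g \<in> kreps. (?f g, \<sigma>) \<in> B})"
        by (rule card_image[symmetric], rule inj_on_subset[OF \<rho>_inj2[of x]]) auto
      also have "\<dots> = F \<sigma>" using filter_image[of ?f kreps "\<lambda>h. (h, \<sigma>) \<in> B"] by (simp add: surj F_def)
      finally show ?thesis .
    qed
    \<comment> \<open>Double counting of the pairs of an edge in \<open>D\<close> and a translation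
      that moves it into \<open>B\<close>.\<close>
    have "p * card D = (\<Sum>z\<in>D. p)" by simp
    also have "\<dots> \<le> (\<Sum>z\<in>D. 8 * card {g \<in> kreps. (\<rho> g (fst z), snd z) \<in> B})"
      by (rule sum_mono) (auto simp: D_def count A_def)
    also have "\<dots> = 8 * (\<Sum>z\<in>D. card {g \<in> kreps. (\<rho> g (fst z), snd z) \<in> B})"
      by (simp only: sum_distrib_left)
    also have "(\<Sum>z\<in>D. card {g \<in> kreps. (\<rho> g (fst z), snd z) \<in> B}) = (\<Sum>g\<in>kreps. card (Bg g))"
    proof (rule sum_multicount_gen[OF finD finite_kreps], rule ballI)
      fix g assume "g \<in> kreps"
      show "card {z \<in> D. (\<rho> g (fst z), snd z) \<in> B} = card (Bg g)"
        unfolding Bg_def by (rule arg_cong[where f = card]) auto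
    qed
    also have "(\<Sum>g\<in>kreps. card (Bg g)) \<le> (\<Sum>g\<in>kreps. card X)" using Bg_le by (rule sum_mono)
    finally have "p * card D \<le> p * (8 * card X)" by (simp add: p_def)
    then have "card D \<le> 8 * card X" using p by (simp only: mult_le_cancel1)
    then show ?thesis by (simp only: D_def)
  qed
  ultimately show ?thesis using AS by blast
qed

end

section \<open>Sparse sets of generators in the limit\<close>

lemma eventually_separated:
  assumes "finite X" "\<And>x y. x \<in> X \<Longrightarrow> y \<in> X \<Longrightarrow> limit_cong x y \<Longrightarrow> x = y"
  shows "\<exists>n0. \<forall>n\<ge>n0. \<forall>x\<in>X. \<forall>y\<in>X. level n x y \<longrightarrow> x = y"
proof -
  have "\<exists>n. x \<noteq> y \<longrightarrow> \<not> level n x y" if "x \<in> X" "y \<in> X" for x y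
    using assms(2)[OF that] by (auto simp: limit_cong_def)
  then obtain f where f: "\<And>x y. x \<in> X \<Longrightarrow> y \<in> X \<Longrightarrow> x \<noteq> y \<Longrightarrow> \<not> level (f x y) x y" by metis
  define n0 where "n0 = Max (insert 0 ((\<lambda>(x, y). f x y) ` (X \<times> X)))"
  have le: "f x y \<le> n0" if "x \<in> X" "y \<in> X" for x y
    unfolding n0_def by (rule Max_ge) (use that assms(1) in auto)
  have "x = y" if "n \<ge> n0" "x \<in> X" "y \<in> X" "level n x y" for n x y
    using f[OF that(2,3)] level_mono[of "f x y" n x y] le[OF that(2,3)] that by fastforce
  then show ?thesis by blast
qed

text \<open>The coarse level \<open>i\<close> and \<open>S\<close> stay fixed while the fine level
  \<open>n\<close> grows. One subset of the finite set \<open>S\<close> is the sparse subset for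
  infinitely many \<open>n\<close>, and a given finite \<open>X\<close> is separated by all large
  \<open>n\<close>.\<close>

lemma sparse_words:
  "\<exists>A. finite A \<and> A \<subseteq> range lim.rep \<and> card (range (level i)) \<le> 4 * card A \<and>
    (\<forall>X. finite X \<longrightarrow> (\<forall>x\<in>X. \<forall>y\<in>X. limit_cong x y \<longrightarrow> x = y) \<longrightarrow>
       card {(x, \<sigma>) \<in> X \<times> A. \<exists>y\<in>X. limit_cong (\<sigma> @ x) y} \<le> 8 * card X)"
proof -
  \<comment> \<open>The Schreier generator of the edge from \<open>t\<close> by \<open>s\<close>,
    with representatives taken in the limit so that the same \<open>S\<close> serves every fine
    level.\<close>
  define g where "g = (\<lambda>(s, t). lim.rep (word_inv (level.rep i (s # t)) @ s # t))"
  define S where "S = g ` (UNIV \<times> range (level.rep i))"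
  have lev: "level n x y" if "limit_cong x y" for n x y using that by (simp add: limit_cong_def)
  have card_S: "card S \<le> 2 * card (range (level i))"
  proof -
    have "card S \<le> card ((UNIV :: bool set) \<times> range (level.rep i))"
      unfolding S_def by (rule card_image_le) (use level.finite_reps in auto)
    then show ?thesis by (simp add: card_cartesian_product level.card_reps)
  qed
  have pair: "congruence_pair (level i) (level n) S" if "i \<le> n" for n
  proof (intro congruence_pair.intro congruence_pair_axioms.intro)
    show "level i x y" if "level n x y" for x y by (rule level_mono[OF \<open>i \<le> n\<close> that])
    show "finite S" unfolding S_def using level.finite_reps by simp
    show "level i \<sigma> []" if \<sigma>S: "\<sigma> \<in> S" for \<sigma>
    proof -
      obtain s t where \<sigma>: "\<sigma> = g (s, t)" using \<sigma>S by (auto simp: S_def)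
      let ?t = "level.rep i (s # t)"
      have "level i (word_inv ?t @ s # t) (word_inv ?t @ ?t)" by (rule level.cong_left) (rule level.E_rep)
      then have "level i (word_inv ?t @ s # t) []" using level.inv_left level.E_trans by blast
      moreover have "level i (word_inv ?t @ s # t) \<sigma>" unfolding \<sigma> g_def prod.case by (rule lev[OF lim.E_rep])
      ultimately show ?thesis using level.E_sym level.E_trans by blast
    qed
    fix s t assume t: "t \<in> range (level.rep i)"
    let ?t = "level.rep i (s # t)"
    have "limit_cong (?t @ g (s, t)) (?t @ word_inv ?t @ s # t)"
      unfolding g_def prod.case by (rule lim.cong_left) (rule lim.E_sym[OF lim.E_rep])
    moreover have "limit_cong ((?t @ word_inv ?t) @ s # t) ([] @ s # t)"
      by (rule lim.cong_right[OF lim.inv_right])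
    ultimately have "limit_cong (s # t) (?t @ g (s, t))"
      using lim.E_sym lim.E_trans by (metis append.left_neutral append_assoc)
    then have "refine (level n) (s # t) (?t @ g (s, t))" using lev[of _ _ "Suc n"] by simp
    then show "\<exists>t'\<in>range (level.rep i). \<exists>\<sigma>\<in>S. refine (level n) (s # t) (t' @ \<sigma>)"
      using t by (intro bexI[of _ ?t] bexI[of _ "g (s, t)"]) (auto simp: S_def)
  qed (rule level.finite_congruence_axioms)+
  have "\<forall>n. \<exists>A. i \<le> n \<longrightarrow> A \<subseteq> S \<and> card (range (level i)) \<le> 4 * card A \<and>
    (\<forall>X x0. finite X \<longrightarrow> (\<forall>x\<in>X. level i x x0) \<longrightarrow> (\<forall>x\<in>X. \<forall>y\<in>X. level n x y \<longrightarrow> x = y) \<longrightarrow>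
       card {(x, \<sigma>) \<in> X \<times> A. \<exists>y\<in>X. refine (level n) (\<sigma> @ x) y} \<le> 8 * card X)"
  proof
    fix n
    show "\<exists>A. i \<le> n \<longrightarrow> A \<subseteq> S \<and> card (range (level i)) \<le> 4 * card A \<and>
      (\<forall>X x0. finite X \<longrightarrow> (\<forall>x\<in>X. level i x x0) \<longrightarrow> (\<forall>x\<in>X. \<forall>y\<in>X. level n x y \<longrightarrow> x = y) \<longrightarrow>
         card {(x, \<sigma>) \<in> X \<times> A. \<exists>y\<in>X. refine (level n) (\<sigma> @ x) y} \<le> 8 * card X)"
    proof (cases "i \<le> n")
      case True
      from congruence_pair.sparse_subset[OF pair[OF True] card_S]
      show ?thesis by (elim exE) (rule exI, rule impI, assumption)
    qed simp
  qed
  from choice[OF this] obtain A where A0: "\<forall>n. i \<le> n \<longrightarrow> A n \<subseteq> S \<and> card (range (level i)) \<le> 4 * card (A n) \<and>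
    (\<forall>X x0. finite X \<longrightarrow> (\<forall>x\<in>X. level i x x0) \<longrightarrow> (\<forall>x\<in>X. \<forall>y\<in>X. level n x y \<longrightarrow> x = y) \<longrightarrow>
       card {(x, \<sigma>) \<in> X \<times> A n. \<exists>y\<in>X. refine (level n) (\<sigma> @ x) y} \<le> 8 * card X)" ..
  note A = A0[THEN spec, THEN mp, THEN conjunct1] A0[THEN spec, THEN mp, THEN conjunct2, THEN conjunct1]
  have sparse: "card {(x, \<sigma>) \<in> X \<times> A n. \<exists>y\<in>X. refine (level n) (\<sigma> @ x) y} \<le> 8 * card X"
    if "i \<le> n" "finite X" "\<forall>x\<in>X. level i x x0" "\<forall>x\<in>X. \<forall>y\<in>X. level n x y \<longrightarrow> x = y" for n X x0
    using A0[THEN spec, THEN mp, OF that(1)] that(2-) by (elim conjE allE[of _ X] allE[of _ x0] impE)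
  have finS: "finite S" using pair[of i] congruence_pair.finite_S by blast
  have "infinite {i..}" by (rule infinite_Ici)
  moreover have "finite (A ` {i..})" by (rule finite_subset[of _ "Pow S"]) (use A(1) finS in auto)
  ultimately obtain k where k: "k \<in> {i..}" "infinite {n \<in> {i..}. A n = A k}"
    using pigeonhole_infinite by blast
  have "card {(x, \<sigma>) \<in> X \<times> A k. \<exists>y\<in>X. limit_cong (\<sigma> @ x) y} \<le> 8 * card X"
    if X: "finite X" "\<forall>x\<in>X. \<forall>y\<in>X. limit_cong x y \<longrightarrow> x = y" for X
  proof -
    obtain n0 where n0: "\<And>n. n \<ge> n0 \<Longrightarrow> \<forall>x\<in>X. \<forall>y\<in>X. level n x y \<longrightarrow> x = y"
      using eventually_separated[OF X(1)] X(2) by blast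
    obtain n where n: "n \<ge> n0" "n \<ge> i" "A n = A k"
      using k(2) unfolding infinite_nat_iff_unbounded_le by auto
    \<comment> \<open>Elements of \<open>S\<close> are trivial at level \<open>i\<close>, so edges
      never leave a class of that level. The bound is applied to each class separately and added
      up.\<close>
    define Xq where "Xq q = {x \<in> X. level i x = q}" for q
    define D where "D q = {(x, \<sigma>) \<in> Xq q \<times> A n. \<exists>y\<in>Xq q. refine (level n) (\<sigma> @ x) y}" for q
    have D_le: "card (D q) \<le> 8 * card (Xq q)" if q: "q \<in> level i ` X" for q
    proof -
      obtain x0 where x0: "x0 \<in> X" "q = level i x0" using q by blast
      show ?thesis unfolding D_def
      proof (rule sparse[OF n(2)])
        show "finite (Xq q)" using X(1) by (simp add: Xq_def)
        show "\<forall>x\<in>Xq q. level i x x0" unfolding Xq_def x0(2) by (auto simp: level.E_iff[of i])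
        show "\<forall>x\<in>Xq q. \<forall>y\<in>Xq q. level n x y \<longrightarrow> x = y" using n0[OF n(1)] by (auto simp: Xq_def)
      qed
    qed
    have "{(x, \<sigma>) \<in> X \<times> A k. \<exists>y\<in>X. limit_cong (\<sigma> @ x) y} \<subseteq> (\<Union>q\<in>level i ` X. D q)"
    proof clarify
      fix x \<sigma> y assume *: "x \<in> X" "\<sigma> \<in> A k" "y \<in> X" "limit_cong (\<sigma> @ x) y"
      have "\<sigma> \<in> S" using * A(1) k(1) by auto
      then have "level i \<sigma> []" using congruence_pair.S_kernel[OF pair[OF order_refl]] by blast
      then have "level i (\<sigma> @ x) ([] @ x)" by (rule level.cong_right)
      then have "level i x y" using lev[OF *(4), of i] level.E_sym level.E_trans by (metis append.left_neutral)
      then have "level i x = level i y" by (simp only: level.E_iff[of i])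
      moreover have "refine (level n) (\<sigma> @ x) y" using lev[OF *(4), of "Suc n"] by simp
      ultimately have "(x, \<sigma>) \<in> D (level i x)" using * n(3) unfolding D_def Xq_def by auto
      then show "(x, \<sigma>) \<in> (\<Union>q\<in>level i ` X. D q)" using *(1) by blast
    qed
    moreover have "finite (D q)" for q
      by (rule finite_subset[of _ "X \<times> S"]) (use X(1) finS A(1)[OF n(2)] in \<open>auto simp: D_def Xq_def\<close>)
    ultimately have "card {(x, \<sigma>) \<in> X \<times> A k. \<exists>y\<in>X. limit_cong (\<sigma> @ x) y} \<le> card (\<Union>q\<in>level i ` X. D q)"
      using X(1) by (intro card_mono) auto
    also have "\<dots> \<le> (\<Sum>q\<in>level i ` X. card (D q))" using X(1) by (intro card_UN_le) auto
    also have "\<dots> \<le> (\<Sum>q\<in>level i ` X. 8 * card (Xq q))" using D_le by (intro sum_mono) auto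
    also have "\<dots> = 8 * card X"
      using sum.image_gen[OF X(1), of "\<lambda>_. 1::nat" "level i"] by (simp add: Xq_def sum_distrib_left)
    finally show ?thesis .
  qed
  moreover have "A k \<subseteq> range lim.rep" using A(1)[of k] k(1) by (auto simp: S_def g_def)
  moreover have "finite (A k)" using A(1)[of k] k(1) finS finite_subset by auto
  ultimately show ?thesis using A(2)[of k] k(1) by (intro exI[of _ "A k"]) auto
qed

section \<open>The limit group\<close>

text \<open>The limit maps onto level \<open>n\<close>, which has more than \<open>n\<close>
  elements.\<close>

lemma infinite_limit: "infinite (range limit_cong)"
proof
  assume fin: "finite (range limit_cong)"
  define n where "n = card (range limit_cong)"
  have "level n (inv_into UNIV limit_cong (limit_cong x)) = level n x" for x
  proof -
    have "limit_cong (inv_into UNIV limit_cong (limit_cong x)) = limit_cong x" by (simp add: f_inv_into_f)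
    then have "limit_cong (inv_into UNIV limit_cong (limit_cong x)) x" by (simp only: lim.E_iff)
    then have "level n (inv_into UNIV limit_cong (limit_cong x)) x" by (simp add: limit_cong_def)
    then show ?thesis by (simp only: level.E_iff)
  qed
  then have "range (level n) = (\<lambda>q. level n (inv_into UNIV limit_cong q)) ` range limit_cong"
    by (simp add: image_image)
  then have "card (range (level n)) \<le> n" unfolding n_def using card_image_le[OF fin] by metis
  with card_level[of n] show False by simp
qed

text \<open>The classes are countably infinite, so they can be numbered by all naturals and the
  group gets the carrier \<open>UNIV\<close>.\<close>

definition code :: "word \<Rightarrow> nat" where
  "code w = to_nat_on (range limit_cong) (limit_cong w)"

definition decode :: "nat \<Rightarrow> word" where
  "decode = inv_into UNIV code"

lemma code_eq_iff: "code v = code w \<longleftrightarrow> limit_cong v w"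
proof -
  have "code v = code w \<longleftrightarrow> limit_cong v = limit_cong w"
    unfolding code_def by (rule inj_on_eq_iff[OF inj_on_to_nat_on]) auto
  also have "\<dots> \<longleftrightarrow> limit_cong v w" by (rule lim.E_iff[symmetric])
  finally show ?thesis .
qed

lemma code_decode [simp]: "code (decode n) = n"
proof -
  have "to_nat_on (range limit_cong) ` range limit_cong = UNIV"
    using to_nat_on_infinite[OF _ infinite_limit] by (auto simp: bij_betw_def)
  then have "surj code" by (simp add: code_def[abs_def] image_image)
  then show ?thesis unfolding decode_def by (rule surj_f_inv_f)
qed

lemma limit_cong_decode_code: "limit_cong (decode (code w)) w"
  by (simp flip: code_eq_iff)

definition limit_group :: "nat monoid" where
  "limit_group = \<lparr>carrier = UNIV, mult = (\<lambda>a b. code (decode a @ decode b)), one = code []\<rparr>"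

lemma carrier_limit_group [simp]: "carrier limit_group = UNIV"
  and one_limit_group: "\<one>\<^bsub>limit_group\<^esub> = code []"
  by (simp_all add: limit_group_def)

lemma mult_limit_group: "code v \<otimes>\<^bsub>limit_group\<^esub> code w = code (v @ w)"
  by (simp add: limit_group_def code_eq_iff lim.cong_append limit_cong_decode_code)

lemma group_limit_group: "group limit_group"
proof (rule groupI)
  fix x y z
  have "code (decode x) \<otimes>\<^bsub>limit_group\<^esub> code (decode y) \<otimes>\<^bsub>limit_group\<^esub> code (decode z)
     = code (decode x) \<otimes>\<^bsub>limit_group\<^esub> (code (decode y) \<otimes>\<^bsub>limit_group\<^esub> code (decode z))"
    by (simp only: mult_limit_group append_assoc)
  then show "x \<otimes>\<^bsub>limit_group\<^esub> y \<otimes>\<^bsub>limit_group\<^esub> z = x \<otimes>\<^bsub>limit_group\<^esub> (y \<otimes>\<^bsub>limit_group\<^esub> z)" by simp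
  have "code [] \<otimes>\<^bsub>limit_group\<^esub> code (decode x) = code (decode x)" by (simp only: mult_limit_group append.left_neutral)
  then show "\<one>\<^bsub>limit_group\<^esub> \<otimes>\<^bsub>limit_group\<^esub> x = x" by (simp add: one_limit_group)
  have "code (word_inv (decode x)) \<otimes>\<^bsub>limit_group\<^esub> code (decode x) = code []"
    unfolding mult_limit_group code_eq_iff by (rule lim.inv_left)
  then show "\<exists>y\<in>carrier limit_group. y \<otimes>\<^bsub>limit_group\<^esub> x = \<one>\<^bsub>limit_group\<^esub>"
    by (auto simp: one_limit_group)
qed auto

lemma finitely_generated_limit_group: "finitely_generated_group limit_group"
proof -
  let ?A = "{code [True], code [False]}"
  have "code w \<in> generate limit_group ?A" for w
  proof (induction w)
    case Nil
    show ?case using generate.one[of limit_group ?A] by (simp add: one_limit_group)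
  next
    case (Cons s w)
    have "code [s] \<in> generate limit_group ?A" by (rule generate.incl) (cases s; simp)
    then have "code [s] \<otimes>\<^bsub>limit_group\<^esub> code w \<in> generate limit_group ?A" by (rule generate.eng[OF _ Cons])
    then show ?case by (simp only: mult_limit_group append.simps)
  qed
  then have "n \<in> generate limit_group ?A" for n by (metis code_decode)
  then have "generate limit_group ?A = carrier limit_group" by auto
  then show ?thesis unfolding finitely_generated_group_def using group_limit_group by force
qed

lemma torsion_limit_group: "torsion_group limit_group"
proof -
  interpret group limit_group by (rule group_limit_group)
  have pow: "code w [^]\<^bsub>limit_group\<^esub> n = code (word_power w n)" for w n
  proof (induction n)
    case 0 show ?case by (simp add: one_limit_group)
  next
    case (Suc n)
    then show ?case using word_power_add[of w n 1] by (simp add: mult_limit_group word_power_Suc)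
  qed
  have "code w [^]\<^bsub>limit_group\<^esub> relator_exponent w = \<one>\<^bsub>limit_group\<^esub>" for w
    unfolding pow one_limit_group code_eq_iff by (rule lim.torsion)
  from this[of "decode _"] have "\<exists>n>0. x [^]\<^bsub>limit_group\<^esub> (n::nat) = \<one>\<^bsub>limit_group\<^esub>" for x
    by (intro exI[of _ "relator_exponent (decode x)"]) simp
  then show ?thesis by (simp add: torsion_group_def group_limit_group)
qed

text \<open>An edge is given equally well by its two ends or by its start and its label
  \<open>y x\<inverse>\<close>, so the bound for words carries over. Level \<open>4 * N\<close> has
  more than \<open>4 * N\<close> elements, which makes \<open>A\<close> large enough.\<close>

lemma sparse_limit_group:
  "\<exists>A. finite A \<and> N \<le> card A \<and>
    (\<forall>X. finite X \<longrightarrow> card {(x, y) \<in> X \<times> X. y \<otimes>\<^bsub>limit_group\<^esub> inv\<^bsub>limit_group\<^esub> x \<in> A} \<le> 8 * card X)"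
proof -
  interpret group limit_group by (rule group_limit_group)
  from sparse_words[of "4 * N"] obtain A where
    A: "finite A" "A \<subseteq> range lim.rep" "card (range (level (4 * N))) \<le> 4 * card A"
    and sparse: "\<forall>X. finite X \<longrightarrow> (\<forall>x\<in>X. \<forall>y\<in>X. limit_cong x y \<longrightarrow> x = y) \<longrightarrow>
       card {(x, \<sigma>) \<in> X \<times> A. \<exists>y\<in>X. limit_cong (\<sigma> @ x) y} \<le> 8 * card X"
    by (elim exE conjE)
  have canon: "a = lim.rep (decode (code a))" if "a \<in> A" for a
  proof -
    have "lim.rep a = a" using that A(2) lim.rep_in_range by blast
    moreover have "lim.rep (decode (code a)) = lim.rep a"
      unfolding lim.rep_eq_iff by (rule limit_cong_decode_code)
    ultimately show ?thesis by simp
  qed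
  have "inj_on code A"
  proof (rule inj_onI)
    fix a b assume *: "a \<in> A" "b \<in> A" "code a = code b"
    have "a = lim.rep (decode (code a))" by (rule canon[OF *(1)])
    also have "\<dots> = lim.rep (decode (code b))" by (simp only: *(3))
    also have "\<dots> = b" by (rule canon[OF *(2), symmetric])
    finally show "a = b" .
  qed
  then have "card (code ` A) = card A" by (rule card_image)
  moreover have "N \<le> card A" using A(3) card_level[of "4 * N"] by linarith
  moreover have "card {(x, y) \<in> X \<times> X. y \<otimes>\<^bsub>limit_group\<^esub> inv\<^bsub>limit_group\<^esub> x \<in> code ` A} \<le> 8 * card X"
    (is "card ?P \<le> _") if "finite X" for X
  proof -
    let ?D = "{(x, \<sigma>) \<in> decode ` X \<times> A. \<exists>y\<in>decode ` X. limit_cong (\<sigma> @ x) y}"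
    let ?f = "\<lambda>(x, \<sigma>). (code x, code (\<sigma> @ x))"
    have "?P \<subseteq> ?f ` ?D"
    proof clarify
      fix x y a assume *: "x \<in> X" "y \<in> X" "a \<in> A" "y \<otimes>\<^bsub>limit_group\<^esub> inv\<^bsub>limit_group\<^esub> x = code a"
      then have "y = code a \<otimes>\<^bsub>limit_group\<^esub> code (decode x)" by (simp add: m_assoc flip: *(4))
      then have y: "y = code (a @ decode x)" by (simp only: mult_limit_group)
      then have "code (a @ decode x) = code (decode y)" by simp
      then have "limit_cong (a @ decode x) (decode y)" by (simp only: code_eq_iff)
      then show "(x, y) \<in> ?f ` ?D" using * y by (intro image_eqI[where x = "(decode x, a)"]) auto
    qed
    moreover have finD: "finite ?D"
      by (rule finite_subset[of _ "decode ` X \<times> A"]) (use that A(1) in auto)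
    ultimately have "card ?P \<le> card ?D" by (rule surj_card_le[rotated])
    also have "\<dots> \<le> 8 * card (decode ` X)"
    proof (rule sparse[rule_format])
      have "x = y" if "limit_cong (decode x) (decode y)" for x y
        using that by (simp flip: code_eq_iff)
      then show "x = y" if "x \<in> decode ` X" "y \<in> decode ` X" "limit_cong x y" for x y
        using that by blast
    qed (use that in simp)
    also have "\<dots> \<le> 8 * card X" using card_image_le[OF that, of decode] by simp
    finally show ?thesis .
  qed
  ultimately show ?thesis using A(1) by (intro exI[of _ "code ` A"]) auto
qed

section \<open>Orientations of sparse graphs\<close>

text \<open>Out-degrees and in-degrees each sum to the number of edges, so the average total degree
  is at most \<open>2 * k\<close>.\<close>

lemma exists_low_degree_vertex:
  assumes "finite X" "X \<noteq> {}" "card {(x, y) \<in> X \<times> X. R x y} \<le> k * card X"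
  shows "\<exists>v\<in>X. card {y \<in> X. R v y} + card {x \<in> X. R x v} \<le> 2 * k"
proof (rule ccontr)
  assume neg: "\<not> ?thesis"
  have gt: "2 * k + 1 \<le> card {y \<in> X. R v y} + card {x \<in> X. R x v}" if "v \<in> X" for v
  proof -
    have "\<not> card {y \<in> X. R v y} + card {x \<in> X. R x v} \<le> 2 * k" using neg that by blast
    then show ?thesis by simp
  qed
  have out: "(\<Sum>v\<in>X. card {y \<in> X. R v y}) = card {(x, y) \<in> X \<times> X. R x y}"
  proof -
    have "{(x, y) \<in> X \<times> X. R x y} = (SIGMA v:X. {y \<in> X. R v y})" by auto
    then show ?thesis using assms(1) by (simp add: card_SigmaI)
  qed
  have inn: "(\<Sum>v\<in>X. card {x \<in> X. R x v}) = card {(x, y) \<in> X \<times> X. R x y}"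
    unfolding out[symmetric] by (rule sum_multicount_gen[OF assms(1,1)]) simp
  have "card X * (2 * k + 1) \<le> (\<Sum>v\<in>X. card {y \<in> X. R v y} + card {x \<in> X. R x v})"
    using sum_bounded_below[of X "2 * k + 1"] gt by simp
  also have "\<dots> \<le> 2 * (k * card X)" unfolding sum.distrib out inn using assms(3) by simp
  finally have "card X * (2 * k + 1) \<le> card X * (2 * k)" by (simp add: mult.commute mult.left_commute)
  moreover have "card X > 0" using assms(1,2) by (simp add: card_gt_0_iff)
  ultimately show False by simp
qed

text \<open>An edge in \<open>Q\<close> is charged to its row \<open>x\<close>, any other edge to
  its column \<open>y\<close>. A vertex of low degree is removed, the rest is oriented by induction,
  and all edges at the removed vertex are charged to it.\<close>

lemma finite_orientation:
  assumes "finite X" "\<And>Y. Y \<subseteq> X \<Longrightarrow> card {(x, y) \<in> Y \<times> Y. R x y} \<le> k * card Y"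
  shows "\<exists>Q. (\<forall>x\<in>X. card {y \<in> X. R x y \<and> (x, y) \<in> Q} \<le> 2 * k) \<and>
             (\<forall>y\<in>X. card {x \<in> X. R x y \<and> (x, y) \<notin> Q} \<le> 2 * k)"
  using assms
proof (induction X rule: finite_psubset_induct)
  case (psubset X)
  show ?case
  proof (cases "X = {}")
    case False
    then obtain v where v: "v \<in> X" "card {y \<in> X. R v y} + card {x \<in> X. R x v} \<le> 2 * k"
      using exists_low_degree_vertex[OF psubset.hyps(1) _ psubset.prems[OF order_refl]] by blast
    have "X - {v} \<subset> X" using v(1) by blast
    then have "\<exists>Q. (\<forall>x\<in>X - {v}. card {y \<in> X - {v}. R x y \<and> (x, y) \<in> Q} \<le> 2 * k) \<and>
        (\<forall>y\<in>X - {v}. card {x \<in> X - {v}. R x y \<and> (x, y) \<notin> Q} \<le> 2 * k)"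
      by (rule psubset.IH) (rule psubset.prems, blast)
    then obtain Q where
      Q: "\<And>x. x \<in> X - {v} \<Longrightarrow> card {y \<in> X - {v}. R x y \<and> (x, y) \<in> Q} \<le> 2 * k"
         "\<And>y. y \<in> X - {v} \<Longrightarrow> card {x \<in> X - {v}. R x y \<and> (x, y) \<notin> Q} \<le> 2 * k"
      by blast
    \<comment> \<open>Edges out of \<open>v\<close> are charged to \<open>v\<close> as a row, edges
      into \<open>v\<close> from elsewhere to \<open>v\<close> as a column. Both are few by the
      choice of \<open>v\<close>, and no other vertex is charged for them.\<close>
    define Q' where "Q' = {(x, y). x = v \<or> y \<noteq> v \<and> (x, y) \<in> Q}"
    have "card {y \<in> X. R x y \<and> (x, y) \<in> Q'} \<le> 2 * k" if x: "x \<in> X" for x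
    proof (cases "x = v")
      case True
      have "card {y \<in> X. R x y \<and> (x, y) \<in> Q'} \<le> card {y \<in> X. R v y}"
        by (rule card_mono) (use True psubset.hyps in auto)
      then show ?thesis using v(2) by simp
    next
      case False
      then have "{y \<in> X. R x y \<and> (x, y) \<in> Q'} = {y \<in> X - {v}. R x y \<and> (x, y) \<in> Q}"
        by (auto simp: Q'_def)
      then show ?thesis using Q(1)[of x] x False by simp
    qed
    moreover have "card {x \<in> X. R x y \<and> (x, y) \<notin> Q'} \<le> 2 * k" if y: "y \<in> X" for y
    proof (cases "y = v")
      case True
      have "card {x \<in> X. R x y \<and> (x, y) \<notin> Q'} \<le> card {x \<in> X. R x v}"
        by (rule card_mono) (use True psubset.hyps in auto)
      then show ?thesis using v(2) by simp
    next
      case False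
      then have "{x \<in> X. R x y \<and> (x, y) \<notin> Q'} = {x \<in> X - {v}. R x y \<and> (x, y) \<notin> Q}"
        by (auto simp: Q'_def)
      then show ?thesis using Q(2)[of y] y False by simp
    qed
    ultimately show ?thesis by blast
  qed simp
qed

text \<open>A compactness argument: orientations of the graphs on \<open>{..<n}\<close> converge
  pointwise along a subsequence, and each bound involves finitely many entries, so it survives in
  the limit. \<open>l x y\<close> is the share of the edge that is charged to
  \<open>x\<close>.\<close>

lemma fractional_orientation:
  fixes R :: "nat \<Rightarrow> nat \<Rightarrow> bool"
  assumes "\<And>X. finite X \<Longrightarrow> card {(x, y) \<in> X \<times> X. R x y} \<le> k * card X"
  shows "\<exists>l :: nat \<Rightarrow> nat \<Rightarrow> real. (\<forall>x y. 0 \<le> l x y \<and> l x y \<le> 1) \<and>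
    (\<forall>x Y. finite Y \<longrightarrow> (\<Sum>y\<in>Y. of_bool (R x y) * l x y) \<le> 2 * k) \<and>
    (\<forall>y X. finite X \<longrightarrow> (\<Sum>x\<in>X. of_bool (R x y) * (1 - l x y)) \<le> 2 * k)"
proof -
  have "\<forall>n. \<exists>Q. (\<forall>x\<in>{..<n}. card {y \<in> {..<n}. R x y \<and> (x, y) \<in> Q} \<le> 2 * k) \<and>
             (\<forall>y\<in>{..<n}. card {x \<in> {..<n}. R x y \<and> (x, y) \<notin> Q} \<le> 2 * k)"
    by (rule allI, rule finite_orientation) (simp, rule assms, erule finite_subset, simp)
  from choice[OF this] obtain Q where
    Q: "\<forall>n. (\<forall>x\<in>{..<n}. card {y \<in> {..<n}. R x y \<and> (x, y) \<in> Q n} \<le> 2 * k) \<and>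
             (\<forall>y\<in>{..<n}. card {x \<in> {..<n}. R x y \<and> (x, y) \<notin> Q n} \<le> 2 * k)" ..
  have Q1: "card {y \<in> {..<n}. R x y \<and> (x, y) \<in> Q n} \<le> 2 * k" if "x < n" for n x
    by (rule Q[THEN spec, THEN conjunct1, THEN bspec]) (simp add: that)
  have Q2: "card {x \<in> {..<n}. R x y \<and> (x, y) \<notin> Q n} \<le> 2 * k" if "y < n" for n y
    by (rule Q[THEN spec, THEN conjunct2, THEN bspec]) (simp add: that)
  define f where "f n z = (of_bool (z \<in> Q n) :: real)" for n and z :: "nat \<times> nat"
  have f_le: "norm (f n z) \<le> 1" for n z by (simp add: f_def)
  obtain r :: "nat \<Rightarrow> nat" where r: "strict_mono r" and conv: "\<forall>z. \<exists>l. (\<lambda>n. f (r n) z) \<longlonglongrightarrow> l"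
    by (rule function_convergent_subsequence[of "UNIV :: (nat \<times> nat) set" f 1]) (simp, rule f_le, blast)
  from choice[OF conv] obtain l where l': "\<forall>z. (\<lambda>n. f (r n) z) \<longlonglongrightarrow> l z" ..
  have l: "(\<lambda>n. f (r n) z) \<longlonglongrightarrow> l z" for z using l' by (rule spec)
  have ge_r: "n \<le> r n" for n by (rule strict_mono_imp_increasing[OF r])
  have "0 \<le> l z" for z by (rule LIMSEQ_le_const[OF l]) (simp add: f_def)
  moreover have "l z \<le> 1" for z by (rule LIMSEQ_le_const2[OF l]) (simp add: f_def)
  moreover have "(\<Sum>y\<in>Y. of_bool (R x y) * l (x, y)) \<le> 2 * k" if Y: "finite Y" for x Y
  proof (rule LIMSEQ_le_const2)
    show "(\<lambda>n. \<Sum>y\<in>Y. of_bool (R x y) * f (r n) (x, y)) \<longlonglongrightarrow> (\<Sum>y\<in>Y. of_bool (R x y) * l (x, y))"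
      by (intro tendsto_sum tendsto_mult tendsto_const l)
    \<comment> \<open>For such \<open>n\<close> the finite graph on \<open>{..<r n}\<close> already
      contains \<open>x\<close> and all of \<open>Y\<close>.\<close>
    have "(\<Sum>y\<in>Y. of_bool (R x y) * f (r n) (x, y)) \<le> 2 * k" if n: "n \<ge> Suc (Max (insert x Y))" for n
    proof -
      have lt: "z < r n" if "z \<in> insert x Y" for z
      proof -
        have "z \<le> Max (insert x Y)" using Y that by simp
        then show ?thesis using n ge_r[of n] by linarith
      qed
      have "(\<Sum>y\<in>Y. of_bool (R x y) * f (r n) (x, y)) = (\<Sum>y\<in>Y. of_bool (R x y \<and> (x, y) \<in> Q (r n)))"
        by (rule sum.cong) (auto simp: f_def)
      also have "\<dots> = card {y \<in> Y. R x y \<and> (x, y) \<in> Q (r n)}"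
        using Y by (simp add: sum.If_cases of_bool_def Int_def)
      also have "\<dots> \<le> card {y \<in> {..<r n}. R x y \<and> (x, y) \<in> Q (r n)}"
        unfolding of_nat_le_iff by (rule card_mono) (use lt in auto)
      also have "\<dots> \<le> 2 * k" using Q1[of x "r n"] lt[of x] by simp
      finally show ?thesis by simp
    qed
    then show "\<exists>N. \<forall>n\<ge>N. (\<Sum>y\<in>Y. of_bool (R x y) * f (r n) (x, y)) \<le> 2 * k" by blast
  qed
  moreover have "(\<Sum>x\<in>X. of_bool (R x y) * (1 - l (x, y))) \<le> 2 * k" if X: "finite X" for y X
  proof (rule LIMSEQ_le_const2)
    show "(\<lambda>n. \<Sum>x\<in>X. of_bool (R x y) * (1 - f (r n) (x, y))) \<longlonglongrightarrow> (\<Sum>x\<in>X. of_bool (R x y) * (1 - l (x, y)))"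
      by (intro tendsto_sum tendsto_mult tendsto_diff tendsto_const l)
    have "(\<Sum>x\<in>X. of_bool (R x y) * (1 - f (r n) (x, y))) \<le> 2 * k" if n: "n \<ge> Suc (Max (insert y X))" for n
    proof -
      have lt: "z < r n" if "z \<in> insert y X" for z
      proof -
        have "z \<le> Max (insert y X)" using X that by simp
        then show ?thesis using n ge_r[of n] by linarith
      qed
      have "(\<Sum>x\<in>X. of_bool (R x y) * (1 - f (r n) (x, y))) = (\<Sum>x\<in>X. of_bool (R x y \<and> (x, y) \<notin> Q (r n)))"
        by (rule sum.cong) (auto simp: f_def)
      also have "\<dots> = card {x \<in> X. R x y \<and> (x, y) \<notin> Q (r n)}"
        using X by (simp add: sum.If_cases of_bool_def Int_def)
      also have "\<dots> \<le> card {x \<in> {..<r n}. R x y \<and> (x, y) \<notin> Q (r n)}"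
        unfolding of_nat_le_iff by (rule card_mono) (use lt in auto)
      also have "\<dots> \<le> 2 * k" using Q2[of y "r n"] lt[of y] by simp
      finally show ?thesis by simp
    qed
    then show "\<exists>N. \<forall>n\<ge>N. (\<Sum>x\<in>X. of_bool (R x y) * (1 - f (r n) (x, y))) \<le> 2 * k" by blast
  qed
  ultimately show ?thesis by (intro exI[of _ "\<lambda>x y. l (x, y)"]) auto
qed

section \<open>A convolution kernel split into rows and columns\<close>

lemma weighted_sums_bounded:
  fixes w :: "nat \<Rightarrow> 'a \<Rightarrow> real"
  assumes w: "\<And>j z. 0 \<le> w j z" "\<And>j z. w j z \<le> 1"
    and bound: "\<And>j. (\<Sum>z\<in>Z. w j z) \<le> C"
  shows "(\<Sum>z\<in>Z. \<Sum>j. (1/2) ^ j * w j z) \<le> 2 * C"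
proof -
  have sm: "summable (\<lambda>j. (1/2) ^ j * w j z)" for z
    by (rule summable_comparison_test'[of "\<lambda>j. (1/2) ^ j"]) (use w in \<open>auto intro!: summable_geometric mult_left_le\<close>)
  have "(\<Sum>z\<in>Z. \<Sum>j. (1/2) ^ j * w j z) = (\<Sum>j. \<Sum>z\<in>Z. (1/2) ^ j * w j z)"
    by (rule suminf_sum[symmetric]) (rule sm)
  also have "\<dots> \<le> (\<Sum>j. (1/2) ^ j * C)"
  proof (rule suminf_le)
    show "(\<Sum>z\<in>Z. (1/2) ^ j * w j z) \<le> (1/2) ^ j * C" for j
      using bound[of j] by (simp flip: sum_distrib_left)
  qed (auto intro!: summable_sum sm summable_mult2 summable_geometric)
  also have "\<dots> = 2 * C"
    by (subst suminf_mult2[symmetric]) (auto simp: suminf_geometric summable_geometric)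
  finally show ?thesis .
qed

text \<open>The kernel \<open>\<phi> (y x\<inverse>)\<close> is unchanged when \<open>x\<close> and
  \<open>y\<close> are multiplied on the right by the same element. Hence such a translation changes
  \<open>f\<close> by the negative of what it changes \<open>g\<close>, and the change in
  \<open>f\<close> obeys row and column bounds at once.\<close>

definition row_column_split ::
    "nat monoid \<Rightarrow> (nat \<Rightarrow> real) \<Rightarrow> (nat \<Rightarrow> nat \<Rightarrow> real) \<Rightarrow> (nat \<Rightarrow> nat \<Rightarrow> real) \<Rightarrow> real \<Rightarrow> bool" where
  "row_column_split G \<phi> f g C \<longleftrightarrow>
     (\<forall>x y. 0 \<le> f x y \<and> 0 \<le> g x y \<and> f x y + g x y = \<phi> (y \<otimes>\<^bsub>G\<^esub> inv\<^bsub>G\<^esub> x)) \<and>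
     (\<forall>x Y. finite Y \<longrightarrow> (\<Sum>y\<in>Y. f x y) \<le> C) \<and> (\<forall>y X. finite X \<longrightarrow> (\<Sum>x\<in>X. g x y) \<le> C)"

text \<open>\<phi> is the sum of the indicators of sets \<open>A j\<close> with weights
  \<open>(1/2) ^ j\<close>. The weights keep row and column sums bounded, while
  \<open>8 ^ j \<le> card (A j)\<close> makes the squares over \<open>A j\<close> add up to at least
  \<open>8 ^ j * (1/4) ^ j = 2 ^ j\<close>.\<close>

lemma exists_row_column_split:
  fixes G :: "nat monoid"
  assumes "\<And>N. \<exists>A. finite A \<and> N \<le> card A \<and>
    (\<forall>X. finite X \<longrightarrow> card {(x, y) \<in> X \<times> X. y \<otimes>\<^bsub>G\<^esub> inv\<^bsub>G\<^esub> x \<in> A} \<le> k * card X)"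
  shows "\<exists>\<phi> f g C. row_column_split G \<phi> f g C \<and> (\<forall>K. \<exists>Z. finite Z \<and> (\<Sum>z\<in>Z. (\<phi> z)\<^sup>2) > K)"
proof -
  have "\<forall>j. \<exists>A. finite A \<and> 8 ^ j \<le> card A \<and>
    (\<forall>X. finite X \<longrightarrow> card {(x, y) \<in> X \<times> X. y \<otimes>\<^bsub>G\<^esub> inv\<^bsub>G\<^esub> x \<in> A} \<le> k * card X)"
    using assms by blast
  from choice[OF this] obtain A where A0: "\<forall>j. finite (A j) \<and> 8 ^ j \<le> card (A j) \<and>
    (\<forall>X. finite X \<longrightarrow> card {(x, y) \<in> X \<times> X. y \<otimes>\<^bsub>G\<^esub> inv\<^bsub>G\<^esub> x \<in> A j} \<le> k * card X)" ..
  note A = A0[THEN spec, THEN conjunct1] A0[THEN spec, THEN conjunct2, THEN conjunct1]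
    A0[THEN spec, THEN conjunct2, THEN conjunct2, THEN spec, THEN mp]
  define e where "e j x y = (of_bool (y \<otimes>\<^bsub>G\<^esub> inv\<^bsub>G\<^esub> x \<in> A j) :: real)" for j x y
  have "\<forall>j. \<exists>l :: nat \<Rightarrow> nat \<Rightarrow> real. (\<forall>x y. 0 \<le> l x y \<and> l x y \<le> 1) \<and>
    (\<forall>x Y. finite Y \<longrightarrow> (\<Sum>y\<in>Y. e j x y * l x y) \<le> 2 * k) \<and>
    (\<forall>y X. finite X \<longrightarrow> (\<Sum>x\<in>X. e j x y * (1 - l x y)) \<le> 2 * k)"
  proof
    fix j
    show "\<exists>l :: nat \<Rightarrow> nat \<Rightarrow> real. (\<forall>x y. 0 \<le> l x y \<and> l x y \<le> 1) \<and>
    (\<forall>x Y. finite Y \<longrightarrow> (\<Sum>y\<in>Y. e j x y * l x y) \<le> 2 * k) \<and>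
    (\<forall>y X. finite X \<longrightarrow> (\<Sum>x\<in>X. e j x y * (1 - l x y)) \<le> 2 * k)"
      unfolding e_def
      using fractional_orientation[of "\<lambda>x y. y \<otimes>\<^bsub>G\<^esub> inv\<^bsub>G\<^esub> x \<in> A j" k, OF A(3)] by simp
  qed
  from choice[OF this] obtain l :: "nat \<Rightarrow> nat \<Rightarrow> nat \<Rightarrow> real" where
    l0: "\<forall>j. (\<forall>x y. 0 \<le> l j x y \<and> l j x y \<le> 1) \<and>
    (\<forall>x Y. finite Y \<longrightarrow> (\<Sum>y\<in>Y. e j x y * l j x y) \<le> 2 * k) \<and>
    (\<forall>y X. finite X \<longrightarrow> (\<Sum>x\<in>X. e j x y * (1 - l j x y)) \<le> 2 * k)" ..
  have l: "0 \<le> l j x y" "l j x y \<le> 1"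
    "finite Y \<Longrightarrow> (\<Sum>y\<in>Y. e j x y * l j x y) \<le> 2 * k"
    "finite X \<Longrightarrow> (\<Sum>x\<in>X. e j x y * (1 - l j x y)) \<le> 2 * k" for j x y X Y
    using l0 by simp_all
  have e01: "0 \<le> e j x y" "e j x y \<le> 1" for j x y by (auto simp: e_def)
  define f where "f x y = (\<Sum>j. (1/2) ^ j * (e j x y * l j x y))" for x y
  define g where "g x y = (\<Sum>j. (1/2) ^ j * (e j x y * (1 - l j x y)))" for x y
  define \<phi> where "\<phi> z = (\<Sum>j. (1/2) ^ j * (of_bool (z \<in> A j) :: real))" for z
  have sm: "summable (\<lambda>j. (1/2) ^ j * (u j :: real))" if "\<And>j. 0 \<le> u j" "\<And>j. u j \<le> 1" for u
    by (rule summable_comparison_test'[of "\<lambda>j. (1/2) ^ j"])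
      (use that in \<open>auto intro!: summable_geometric mult_left_le\<close>)
  have el: "0 \<le> e j x y * l j x y" "e j x y * l j x y \<le> 1"
    "0 \<le> e j x y * (1 - l j x y)" "e j x y * (1 - l j x y) \<le> 1" for j x y
    using e01[of j x y] l(1,2)[of j x y] by (auto intro: mult_le_one)
  have "row_column_split G \<phi> f g (2 * real (2 * k))"
    unfolding row_column_split_def
  proof (intro conjI allI impI)
    fix x y
    show "0 \<le> f x y" "0 \<le> g x y" unfolding f_def g_def
      by (intro suminf_nonneg sm el mult_nonneg_nonneg; simp)+
    show "f x y + g x y = \<phi> (y \<otimes>\<^bsub>G\<^esub> inv\<^bsub>G\<^esub> x)"
    proof -
      have "f x y + g x y = (\<Sum>j. (1/2) ^ j * (e j x y * l j x y) + (1/2) ^ j * (e j x y * (1 - l j x y)))"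
        unfolding f_def g_def by (intro suminf_add sm el)
      also have "\<dots> = (\<Sum>j. (1/2) ^ j * e j x y)" by (simp add: algebra_simps)
      finally show ?thesis by (simp add: \<phi>_def e_def)
    qed
  next
    fix x and Y :: "nat set" assume "finite Y"
    then show "(\<Sum>y\<in>Y. f x y) \<le> 2 * real (2 * k)"
      unfolding f_def by (intro weighted_sums_bounded[where w = "\<lambda>j y. e j x y * l j x y"] el l(3))
  next
    fix y and X :: "nat set" assume "finite X"
    then show "(\<Sum>x\<in>X. g x y) \<le> 2 * real (2 * k)"
      unfolding g_def by (intro weighted_sums_bounded[where w = "\<lambda>j x. e j x y * (1 - l j x y)"] el l(4))
  qed
  moreover have "\<exists>Z. finite Z \<and> (\<Sum>z\<in>Z. (\<phi> z)\<^sup>2) > K" for K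
  proof -
    obtain j where j: "K < 2 ^ j" using real_arch_pow[of 2 K] by auto
    have ge: "(1/2) ^ j \<le> \<phi> z" if "z \<in> A j" for z
    proof -
      have "sum (\<lambda>j. (1/2) ^ j * (of_bool (z \<in> A j) :: real)) {j} \<le> \<phi> z"
        unfolding \<phi>_def by (intro sum_le_suminf sm) auto
      then show ?thesis using that by simp
    qed
    have "(2::real) ^ j = 8 ^ j * (1/4) ^ j" by (simp flip: power_mult_distrib)
    also have "\<dots> \<le> card (A j) * (1/4) ^ j"
    proof (rule mult_right_mono)
      have "real (8 ^ j) \<le> real (card (A j))" using A(2) by (simp only: of_nat_le_iff)
      then show "8 ^ j \<le> real (card (A j))" by simp
    qed simp
    also have "\<dots> = (\<Sum>z\<in>A j. ((1/2) ^ j)\<^sup>2)" by (simp add: power_even_eq[symmetric] power_commutes power2_eq_square flip: power_mult_distrib)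
    also have "\<dots> \<le> (\<Sum>z\<in>A j. (\<phi> z)\<^sup>2)" by (intro sum_mono power_mono ge) auto
    finally show ?thesis using j A(1) by (intro exI[of _ "A j"]) auto
  qed
  ultimately show ?thesis by blast
qed

section \<open>Square summable functions\<close>

definition l2 :: "('a \<Rightarrow> complex) \<Rightarrow> bool" where
  "l2 \<xi> \<longleftrightarrow> (\<lambda>n. (cmod (\<xi> n))\<^sup>2) summable_on UNIV"

definition sq_norm :: "('a \<Rightarrow> complex) \<Rightarrow> real" where
  "sq_norm \<xi> = (\<Sum>\<^sub>\<infinity>n. (cmod (\<xi> n))\<^sup>2)"

definition l2_ip :: "('a \<Rightarrow> complex) \<Rightarrow> ('a \<Rightarrow> complex) \<Rightarrow> complex" where
  "l2_ip \<xi> \<eta> = (\<Sum>\<^sub>\<infinity>n. \<xi> n * cnj (\<eta> n))"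

lemma sq_norm_nonneg [simp]: "0 \<le> sq_norm \<xi>"
  unfolding sq_norm_def by (rule infsum_nonneg) simp

lemma l2_boundI:
  assumes "\<And>F. finite F \<Longrightarrow> (\<Sum>n\<in>F. (cmod (\<xi> n))\<^sup>2) \<le> B"
  shows l2_bounded: "l2 \<xi>" and sq_norm_le: "sq_norm \<xi> \<le> B"
proof -
  show l: "l2 \<xi>" unfolding l2_def
    by (rule nonneg_bdd_above_summable_on) (auto intro!: bdd_aboveI2 assms)
  show "sq_norm \<xi> \<le> B" unfolding sq_norm_def
    by (rule infsum_le_finite_sums) (use l assms in \<open>auto simp: l2_def\<close>)
qed

lemma sum_le_sq_norm: "l2 \<xi> \<Longrightarrow> finite F \<Longrightarrow> (\<Sum>n\<in>F. (cmod (\<xi> n))\<^sup>2) \<le> sq_norm \<xi>"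
  unfolding sq_norm_def l2_def by (rule finite_sum_le_infsum) auto

lemma coord_le_sq_norm: "l2 \<xi> \<Longrightarrow> (cmod (\<xi> n))\<^sup>2 \<le> sq_norm \<xi>"
  using sum_le_sq_norm[of \<xi> "{n}"] by simp

lemma sq_norm_eq_0: "l2 \<xi> \<Longrightarrow> sq_norm \<xi> = 0 \<Longrightarrow> \<xi> = (\<lambda>_. 0)"
  using coord_le_sq_norm[of \<xi>] by fastforce

lemma sq_norm_add_le:
  assumes "l2 \<xi>" "l2 \<eta>"
  shows l2_add: "l2 (\<lambda>n. \<xi> n + \<eta> n)" and sq_norm_add: "sq_norm (\<lambda>n. \<xi> n + \<eta> n) \<le> 2 * sq_norm \<xi> + 2 * sq_norm \<eta>"
proof -
  have *: "(cmod (a + b))\<^sup>2 \<le> 2 * (cmod a)\<^sup>2 + 2 * (cmod b)\<^sup>2" for a b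
  proof -
    have "(cmod (a + b))\<^sup>2 \<le> (cmod a + cmod b)\<^sup>2" by (rule power_mono[OF norm_triangle_ineq]) simp
    also have "\<dots> \<le> 2 * (cmod a)\<^sup>2 + 2 * (cmod b)\<^sup>2"
      using zero_le_power2[of "cmod a - cmod b"] by (simp add: power2_sum power2_diff)
    finally show ?thesis .
  qed
  have "(\<Sum>n\<in>F. (cmod (\<xi> n + \<eta> n))\<^sup>2) \<le> 2 * sq_norm \<xi> + 2 * sq_norm \<eta>" if "finite F" for F
  proof -
    have "(\<Sum>n\<in>F. (cmod (\<xi> n + \<eta> n))\<^sup>2) \<le> (\<Sum>n\<in>F. 2 * (cmod (\<xi> n))\<^sup>2 + 2 * (cmod (\<eta> n))\<^sup>2)"
      by (rule sum_mono) (rule *)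
    also have "\<dots> = 2 * (\<Sum>n\<in>F. (cmod (\<xi> n))\<^sup>2) + 2 * (\<Sum>n\<in>F. (cmod (\<eta> n))\<^sup>2)"
      by (simp add: sum.distrib sum_distrib_left)
    finally show ?thesis using sum_le_sq_norm[OF assms(1) that] sum_le_sq_norm[OF assms(2) that] by simp
  qed
  then show "l2 (\<lambda>n. \<xi> n + \<eta> n)" "sq_norm (\<lambda>n. \<xi> n + \<eta> n) \<le> 2 * sq_norm \<xi> + 2 * sq_norm \<eta>"
    using l2_boundI[of "\<lambda>n. \<xi> n + \<eta> n"] by blast+
qed

lemma l2_scale: "l2 \<xi> \<Longrightarrow> l2 (\<lambda>n. a * \<xi> n)"
  unfolding l2_def norm_mult power_mult_distrib by (rule summable_on_cmult_right)

lemma sq_norm_scale: "sq_norm (\<lambda>n. a * \<xi> n) = (cmod a)\<^sup>2 * sq_norm \<xi>"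
  unfolding sq_norm_def norm_mult power_mult_distrib by (rule infsum_cmult_right')

lemma l2_zero [simp]: "l2 (\<lambda>_. 0)" and sq_norm_zero [simp]: "sq_norm (\<lambda>_. 0) = 0"
  by (simp_all add: l2_def sq_norm_def)

lemma l2_uminus: "l2 \<xi> \<Longrightarrow> l2 (\<lambda>n. - \<xi> n)"
  by (simp add: l2_def)

lemma l2_diff: "l2 \<xi> \<Longrightarrow> l2 \<eta> \<Longrightarrow> l2 (\<lambda>n. \<xi> n - \<eta> n)"
  using l2_add[OF _ l2_uminus, of \<xi> \<eta>] by simp

lemma l2_sum: "finite Z \<Longrightarrow> (\<And>x. x \<in> Z \<Longrightarrow> l2 (f x)) \<Longrightarrow> l2 (\<lambda>n. \<Sum>x\<in>Z. f x n)"
  by (induction Z rule: finite_induct) (auto intro: l2_add)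

lemma l2_ip_summable:
  assumes "l2 \<xi>" "l2 \<eta>" shows "(\<lambda>n. \<xi> n * cnj (\<eta> n)) summable_on UNIV"
proof (rule abs_summable_summable, rule abs_summable_product)
  show "(\<lambda>n. cmod (\<xi> n * \<xi> n)) summable_on UNIV" "(\<lambda>n. cmod (cnj (\<eta> n) * cnj (\<eta> n))) summable_on UNIV"
    using assms by (simp_all add: l2_def norm_mult power2_eq_square)
qed

lemma l2_ip_add_left: "l2 \<xi> \<Longrightarrow> l2 \<eta> \<Longrightarrow> l2 \<zeta> \<Longrightarrow> l2_ip (\<lambda>n. \<xi> n + \<eta> n) \<zeta> = l2_ip \<xi> \<zeta> + l2_ip \<eta> \<zeta>"
  unfolding l2_ip_def distrib_right by (intro infsum_add l2_ip_summable)

lemma l2_ip_scale_left: "l2_ip (\<lambda>n. a * \<xi> n) \<eta> = a * l2_ip \<xi> \<eta>"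
  unfolding l2_ip_def mult.assoc by (rule infsum_cmult_right')

lemma l2_ip_cnj: "l2_ip \<eta> \<xi> = cnj (l2_ip \<xi> \<eta>)"
  unfolding l2_ip_def by (simp flip: infsum_cnj add: mult.commute)

lemma l2_ip_self: "l2 \<xi> \<Longrightarrow> l2_ip \<xi> \<xi> = of_real (sq_norm \<xi>)"
proof -
  assume "l2 \<xi>"
  then have "((\<lambda>n. (cmod (\<xi> n))\<^sup>2) has_sum sq_norm \<xi>) UNIV"
    unfolding l2_def sq_norm_def by (rule has_sum_infsum)
  then have "((\<lambda>n. complex_of_real ((cmod (\<xi> n))\<^sup>2)) has_sum of_real (sq_norm \<xi>)) UNIV"
    by (rule has_sum_of_real)
  then have "(\<Sum>\<^sub>\<infinity>n. complex_of_real ((cmod (\<xi> n))\<^sup>2)) = of_real (sq_norm \<xi>)" by (rule infsumI)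
  then show ?thesis unfolding l2_ip_def complex_norm_square .
qed

definition L2 :: "('a \<Rightarrow> complex) inner_space" where
  "L2 = \<lparr>carrier = {\<xi>. l2 \<xi>}, mult = undefined, one = undefined, zero = (\<lambda>_. 0),
     add = (\<lambda>\<xi> \<eta> n. \<xi> n + \<eta> n), smult = (\<lambda>a \<xi> n. a * \<xi> n), ip = l2_ip\<rparr>"

lemma L2_simps [simp]:
  "carrier L2 = {\<xi>. l2 \<xi>}" "\<zero>\<^bsub>L2\<^esub> = (\<lambda>_. 0)" "\<xi> \<oplus>\<^bsub>L2\<^esub> \<eta> = (\<lambda>n. \<xi> n + \<eta> n)"
  "a \<odot>\<^bsub>L2\<^esub> \<xi> = (\<lambda>n. a * \<xi> n)" "ip L2 = l2_ip"
  by (simp_all add: L2_def)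

lemma hnorm_L2: "l2 \<xi> \<Longrightarrow> hnorm L2 \<xi> = sqrt (sq_norm \<xi>)"
  by (simp add: hnorm_def l2_ip_self)

lemma cring_complex_ring: "cring complex_ring"
  unfolding complex_ring_def
  by (rule cringI, rule abelian_groupI)
    (auto simp: algebra_simps intro!: comm_monoidI exI[of _ "- _"])

lemma abelian_group_L2: "abelian_group L2"
proof (rule abelian_groupI)
  show "\<exists>y\<in>carrier L2. y \<oplus>\<^bsub>L2\<^esub> x = \<zero>\<^bsub>L2\<^esub>" if "x \<in> carrier L2" for x :: "'a \<Rightarrow> complex"
    using that by (intro bexI[of _ "\<lambda>n. - x n"]) (auto intro: l2_uminus)
qed (auto simp: l2_add algebra_simps)

lemma minus_L2:
  assumes "l2 \<xi>" "l2 \<eta>" shows "\<xi> \<ominus>\<^bsub>L2\<^esub> \<eta> = (\<lambda>n. \<xi> n - \<eta> n)"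
proof -
  have "\<ominus>\<^bsub>L2\<^esub> \<eta> = (\<lambda>n. - \<eta> n)"
    by (rule abelian_group.minus_equality[OF abelian_group_L2]) (use assms in \<open>auto intro: l2_uminus\<close>)
  then show ?thesis by (simp add: a_minus_def)
qed

text \<open>The limit is taken in each coordinate. Bounds on finite partial sums pass to it and then
  give the bound on the norm.\<close>

lemma L2_complete:
  fixes X :: "nat \<Rightarrow> 'a \<Rightarrow> complex"
  assumes X: "\<And>n. l2 (X n)"
    and Cauchy: "\<And>e. e > 0 \<Longrightarrow> \<exists>N. \<forall>m\<ge>N. \<forall>n\<ge>N. sq_norm (\<lambda>k. X m k - X n k) < e"
  shows "\<exists>x. l2 x \<and> (\<lambda>n. sq_norm (\<lambda>k. X n k - x k)) \<longlonglongrightarrow> 0"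
proof -
  have "Cauchy (\<lambda>n. X n k)" for k
  proof (rule metric_CauchyI)
    fix e :: real assume "e > 0"
    then obtain N where N: "\<And>m n. m \<ge> N \<Longrightarrow> n \<ge> N \<Longrightarrow> sq_norm (\<lambda>k. X m k - X n k) < e\<^sup>2"
      using Cauchy[of "e\<^sup>2"] by auto
    have "dist (X m k) (X n k) < e" if "m \<ge> N" "n \<ge> N" for m n
    proof -
      have "(cmod (X m k - X n k))\<^sup>2 < e\<^sup>2"
        using coord_le_sq_norm[OF l2_diff[OF X[of m] X[of n]], of k] N[OF that] by linarith
      then show ?thesis using \<open>e > 0\<close> by (simp add: dist_norm power2_less_imp_less)
    qed
    then show "\<exists>N. \<forall>m\<ge>N. \<forall>n\<ge>N. dist (X m k) (X n k) < e" by blast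
  qed
  then have "\<forall>k. \<exists>l. (\<lambda>n. X n k) \<longlonglongrightarrow> l" using Cauchy_convergent convergent_def by blast
  from choice[OF this] obtain x where x: "\<forall>k. (\<lambda>n. X n k) \<longlonglongrightarrow> x k" ..
  have bound: "(\<Sum>k\<in>F. (cmod (X m k - x k))\<^sup>2) \<le> e"
    if N: "\<And>m n. m \<ge> N \<Longrightarrow> n \<ge> N \<Longrightarrow> sq_norm (\<lambda>k. X m k - X n k) < e" and m: "m \<ge> N" and F: "finite F"
    for e m N F
  proof (rule LIMSEQ_le_const2)
    show "(\<lambda>n. \<Sum>k\<in>F. (cmod (X m k - X n k))\<^sup>2) \<longlonglongrightarrow> (\<Sum>k\<in>F. (cmod (X m k - x k))\<^sup>2)"
      using x by (intro tendsto_intros) auto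
    have "(\<Sum>k\<in>F. (cmod (X m k - X n k))\<^sup>2) \<le> e" if "n \<ge> N" for n
      using sum_le_sq_norm[OF l2_diff[OF X[of m] X[of n]] F] N[OF m that] by linarith
    then show "\<exists>N. \<forall>n\<ge>N. (\<Sum>k\<in>F. (cmod (X m k - X n k))\<^sup>2) \<le> e" by blast
  qed
  have "l2 x"
  proof -
    obtain N where N: "\<And>m n. m \<ge> N \<Longrightarrow> n \<ge> N \<Longrightarrow> sq_norm (\<lambda>k. X m k - X n k) < 1"
      using Cauchy[of 1] by auto
    have "l2 (\<lambda>k. X N k - x k)" by (rule l2_bounded, rule bound[OF N]) auto
    from l2_diff[OF X[of N] this] show ?thesis by simp
  qed
  moreover have "(\<lambda>n. sq_norm (\<lambda>k. X n k - x k)) \<longlonglongrightarrow> 0"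
  proof (rule LIMSEQ_I)
    fix e :: real assume "e > 0"
    then obtain N where N: "\<And>m n. m \<ge> N \<Longrightarrow> n \<ge> N \<Longrightarrow> sq_norm (\<lambda>k. X m k - X n k) < e / 2"
      using Cauchy[of "e / 2"] by auto
    have "sq_norm (\<lambda>k. X m k - x k) \<le> e / 2" if "m \<ge> N" for m
      by (rule sq_norm_le, rule bound[OF N that]) auto
    then show "\<exists>N. \<forall>n\<ge>N. norm (sq_norm (\<lambda>k. X n k - x k) - 0) < e" using \<open>e > 0\<close> by fastforce
  qed
  ultimately show ?thesis by blast
qed

lemma hilbert_space_L2: "hilbert_space L2"
proof (intro hilbert_space.intro hilbert_space_axioms.intro)
  show "Module.module complex_ring (L2 :: ('a \<Rightarrow> complex) inner_space)"
    by (rule moduleI[OF cring_complex_ring abelian_group_L2])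
      (auto simp: complex_ring_def l2_scale algebra_simps)
  fix X :: "nat \<Rightarrow> 'a \<Rightarrow> complex"
  assume "\<And>n. X n \<in> carrier L2"
    and C: "\<And>e. e > 0 \<Longrightarrow> \<exists>N. \<forall>m\<ge>N. \<forall>n\<ge>N. hnorm L2 (X m \<ominus>\<^bsub>L2\<^esub> X n) < e"
  then have X: "l2 (X n)" for n by simp
  have hn: "hnorm L2 (X m \<ominus>\<^bsub>L2\<^esub> x) = sqrt (sq_norm (\<lambda>k. X m k - x k))" if "l2 x" for m x
    by (simp add: minus_L2[OF X that] hnorm_L2 l2_diff X that)
  have "\<exists>N. \<forall>m\<ge>N. \<forall>n\<ge>N. sq_norm (\<lambda>k. X m k - X n k) < e" if "e > 0" for e
    using C[of "sqrt e"] that by (simp add: hn X)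
  from L2_complete[OF X this] obtain x where x: "l2 x" "(\<lambda>n. sq_norm (\<lambda>k. X n k - x k)) \<longlonglongrightarrow> 0" by blast
  have "(\<lambda>n. sqrt (sq_norm (\<lambda>k. X n k - x k))) \<longlonglongrightarrow> sqrt 0" by (intro tendsto_real_sqrt x(2))
  then show "\<exists>x\<in>carrier L2. (\<lambda>n. hnorm L2 (X n \<ominus>\<^bsub>L2\<^esub> x)) \<longlonglongrightarrow> 0"
    using x(1) by (intro bexI[of _ x]) (simp_all add: hn)
next
  fix x :: "'a \<Rightarrow> complex" assume "x \<in> carrier L2" "x \<noteq> \<zero>\<^bsub>L2\<^esub>"
  then have "l2 x" "sq_norm x \<noteq> 0" using sq_norm_eq_0 by auto
  then show "0 < Re (ip L2 x x)" by (simp add: l2_ip_self less_le)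
qed (auto simp: l2_ip_add_left l2_ip_scale_left intro: l2_ip_cnj)

section \<open>The direct sum of two sequence spaces\<close>

definition even_part :: "(nat \<Rightarrow> complex) \<Rightarrow> nat \<Rightarrow> complex" where "even_part \<xi> n = \<xi> (2 * n)"
definition odd_part :: "(nat \<Rightarrow> complex) \<Rightarrow> nat \<Rightarrow> complex" where "odd_part \<xi> n = \<xi> (2 * n + 1)"
text \<open>Encodes a pair of sequences as one sequence, so that the direct sum of two copies of the
  Hilbert space is again a space of functions of type
  \<open>nat \<Rightarrow> complex\<close>.\<close>

definition interleave :: "(nat \<Rightarrow> complex) \<Rightarrow> (nat \<Rightarrow> complex) \<Rightarrow> nat \<Rightarrow> complex" where
  "interleave \<alpha> \<beta> n = (if even n then \<alpha> (n div 2) else \<beta> (n div 2))"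

lemma even_part_interleave [simp]: "even_part (interleave \<alpha> \<beta>) = \<alpha>" and odd_part_interleave [simp]: "odd_part (interleave \<alpha> \<beta>) = \<beta>"
  and interleave_even_part_odd_part [simp]: "interleave (even_part \<xi>) (odd_part \<xi>) = \<xi>"
  by (auto simp: even_part_def odd_part_def interleave_def fun_eq_iff)

lemma interleave_add: "(\<lambda>n. interleave \<alpha> \<beta> n + interleave \<gamma> \<delta> n) = interleave (\<lambda>n. \<alpha> n + \<gamma> n) (\<lambda>n. \<beta> n + \<delta> n)"
  and interleave_scale: "(\<lambda>n. a * interleave \<alpha> \<beta> n) = interleave (\<lambda>n. a * \<alpha> n) (\<lambda>n. a * \<beta> n)"
  and interleave_sum: "(\<lambda>n. \<Sum>x\<in>Z. interleave (f x) (g x) n) = interleave (\<lambda>n. \<Sum>x\<in>Z. f x n) (\<lambda>n. \<Sum>x\<in>Z. g x n)"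
  by (auto simp: interleave_def fun_eq_iff)

lemma l2_interleave_sq_norm:
  assumes "l2 \<alpha>" "l2 \<beta>"
  shows l2_interleave: "l2 (interleave \<alpha> \<beta>)" and sq_norm_interleave: "sq_norm (interleave \<alpha> \<beta>) = sq_norm \<alpha> + sq_norm \<beta>"
proof -
  let ?e = "\<lambda>n::nat. 2 * n" and ?o = "\<lambda>n::nat. Suc (2 * n)"
  have inj: "inj ?e" "inj ?o" by (auto simp: inj_def)
  have "((\<lambda>n. (cmod (\<alpha> n))\<^sup>2) has_sum sq_norm \<alpha>) UNIV" "((\<lambda>n. (cmod (\<beta> n))\<^sup>2) has_sum sq_norm \<beta>) UNIV"
    using assms by (auto simp: l2_def sq_norm_def)
  then have "((\<lambda>n. (cmod (interleave \<alpha> \<beta> n))\<^sup>2) has_sum sq_norm \<alpha>) (range ?e)"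
    "((\<lambda>n. (cmod (interleave \<alpha> \<beta> n))\<^sup>2) has_sum sq_norm \<beta>) (range ?o)"
    by (simp_all add: has_sum_reindex[OF inj(1)] has_sum_reindex[OF inj(2)] o_def interleave_def)
  moreover have "range ?e \<inter> range ?o = {}" by (auto simp: image_def) presburger
  ultimately have "((\<lambda>n. (cmod (interleave \<alpha> \<beta> n))\<^sup>2) has_sum (sq_norm \<alpha> + sq_norm \<beta>)) (range ?e \<union> range ?o)"
    by (rule has_sum_Un_disjoint)
  moreover have "range ?e \<union> range ?o = UNIV" by (auto simp: image_def) presburger
  ultimately have "((\<lambda>n. (cmod (interleave \<alpha> \<beta> n))\<^sup>2) has_sum (sq_norm \<alpha> + sq_norm \<beta>)) UNIV" by simp
  then show "l2 (interleave \<alpha> \<beta>)" "sq_norm (interleave \<alpha> \<beta>) = sq_norm \<alpha> + sq_norm \<beta>"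
    unfolding l2_def sq_norm_def[of "interleave \<alpha> \<beta>"] by (auto simp: summable_on_def intro: infsumI)
qed

lemma l2_even_part: "l2 \<xi> \<Longrightarrow> l2 (even_part \<xi>)" and l2_odd_part: "l2 \<xi> \<Longrightarrow> l2 (odd_part \<xi>)"
proof -
  assume l: "l2 \<xi>"
  have "(\<Sum>n\<in>F. (cmod (even_part \<xi> n))\<^sup>2) \<le> sq_norm \<xi>" if "finite F" for F
  proof -
    have "(\<Sum>n\<in>F. (cmod (even_part \<xi> n))\<^sup>2) = (\<Sum>n\<in>(\<lambda>n. 2 * n) ` F. (cmod (\<xi> n))\<^sup>2)"
      by (subst sum.reindex) (auto simp: inj_on_def even_part_def)
    then show ?thesis using sum_le_sq_norm[OF l, of "(\<lambda>n. 2 * n) ` F"] that by simp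
  qed
  then show "l2 (even_part \<xi>)" by (rule l2_bounded)
  have "(\<Sum>n\<in>F. (cmod (odd_part \<xi> n))\<^sup>2) \<le> sq_norm \<xi>" if "finite F" for F
  proof -
    have "(\<Sum>n\<in>F. (cmod (odd_part \<xi> n))\<^sup>2) = (\<Sum>n\<in>(\<lambda>n. 2 * n + 1) ` F. (cmod (\<xi> n))\<^sup>2)"
      by (subst sum.reindex) (auto simp: inj_on_def odd_part_def)
    then show ?thesis using sum_le_sq_norm[OF l, of "(\<lambda>n. 2 * n + 1) ` F"] that by simp
  qed
  then show "l2 (odd_part \<xi>)" by (rule l2_bounded)
qed

lemma sq_norm_split: "l2 \<xi> \<Longrightarrow> sq_norm \<xi> = sq_norm (even_part \<xi>) + sq_norm (odd_part \<xi>)"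
  using sq_norm_interleave[OF l2_even_part l2_odd_part, of \<xi> \<xi>] by simp

text \<open>The Schur test, first for finite sections of the kernel.\<close>

lemma kernel_operator_finite:
  fixes d :: "'a \<Rightarrow> 'b \<Rightarrow> complex"
  assumes rows: "\<And>x Y. finite Y \<Longrightarrow> (\<Sum>y\<in>Y. cmod (d x y)) \<le> C"
    and cols: "\<And>y X. finite X \<Longrightarrow> (\<Sum>x\<in>X. cmod (d x y)) \<le> C"
    and "finite X" "finite Y"
  shows "(\<Sum>x\<in>X. (cmod (\<Sum>y\<in>Y. d x y * \<beta> y))\<^sup>2) \<le> C\<^sup>2 * (\<Sum>y\<in>Y. (cmod (\<beta> y))\<^sup>2)"
proof -
  have C: "0 \<le> C" using rows[of "{}"] by simp
  have "(cmod (\<Sum>y\<in>Y. d x y * \<beta> y))\<^sup>2 \<le> C * (\<Sum>y\<in>Y. cmod (d x y) * (cmod (\<beta> y))\<^sup>2)" for x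
  proof -
    \<comment> \<open>The weight is split into two square roots, so that Cauchy-Schwarz leaves the
      row sum in one factor and the weighted squares in the other.\<close>
    have "cmod (\<Sum>y\<in>Y. d x y * \<beta> y) \<le> (\<Sum>y\<in>Y. sqrt (cmod (d x y)) * (sqrt (cmod (d x y)) * cmod (\<beta> y)))"
      by (rule order_trans[OF norm_sum]) (simp add: norm_mult flip: mult.assoc)
    then have "(cmod (\<Sum>y\<in>Y. d x y * \<beta> y))\<^sup>2 \<le> (\<Sum>y\<in>Y. sqrt (cmod (d x y)) * (sqrt (cmod (d x y)) * cmod (\<beta> y)))\<^sup>2"
      by (rule power_mono) simp
    also have "\<dots> \<le> (\<Sum>y\<in>Y. (sqrt (cmod (d x y)))\<^sup>2) * (\<Sum>y\<in>Y. (sqrt (cmod (d x y)) * cmod (\<beta> y))\<^sup>2)"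
      by (rule Cauchy_Schwarz_ineq_sum)
    also have "\<dots> = (\<Sum>y\<in>Y. cmod (d x y)) * (\<Sum>y\<in>Y. cmod (d x y) * (cmod (\<beta> y))\<^sup>2)"
      by (simp add: power_mult_distrib)
    also have "\<dots> \<le> C * (\<Sum>y\<in>Y. cmod (d x y) * (cmod (\<beta> y))\<^sup>2)"
      by (rule mult_right_mono[OF rows[OF assms(4)]]) (simp add: sum_nonneg)
    finally show ?thesis .
  qed
  then have "(\<Sum>x\<in>X. (cmod (\<Sum>y\<in>Y. d x y * \<beta> y))\<^sup>2) \<le> (\<Sum>x\<in>X. C * (\<Sum>y\<in>Y. cmod (d x y) * (cmod (\<beta> y))\<^sup>2))"
    by (rule sum_mono)
  also have "\<dots> = C * (\<Sum>y\<in>Y. (\<Sum>x\<in>X. cmod (d x y)) * (cmod (\<beta> y))\<^sup>2)"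
    by (simp add: sum_distrib_left[symmetric] sum_distrib_right sum.swap[of _ X Y])
  also have "\<dots> \<le> C * (\<Sum>y\<in>Y. C * (cmod (\<beta> y))\<^sup>2)"
    using C by (intro mult_left_mono sum_mono mult_right_mono cols[OF assms(3)]) auto
  finally show ?thesis by (simp add: sum_distrib_left power2_eq_square mult.assoc)
qed

lemma kernel_operator_summable:
  assumes rows: "\<And>x Y. finite Y \<Longrightarrow> (\<Sum>y\<in>Y. cmod (d x y)) \<le> C" and "l2 \<beta>"
  shows "(\<lambda>y. d x y * \<beta> y) summable_on UNIV"
proof (rule abs_summable_summable, rule nonneg_bdd_above_summable_on)
  have \<beta>: "cmod (\<beta> y) \<le> sqrt (sq_norm \<beta>)" for y
    using coord_le_sq_norm[OF assms(2), of y] by (rule real_le_rsqrt)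
  have "(\<Sum>y\<in>Y. cmod (d x y * \<beta> y)) \<le> C * sqrt (sq_norm \<beta>)" if "finite Y" for Y
  proof -
    have "(\<Sum>y\<in>Y. cmod (d x y * \<beta> y)) \<le> (\<Sum>y\<in>Y. cmod (d x y) * sqrt (sq_norm \<beta>))"
      by (rule sum_mono) (simp add: norm_mult mult_left_mono \<beta>)
    also have "\<dots> \<le> C * sqrt (sq_norm \<beta>)"
      unfolding sum_distrib_right[symmetric] by (rule mult_right_mono[OF rows[OF that]]) simp
    finally show ?thesis .
  qed
  then show "bdd_above (sum (\<lambda>y. cmod (d x y * \<beta> y)) ` {F. F \<subseteq> UNIV \<and> finite F})"
    by (auto intro!: bdd_aboveI2)
qed simp

lemma kernel_operator:
  fixes d :: "'a \<Rightarrow> 'b \<Rightarrow> complex"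
  assumes rows: "\<And>x Y. finite Y \<Longrightarrow> (\<Sum>y\<in>Y. cmod (d x y)) \<le> C"
    and cols: "\<And>y X. finite X \<Longrightarrow> (\<Sum>x\<in>X. cmod (d x y)) \<le> C"
    and \<beta>: "l2 \<beta>"
  shows l2_kernel_operator: "l2 (\<lambda>x. \<Sum>\<^sub>\<infinity>y. d x y * \<beta> y)"
    and sq_norm_kernel_operator: "sq_norm (\<lambda>x. \<Sum>\<^sub>\<infinity>y. d x y * \<beta> y) \<le> C\<^sup>2 * sq_norm \<beta>"
proof -
  have "(\<Sum>x\<in>X. (cmod (\<Sum>\<^sub>\<infinity>y. d x y * \<beta> y))\<^sup>2) \<le> C\<^sup>2 * sq_norm \<beta>" if X: "finite X" for X
  proof (rule tendsto_upperbound)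
    show "((\<lambda>Y. \<Sum>x\<in>X. (cmod (\<Sum>y\<in>Y. d x y * \<beta> y))\<^sup>2) \<longlongrightarrow> (\<Sum>x\<in>X. (cmod (\<Sum>\<^sub>\<infinity>y. d x y * \<beta> y))\<^sup>2))
        (finite_subsets_at_top UNIV)"
      by (intro tendsto_intros infsum_tendsto kernel_operator_summable[OF rows \<beta>])
    have "(\<Sum>x\<in>X. (cmod (\<Sum>y\<in>Y. d x y * \<beta> y))\<^sup>2) \<le> C\<^sup>2 * sq_norm \<beta>" if Y: "finite Y" for Y
      using kernel_operator_finite[where d = d and \<beta> = \<beta>, OF rows cols X Y]
        mult_left_mono[OF sum_le_sq_norm[OF \<beta> Y], of "C\<^sup>2"] by simp
    then show "\<forall>\<^sub>F Y in finite_subsets_at_top UNIV. (\<Sum>x\<in>X. (cmod (\<Sum>y\<in>Y. d x y * \<beta> y))\<^sup>2) \<le> C\<^sup>2 * sq_norm \<beta>"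
      by (intro eventually_finite_subsets_at_top_weakI)
  qed (rule finite_subsets_at_top_neq_bot)
  then show "l2 (\<lambda>x. \<Sum>\<^sub>\<infinity>y. d x y * \<beta> y)" "sq_norm (\<lambda>x. \<Sum>\<^sub>\<infinity>y. d x y * \<beta> y) \<le> C\<^sup>2 * sq_norm \<beta>"
    using l2_boundI[of "\<lambda>x. \<Sum>\<^sub>\<infinity>y. d x y * \<beta> y"] by blast+
qed

section \<open>The triangular representation\<close>

locale split_group = group G for G :: "nat monoid" (structure) +
  fixes \<phi> :: "nat \<Rightarrow> real" and f g :: "nat \<Rightarrow> nat \<Rightarrow> real" and C :: real
  assumes carrier_UNIV [simp]: "carrier G = UNIV"
    and split: "row_column_split G \<phi> f g C"
begin

lemma f_nonneg: "0 \<le> f x y" and g_nonneg: "0 \<le> g x y"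
  and split_eq: "f x y + g x y = \<phi> (y \<otimes> inv x)"
  and f_bound: "finite Y \<Longrightarrow> (\<Sum>y\<in>Y. f x y) \<le> C" and g_bound: "finite X \<Longrightarrow> (\<Sum>x\<in>X. g x y) \<le> C"
  using split by (simp_all add: row_column_split_def)

lemma inj_rtrans: "inj_on (\<lambda>x. x \<otimes> t) X"
  by (rule inj_onI) simp

lemma bij_rtrans: "bij_betw (\<lambda>x. x \<otimes> t) UNIV UNIV"
proof (rule bij_betwI[where g = "\<lambda>x. x \<otimes> inv t"])
  show "x \<otimes> t \<otimes> inv t = x" "x \<otimes> inv t \<otimes> t = x" for x by (simp_all add: m_assoc)
qed auto

text \<open>The right regular representation.\<close>

definition rho :: "nat \<Rightarrow> (nat \<Rightarrow> complex) \<Rightarrow> nat \<Rightarrow> complex" where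
  "rho t \<xi> x = \<xi> (x \<otimes> t)"

lemma l2_rho: "l2 \<xi> \<Longrightarrow> l2 (rho t \<xi>)"
  unfolding l2_def rho_def using summable_on_reindex_bij_betw[OF bij_rtrans, of "\<lambda>n. (cmod (\<xi> n))\<^sup>2"] by simp

lemma sq_norm_rho: "sq_norm (rho t \<xi>) = sq_norm \<xi>"
  unfolding sq_norm_def rho_def by (rule infsum_reindex_bij_betw[OF bij_rtrans])

text \<open>Let F be the matrix with entry \<open>f x y\<close> in row \<open>y\<close> and column
  \<open>x\<close>. This is the matrix of F minus its conjugate by \<open>rho t\<close>, which is
  bounded even where F is not.\<close>

definition ker :: "nat \<Rightarrow> nat \<Rightarrow> nat \<Rightarrow> complex" where
  "ker t y x = of_real (f x y - f (x \<otimes> t) (y \<otimes> t))"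

lemma cmod_ker: "cmod (ker t y x) = \<bar>f x y - f (x \<otimes> t) (y \<otimes> t)\<bar>"
  unfolding ker_def by (rule norm_of_real)

lemma ker_col:
  assumes "finite Y" shows "(\<Sum>y\<in>Y. cmod (ker t y x)) \<le> 2 * C"
proof -
  have "(\<Sum>y\<in>Y. cmod (ker t y x)) \<le> (\<Sum>y\<in>Y. f x y + f (x \<otimes> t) (y \<otimes> t))"
    using f_nonneg by (intro sum_mono) (simp add: cmod_ker abs_le_iff add_increasing add_increasing2)
  also have "\<dots> = (\<Sum>y\<in>Y. f x y) + (\<Sum>y\<in>(\<lambda>y. y \<otimes> t) ` Y. f (x \<otimes> t) y)"
    by (simp add: sum.distrib sum.reindex[OF inj_rtrans])
  also have "\<dots> \<le> C + C" by (intro add_mono f_bound) (use assms in auto)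
  finally show ?thesis by simp
qed

text \<open>The values of \<phi> cancel, because
  \<open>(y t) (x t)\<inverse> = y x\<inverse>\<close>. The difference of the values of
  \<open>f\<close> is thus one of values of \<open>g\<close>, whose columns are bounded.\<close>

lemma ker_row:
  assumes "finite X" shows "(\<Sum>x\<in>X. cmod (ker t y x)) \<le> 2 * C"
proof -
  have "y \<otimes> t \<otimes> inv (x \<otimes> t) = y \<otimes> inv x" for x
    by (simp add: inv_mult_group m_assoc) (simp flip: m_assoc)
  then have "f x y - f (x \<otimes> t) (y \<otimes> t) = g (x \<otimes> t) (y \<otimes> t) - g x y" for x
    using split_eq[of x y] split_eq[of "x \<otimes> t" "y \<otimes> t"] by simp
  then have "(\<Sum>x\<in>X. cmod (ker t y x)) \<le> (\<Sum>x\<in>X. g x y + g (x \<otimes> t) (y \<otimes> t))"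
    using g_nonneg by (intro sum_mono) (simp add: cmod_ker abs_le_iff add_increasing add_increasing2)
  also have "\<dots> = (\<Sum>x\<in>X. g x y) + (\<Sum>x\<in>(\<lambda>x. x \<otimes> t) ` X. g x (y \<otimes> t))"
    by (simp add: sum.distrib sum.reindex[OF inj_rtrans])
  also have "\<dots> \<le> C + C" by (intro add_mono g_bound) (use assms in auto)
  finally show ?thesis by simp
qed

definition cross :: "nat \<Rightarrow> (nat \<Rightarrow> complex) \<Rightarrow> nat \<Rightarrow> complex" where
  "cross t \<beta> y = (\<Sum>\<^sub>\<infinity>x. ker t y x * \<beta> x)"

lemma cross_summable: "l2 \<beta> \<Longrightarrow> (\<lambda>x. ker t y x * \<beta> x) summable_on UNIV"
  by (rule kernel_operator_summable[where C = "2 * C"]) (rule ker_row)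

lemma l2_cross: "l2 \<beta> \<Longrightarrow> l2 (cross t \<beta>)"
  unfolding cross_def[abs_def] by (rule l2_kernel_operator[OF ker_row ker_col])

lemma sq_norm_cross: "l2 \<beta> \<Longrightarrow> sq_norm (cross t \<beta>) \<le> (2 * C)\<^sup>2 * sq_norm \<beta>"
  unfolding cross_def[abs_def] by (rule sq_norm_kernel_operator[OF ker_row ker_col])

lemma cross_add: "l2 \<beta> \<Longrightarrow> l2 \<gamma> \<Longrightarrow> cross t (\<lambda>n. \<beta> n + \<gamma> n) y = cross t \<beta> y + cross t \<gamma> y"
  unfolding cross_def distrib_left by (intro infsum_add cross_summable)

lemma cross_scale: "cross t (\<lambda>n. a * \<beta> n) y = a * cross t \<beta> y"
proof -
  have "cross t (\<lambda>n. a * \<beta> n) y = (\<Sum>\<^sub>\<infinity>x. a * (ker t y x * \<beta> x))"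
    unfolding cross_def by (simp add: mult.left_commute)
  then show ?thesis unfolding cross_def by (simp add: infsum_cmult_right')
qed

lemma rho_add: "rho t (\<lambda>n. \<xi> n + \<eta> n) = (\<lambda>n. rho t \<xi> n + rho t \<eta> n)"
  and rho_scale: "rho t (\<lambda>n. a * \<xi> n) = (\<lambda>n. a * rho t \<xi> n)"
  and rho_rho: "rho s (rho t \<xi>) = rho (s \<otimes> t) \<xi>"
  by (simp_all add: rho_def fun_eq_iff m_assoc)

text \<open>Formally the conjugate of two copies of \<open>rho t\<close> by the unipotent block
  matrix with F in its upper right corner. The even part is the invariant first summand.\<close>

definition act :: "nat \<Rightarrow> (nat \<Rightarrow> complex) \<Rightarrow> nat \<Rightarrow> complex" where
  "act t \<xi> = interleave (\<lambda>y. rho t (even_part \<xi>) y + cross t (rho t (odd_part \<xi>)) y) (rho t (odd_part \<xi>))"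

lemma l2_act: "l2 \<xi> \<Longrightarrow> l2 (act t \<xi>)"
  unfolding act_def by (intro l2_interleave l2_add l2_rho l2_cross l2_even_part l2_odd_part)

lemma sq_norm_act:
  assumes "l2 \<xi>" shows "sq_norm (act t \<xi>) \<le> (3 + 8 * C\<^sup>2) * sq_norm \<xi>"
proof -
  have e: "l2 (even_part \<xi>)" and o: "l2 (odd_part \<xi>)" using assms by (auto intro: l2_even_part l2_odd_part)
  have "sq_norm (act t \<xi>) = sq_norm (\<lambda>y. rho t (even_part \<xi>) y + cross t (rho t (odd_part \<xi>)) y) + sq_norm (rho t (odd_part \<xi>))"
    unfolding act_def by (intro sq_norm_interleave l2_add l2_rho l2_cross e o)
  also have "\<dots> \<le> (2 * sq_norm (rho t (even_part \<xi>)) + 2 * sq_norm (cross t (rho t (odd_part \<xi>)))) + sq_norm (odd_part \<xi>)"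
    by (intro add_mono sq_norm_add l2_rho l2_cross e o) (simp add: sq_norm_rho)
  also have "\<dots> \<le> (2 * sq_norm (even_part \<xi>) + 2 * ((2 * C)\<^sup>2 * sq_norm (odd_part \<xi>))) + sq_norm (odd_part \<xi>)"
    using sq_norm_cross[OF l2_rho[OF o], of t t] by (simp add: sq_norm_rho algebra_simps)
  also have "\<dots> \<le> (3 + 8 * C\<^sup>2) * (sq_norm (even_part \<xi>) + sq_norm (odd_part \<xi>))"
  proof -
    have "0 \<le> sq_norm (even_part \<xi>) + 2 * sq_norm (odd_part \<xi>) + 8 * C\<^sup>2 * sq_norm (even_part \<xi>)" by simp
    then show ?thesis by (simp add: algebra_simps)
  qed
  also have "\<dots> = (3 + 8 * C\<^sup>2) * sq_norm \<xi>" by (simp add: sq_norm_split[OF assms])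
  finally show ?thesis .
qed

lemma act_add:
  assumes "l2 \<xi>" "l2 \<eta>" shows "act t (\<lambda>n. \<xi> n + \<eta> n) = (\<lambda>n. act t \<xi> n + act t \<eta> n)"
proof -
  have "even_part (\<lambda>n. \<xi> n + \<eta> n) = (\<lambda>n. even_part \<xi> n + even_part \<eta> n)" "odd_part (\<lambda>n. \<xi> n + \<eta> n) = (\<lambda>n. odd_part \<xi> n + odd_part \<eta> n)"
    by (auto simp: even_part_def odd_part_def)
  then show ?thesis
    unfolding act_def interleave_add
    by (simp add: rho_add cross_add l2_rho l2_odd_part assms algebra_simps)
qed

lemma act_scale: "act t (\<lambda>n. a * \<xi> n) = (\<lambda>n. a * act t \<xi> n)"
proof -
  have "even_part (\<lambda>n. a * \<xi> n) = (\<lambda>n. a * even_part \<xi> n)" "odd_part (\<lambda>n. a * \<xi> n) = (\<lambda>n. a * odd_part \<xi> n)"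
    by (auto simp: even_part_def odd_part_def)
  then show ?thesis
    unfolding act_def interleave_scale by (simp add: rho_scale cross_scale algebra_simps)
qed

lemma act_one: "act \<one> \<xi> = \<xi>"
proof -
  have "rho \<one> \<beta> = \<beta>" "cross \<one> \<beta> = (\<lambda>_. 0)" for \<beta>
    by (auto simp: rho_def cross_def ker_def fun_eq_iff)
  then show ?thesis by (simp add: act_def)
qed

text \<open>The cocycle identity behind multiplicativity of \<open>act\<close>. After the
  substitution of \<open>x \<otimes> s\<close> for \<open>x\<close>, the kernels telescope.\<close>

lemma cross_rho:
  assumes "l2 \<beta>"
  shows "rho s (cross t (rho t \<beta>)) y + cross s (rho (s \<otimes> t) \<beta>) y = cross (s \<otimes> t) (rho (s \<otimes> t) \<beta>) y"
proof -
  let ?\<gamma> = "rho (s \<otimes> t) \<beta>"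
  have "rho s (cross t (rho t \<beta>)) y = (\<Sum>\<^sub>\<infinity>x. ker t (y \<otimes> s) x * rho t \<beta> x)"
    by (simp add: rho_def[of s] cross_def)
  also have "\<dots> = (\<Sum>\<^sub>\<infinity>x. ker t (y \<otimes> s) (x \<otimes> s) * rho t \<beta> (x \<otimes> s))"
    by (rule infsum_reindex_bij_betw[OF bij_rtrans, symmetric])
  also have "\<dots> = (\<Sum>\<^sub>\<infinity>x. ker t (y \<otimes> s) (x \<otimes> s) * ?\<gamma> x)"
    by (simp add: rho_def m_assoc)
  finally have 1: "rho s (cross t (rho t \<beta>)) y = (\<Sum>\<^sub>\<infinity>x. ker t (y \<otimes> s) (x \<otimes> s) * ?\<gamma> x)" .
  have eq: "ker t (y \<otimes> s) (x \<otimes> s) * ?\<gamma> x + ker s y x * ?\<gamma> x = ker (s \<otimes> t) y x * ?\<gamma> x" for x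
    by (simp add: ker_def m_assoc algebra_simps)
  have l: "l2 ?\<gamma>" by (rule l2_rho[OF assms])
  \<comment> \<open>Summability of the translated series is read off from the other two, of which it
    is the difference.\<close>
  have "(\<lambda>x. ker t (y \<otimes> s) (x \<otimes> s) * ?\<gamma> x) = (\<lambda>x. ker (s \<otimes> t) y x * ?\<gamma> x + (-1) * (ker s y x * ?\<gamma> x))"
    using eq by (simp add: fun_eq_iff algebra_simps)
  moreover have "\<dots> summable_on UNIV"
    by (intro summable_on_add summable_on_cmult_right cross_summable l)
  ultimately have "(\<lambda>x. ker t (y \<otimes> s) (x \<otimes> s) * ?\<gamma> x) summable_on UNIV" by simp
  from infsum_add[OF this cross_summable[OF l, of s y]] show ?thesis
    unfolding 1 eq by (simp add: cross_def)
qed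

lemma act_act:
  assumes "l2 \<xi>" shows "act s (act t \<xi>) = act (s \<otimes> t) \<xi>"
proof -
  have "rho s (\<lambda>y. rho t (even_part \<xi>) y + cross t (rho t (odd_part \<xi>)) y) y + cross s (rho (s \<otimes> t) (odd_part \<xi>)) y
      = rho (s \<otimes> t) (even_part \<xi>) y + cross (s \<otimes> t) (rho (s \<otimes> t) (odd_part \<xi>)) y" for y
    using cross_rho[OF l2_odd_part[OF assms], of s t y] by (simp add: rho_add rho_rho)
  then show ?thesis unfolding act_def by (simp add: rho_rho)
qed

definition triangular_rep :: "nat \<Rightarrow> (nat \<Rightarrow> complex) \<Rightarrow> nat \<Rightarrow> complex" where
  "triangular_rep t = restrict (act t) (carrier L2)"

lemma hnorm_act: "l2 \<xi> \<Longrightarrow> hnorm L2 (act t \<xi>) \<le> sqrt (3 + 8 * C\<^sup>2) * hnorm L2 \<xi>"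
  using sq_norm_act[of \<xi> t] by (simp add: hnorm_L2 l2_act flip: real_sqrt_mult)

lemma triangular_rep_bounded: "triangular_rep t \<in> carrier (bounded_operators L2)"
proof -
  have "bounded_operator L2 (triangular_rep t)"
    unfolding bounded_operator_def
  proof (intro conjI ballI allI exI[of _ "sqrt (3 + 8 * C\<^sup>2)"])
    show "triangular_rep t \<in> carrier L2 \<rightarrow> carrier L2" by (auto simp: triangular_rep_def l2_act)
  qed (simp_all add: triangular_rep_def l2_add l2_scale act_add act_scale hnorm_act)
  then show ?thesis by (simp add: bounded_operators_def triangular_rep_def)
qed

lemma triangular_rep_mult: "compose (carrier L2) (triangular_rep s) (triangular_rep t) = triangular_rep (s \<otimes> t)"
  by (auto simp: compose_def triangular_rep_def fun_eq_iff l2_act act_act)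

lemma triangular_rep_Units: "triangular_rep t \<in> Units (bounded_operators L2)"
proof -
  have "triangular_rep \<one> = \<one>\<^bsub>bounded_operators L2\<^esub>"
    by (auto simp: triangular_rep_def bounded_operators_def act_one)
  then have "triangular_rep (inv t) \<otimes>\<^bsub>bounded_operators L2\<^esub> triangular_rep t = \<one>\<^bsub>bounded_operators L2\<^esub>"
    "triangular_rep t \<otimes>\<^bsub>bounded_operators L2\<^esub> triangular_rep (inv t) = \<one>\<^bsub>bounded_operators L2\<^esub>"
    using triangular_rep_mult[of "inv t" t] triangular_rep_mult[of t "inv t"] by (simp_all add: bounded_operators_def)
  then show ?thesis unfolding Units_def using triangular_rep_bounded by blast
qed

lemma representation_triangular_rep: "representation G L2 triangular_rep"
  unfolding representation_def hom_def
  using triangular_rep_Units by (simp add: units_of_def triangular_rep_mult[symmetric] bounded_operators_def)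

lemma uniformly_bounded_triangular_rep: "uniformly_bounded G L2 triangular_rep"
  unfolding uniformly_bounded_def
proof (rule bdd_aboveI2)
  fix t
  show "op_norm L2 (triangular_rep t) \<le> sqrt (3 + 8 * C\<^sup>2)"
    unfolding op_norm_def
  proof (rule cSUP_least)
    show "{x \<in> carrier L2. hnorm L2 x \<le> 1} \<noteq> {}"
      by (auto intro!: exI[of _ "\<lambda>_. 0"] simp: hnorm_L2)
    fix x :: "nat \<Rightarrow> complex" assume x: "x \<in> {x \<in> carrier L2. hnorm L2 x \<le> 1}"
    then have "hnorm L2 (triangular_rep t x) \<le> sqrt (3 + 8 * C\<^sup>2) * hnorm L2 x"
      by (simp add: triangular_rep_def hnorm_act)
    also have "\<dots> \<le> sqrt (3 + 8 * C\<^sup>2) * 1" using x by (intro mult_left_mono) auto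
    finally show "hnorm L2 (triangular_rep t x) \<le> sqrt (3 + 8 * C\<^sup>2)" by simp
  qed
qed

end

section \<open>The monoid of bounded operators\<close>

lemma monoid_bounded_operators: "monoid (bounded_operators (L2 :: ('a \<Rightarrow> complex) inner_space))"
proof (rule monoidI)
  let ?B = "bounded_operators (L2 :: ('a \<Rightarrow> complex) inner_space)"
  let ?H = "L2 :: ('a \<Rightarrow> complex) inner_space"
  show "S \<otimes>\<^bsub>?B\<^esub> T \<in> carrier ?B" if S: "S \<in> carrier ?B" and T: "T \<in> carrier ?B" for S T
  proof -
    obtain c where c: "\<And>x. x \<in> carrier ?H \<Longrightarrow> hnorm ?H (S x) \<le> c * hnorm ?H x"
      using S by (auto simp: bounded_operators_def bounded_operator_def)
    obtain d where d: "\<And>x. x \<in> carrier ?H \<Longrightarrow> hnorm ?H (T x) \<le> d * hnorm ?H x"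
      using T by (auto simp: bounded_operators_def bounded_operator_def)
    have Tc: "T x \<in> carrier ?H" if "x \<in> carrier ?H" for x
      using T that by (auto simp: bounded_operators_def bounded_operator_def)
    have pos: "0 \<le> hnorm ?H x" if "x \<in> carrier ?H" for x using that by (simp add: hnorm_L2)
    \<comment> \<open>The sign of \<open>c\<close> is not known, and its absolute value lets the
      second estimate be multiplied through.\<close>
    have "hnorm ?H (S (T x)) \<le> \<bar>c\<bar> * d * hnorm ?H x" if x: "x \<in> carrier ?H" for x
    proof -
      have "hnorm ?H (S (T x)) \<le> c * hnorm ?H (T x)" by (rule c[OF Tc[OF x]])
      also have "\<dots> \<le> \<bar>c\<bar> * hnorm ?H (T x)" by (intro mult_right_mono pos Tc x) simp
      also have "\<dots> \<le> \<bar>c\<bar> * (d * hnorm ?H x)" by (intro mult_left_mono d x) simp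
      finally show ?thesis by (simp add: mult.assoc)
    qed
    then have "bounded_operator ?H (compose (carrier ?H) S T)"
      using S T unfolding bounded_operators_def bounded_operator_def
      by (auto simp: compose_def Pi_iff l2_add l2_scale intro!: exI[of _ "\<bar>c\<bar> * d"])
    then show ?thesis by (simp add: bounded_operators_def)
  qed
  show "\<one>\<^bsub>?B\<^esub> \<in> carrier ?B"
    by (auto simp: bounded_operators_def bounded_operator_def l2_add l2_scale intro!: exI[of _ 1])
  show "S \<otimes>\<^bsub>?B\<^esub> T \<otimes>\<^bsub>?B\<^esub> U = S \<otimes>\<^bsub>?B\<^esub> (T \<otimes>\<^bsub>?B\<^esub> U)"
    if "S \<in> carrier ?B" "T \<in> carrier ?B" "U \<in> carrier ?B" for S T U
    using that by (auto simp: bounded_operators_def bounded_operator_def compose_def fun_eq_iff Pi_iff)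
  show "\<one>\<^bsub>?B\<^esub> \<otimes>\<^bsub>?B\<^esub> S = S" "S \<otimes>\<^bsub>?B\<^esub> \<one>\<^bsub>?B\<^esub> = S" if "S \<in> carrier ?B" for S
    using that by (auto simp: bounded_operators_def bounded_operator_def compose_def fun_eq_iff Pi_iff extensional_def)
qed

lemma bounded_operator_sq_norm:
  assumes "T \<in> carrier (bounded_operators L2)"
  shows "\<exists>c\<ge>0. \<forall>\<xi>. l2 \<xi> \<longrightarrow> sq_norm (T \<xi>) \<le> c * sq_norm \<xi>"
proof -
  obtain c where c: "\<And>x. l2 x \<Longrightarrow> hnorm L2 (T x) \<le> c * hnorm L2 x"
    using assms by (auto simp: bounded_operators_def bounded_operator_def)
  have "sq_norm (T \<xi>) \<le> c\<^sup>2 * sq_norm \<xi>" if "l2 \<xi>" for \<xi>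
  proof -
    have "l2 (T \<xi>)" using assms that by (auto simp: bounded_operators_def bounded_operator_def)
    then have "sqrt (sq_norm (T \<xi>)) \<le> c * sqrt (sq_norm \<xi>)" using c[OF that] that by (simp add: hnorm_L2)
    then have "(sqrt (sq_norm (T \<xi>)))\<^sup>2 \<le> (c * sqrt (sq_norm \<xi>))\<^sup>2" by (rule power_mono) simp
    then show ?thesis by (simp add: power_mult_distrib)
  qed
  then show ?thesis by (intro exI[of _ "c\<^sup>2"]) auto
qed

section \<open>Invariant inner products\<close>

context split_group
begin

text \<open>\<open>T\<close> is the inverse of the unitarizing operator. Pulling the inner product
  back along \<open>T\<close> gives an equivalent one for which the representation is
  unitary.\<close>

lemma invariant_form_of_unitarizable:
  assumes "unitarizable_representation G L2 triangular_rep"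
  shows "\<exists>T c1 c2. T \<in> carrier (bounded_operators L2) \<and> c1 \<ge> 0 \<and> c2 \<ge> 0 \<and>
    (\<forall>\<xi>. l2 \<xi> \<longrightarrow> sq_norm (T \<xi>) \<le> c1 * sq_norm \<xi> \<and> sq_norm \<xi> \<le> c2 * sq_norm (T \<xi>)) \<and>
    (\<forall>t \<xi> \<eta>. l2 \<xi> \<longrightarrow> l2 \<eta> \<longrightarrow> l2_ip (T (act t \<xi>)) (T (act t \<eta>)) = l2_ip (T \<xi>) (T \<eta>))"
proof -
  let ?B = "bounded_operators (L2 :: (nat \<Rightarrow> complex) inner_space)"
  interpret B: monoid ?B by (rule monoid_bounded_operators)
  obtain S where S: "S \<in> Units ?B"
    and U: "unitary_representation G L2 (\<lambda>t. inv\<^bsub>?B\<^esub> S \<otimes>\<^bsub>?B\<^esub> triangular_rep t \<otimes>\<^bsub>?B\<^esub> S)"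
    using assms by (auto simp: unitarizable_representation_def)
  define T where "T = inv\<^bsub>?B\<^esub> S"
  have T: "T \<in> carrier ?B" and SB: "S \<in> carrier ?B" unfolding T_def using S by auto
  have "S \<otimes>\<^bsub>?B\<^esub> T = \<one>\<^bsub>?B\<^esub>" unfolding T_def by (rule B.Units_r_inv[OF S])
  then have ST: "S (T \<xi>) = \<xi>" if "l2 \<xi>" for \<xi>
    using that by (auto simp: bounded_operators_def compose_def fun_eq_iff dest: spec[of _ \<xi>])
  have Tl2: "l2 (T \<xi>)" if "l2 \<xi>" for \<xi>
    using T that by (auto simp: bounded_operators_def bounded_operator_def)
  have inv: "l2_ip (T (act t \<xi>)) (T (act t \<eta>)) = l2_ip (T \<xi>) (T \<eta>)" if "l2 \<xi>" "l2 \<eta>" for t \<xi> \<eta>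
  proof -
    let ?U = "T \<otimes>\<^bsub>?B\<^esub> triangular_rep t \<otimes>\<^bsub>?B\<^esub> S"
    have conj: "?U (T \<xi>) = T (act t \<xi>)" if "l2 \<xi>" for \<xi>
      using that Tl2 ST by (simp add: bounded_operators_def compose_def triangular_rep_def)
    have "unitary_operator L2 ?U"
      using U unfolding unitary_representation_def T_def by simp
    then have "l2_ip (?U (T \<xi>)) (?U (T \<eta>)) = l2_ip (T \<xi>) (T \<eta>)"
      using Tl2 that unfolding unitary_operator_def by simp
    then show ?thesis by (simp only: conj that)
  qed
  from bounded_operator_sq_norm[OF T] obtain c1 where c1: "c1 \<ge> 0" "\<forall>\<xi>. l2 \<xi> \<longrightarrow> sq_norm (T \<xi>) \<le> c1 * sq_norm \<xi>" by blast
  from bounded_operator_sq_norm[OF SB] obtain c2 where c2: "c2 \<ge> 0" "\<forall>\<xi>. l2 \<xi> \<longrightarrow> sq_norm (S \<xi>) \<le> c2 * sq_norm \<xi>" by blast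
  have "sq_norm \<xi> \<le> c2 * sq_norm (T \<xi>)" if "l2 \<xi>" for \<xi>
    using c2(2)[rule_format, OF Tl2[OF that]] by (simp only: ST that)
  then show ?thesis using T c1 c2(1) inv by blast
qed

end

lemma l2_ip_add_right: "l2 \<xi> \<Longrightarrow> l2 \<eta> \<Longrightarrow> l2 \<zeta> \<Longrightarrow> l2_ip \<zeta> (\<lambda>n. \<xi> n + \<eta> n) = l2_ip \<zeta> \<xi> + l2_ip \<zeta> \<eta>"
  using l2_ip_add_left[of \<xi> \<eta> \<zeta>] by (simp add: l2_ip_cnj[of \<zeta>])

lemma l2_ip_scale_right: "l2_ip \<eta> (\<lambda>n. a * \<xi> n) = cnj a * l2_ip \<eta> \<xi>"
  using l2_ip_scale_left[of a \<xi> \<eta>] by (simp add: l2_ip_cnj[of \<eta>])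

lemma l2_ip_sum_left:
  "finite Z \<Longrightarrow> (\<And>x. x \<in> Z \<Longrightarrow> l2 (v x)) \<Longrightarrow> l2 \<eta> \<Longrightarrow> l2_ip (\<lambda>n. \<Sum>x\<in>Z. v x n) \<eta> = (\<Sum>x\<in>Z. l2_ip (v x) \<eta>)"
proof (induction Z rule: finite_induct)
  case (insert x Z)
  then show ?case using l2_ip_add_left[of "v x" "\<lambda>n. \<Sum>x\<in>Z. v x n" \<eta>] by (simp add: l2_sum)
qed (simp add: l2_ip_def)

lemma sq_norm_add_expand:
  assumes "l2 \<xi>" "l2 \<eta>"
  shows "sq_norm (\<lambda>n. \<xi> n + \<eta> n) = sq_norm \<xi> + sq_norm \<eta> + 2 * Re (l2_ip \<xi> \<eta>)"
proof -
  have "complex_of_real (sq_norm (\<lambda>n. \<xi> n + \<eta> n)) = l2_ip (\<lambda>n. \<xi> n + \<eta> n) (\<lambda>n. \<xi> n + \<eta> n)"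
    by (rule l2_ip_self[symmetric]) (rule l2_add[OF assms])
  also have "\<dots> = of_real (sq_norm \<xi>) + l2_ip \<eta> \<xi> + (l2_ip \<xi> \<eta> + of_real (sq_norm \<eta>))"
    using assms by (simp add: l2_ip_add_left l2_ip_add_right l2_add l2_ip_self)
  finally have "Re (complex_of_real (sq_norm (\<lambda>n. \<xi> n + \<eta> n))) = Re (of_real (sq_norm \<xi>) + l2_ip \<eta> \<xi> + (l2_ip \<xi> \<eta> + of_real (sq_norm \<eta>)))"
    by simp
  then show ?thesis by (simp add: l2_ip_cnj[of \<eta> \<xi>])
qed

definition unit_vec :: "nat \<Rightarrow> nat \<Rightarrow> complex" where
  "unit_vec x n = (if n = x then 1 else 0)"

lemma sq_norm_unit_vec_sum:
  assumes "finite Z"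
  shows "l2 (\<lambda>n. \<Sum>x\<in>Z. a x * unit_vec x n)" and "sq_norm (\<lambda>n. \<Sum>x\<in>Z. a x * unit_vec x n) = (\<Sum>x\<in>Z. (cmod (a x))\<^sup>2)"
proof -
  have eq: "(\<Sum>x\<in>Z. a x * unit_vec x n) = (if n \<in> Z then a n else 0)" for n
    using assms by (simp add: unit_vec_def if_distrib[of "\<lambda>t. _ * t"] sum.delta cong: if_cong)
  have "((\<lambda>n. (cmod (if n \<in> Z then a n else 0))\<^sup>2) has_sum (\<Sum>x\<in>Z. (cmod (a x))\<^sup>2)) UNIV"
    by (rule has_sum_finite_neutralI[where B = Z]) (use assms in auto)
  then show "l2 (\<lambda>n. \<Sum>x\<in>Z. a x * unit_vec x n)" "sq_norm (\<lambda>n. \<Sum>x\<in>Z. a x * unit_vec x n) = (\<Sum>x\<in>Z. (cmod (a x))\<^sup>2)"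
    unfolding l2_def sq_norm_def eq by (auto simp: summable_on_def intro: infsumI)
qed

lemma l2_unit_vec: "l2 (unit_vec x)" and sq_norm_unit_vec: "sq_norm (unit_vec x) = 1"
  using sq_norm_unit_vec_sum[of "{x}" "\<lambda>_. 1"] by simp_all

text \<open>Each entry is at most the total, hence at most \<open>c\<close>.\<close>

lemma sum_squares_le:
  assumes "finite Y" "\<And>y. y \<in> Y \<Longrightarrow> 0 \<le> h y" "(\<Sum>y\<in>Y. h y) \<le> (c::real)"
  shows "(\<Sum>y\<in>Y. (h y)\<^sup>2) \<le> c\<^sup>2"
proof -
  have "h y \<le> (\<Sum>y\<in>Y. h y)" if "y \<in> Y" for y by (rule member_le_sum[OF that]) (use assms in auto)
  then have "(h y)\<^sup>2 \<le> c * h y" if "y \<in> Y" for y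
    using that assms by (force simp: power2_eq_square intro!: mult_right_mono)
  then have "(\<Sum>y\<in>Y. (h y)\<^sup>2) \<le> c * (\<Sum>y\<in>Y. h y)" unfolding sum_distrib_left by (rule sum_mono)
  also have "\<dots> \<le> c * c"
    using assms(3) sum_nonneg[of Y h] assms(2) by (intro mult_left_mono) auto
  finally show ?thesis by (simp add: power2_eq_square)
qed

section \<open>The approximate complement of the first summand\<close>

locale invariant_form = split_group +
  fixes T :: "(nat \<Rightarrow> complex) \<Rightarrow> nat \<Rightarrow> complex" and c1 c2 :: real
  assumes T_bounded: "T \<in> carrier (bounded_operators L2)"
    and c1_nonneg: "c1 \<ge> 0" and c2_nonneg: "c2 \<ge> 0"
    and T_upper: "l2 \<xi> \<Longrightarrow> sq_norm (T \<xi>) \<le> c1 * sq_norm \<xi>"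
    and T_lower: "l2 \<xi> \<Longrightarrow> sq_norm \<xi> \<le> c2 * sq_norm (T \<xi>)"
    and T_invariant: "l2 \<xi> \<Longrightarrow> l2 \<eta> \<Longrightarrow> l2_ip (T (act t \<xi>)) (T (act t \<eta>)) = l2_ip (T \<xi>) (T \<eta>)"
begin

lemma l2_T: "l2 \<xi> \<Longrightarrow> l2 (T \<xi>)"
  and T_add: "l2 \<xi> \<Longrightarrow> l2 \<eta> \<Longrightarrow> T (\<lambda>n. \<xi> n + \<eta> n) = (\<lambda>n. T \<xi> n + T \<eta> n)"
  and T_scale: "l2 \<xi> \<Longrightarrow> T (\<lambda>n. a * \<xi> n) = (\<lambda>n. a * T \<xi> n)"
  using T_bounded by (auto simp: bounded_operators_def bounded_operator_def)

lemma T_sum: "finite Z \<Longrightarrow> (\<And>x. x \<in> Z \<Longrightarrow> l2 (v x)) \<Longrightarrow> T (\<lambda>n. \<Sum>x\<in>Z. v x n) = (\<lambda>n. \<Sum>x\<in>Z. T (v x) n)"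
proof (induction Z rule: finite_induct)
  case empty
  show ?case using T_scale[of "\<lambda>_. 0" 0] by simp
next
  case (insert x Z)
  then show ?case using T_add[of "v x" "\<lambda>n. \<Sum>x\<in>Z. v x n"] by (simp add: l2_sum)
qed

text \<open>A near-minimizer replaces the orthogonal projection, so that no closedness or limit is needed.\<close>

lemma almost_orthogonal:
  assumes "\<epsilon> > 0" "l2 \<delta>"
  shows "\<exists>w. l2 w \<and> sq_norm (T (interleave w \<delta>)) \<le> sq_norm (T (interleave (\<lambda>_. 0) \<delta>)) \<and>
    (\<forall>k. l2 k \<longrightarrow> (cmod (l2_ip (T (interleave w \<delta>)) (T (interleave k (\<lambda>_. 0)))))\<^sup>2 \<le> \<epsilon> * sq_norm (T (interleave k (\<lambda>_. 0))))"
proof -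
  define N where "N w = sq_norm (T (interleave w \<delta>))" for w
  define m where "m = Inf (N ` {w. l2 w})"
  have bdd: "bdd_below (N ` {w. l2 w})" by (rule bdd_belowI[of _ 0]) (auto simp: N_def)
  have m_le: "m \<le> N w" if "l2 w" for w unfolding m_def by (rule cInf_lower[OF _ bdd]) (use that in auto)
  have "\<exists>w. l2 w \<and> N w \<le> N (\<lambda>_. 0) \<and> N w \<le> m + \<epsilon>"
  proof (cases "N (\<lambda>_. 0) \<le> m + \<epsilon>")
    case True
    then show ?thesis by (intro exI[of _ "\<lambda>_. 0"]) simp
  next
    case False
    have ne: "N ` {w. l2 w} \<noteq> {}" using l2_zero by blast
    have "Inf (N ` {w. l2 w}) < m + \<epsilon>" using assms(1) by (simp add: m_def)
    then have "\<exists>z\<in>N ` {w. l2 w}. z < m + \<epsilon>" by (simp only: cInf_less_iff[OF ne bdd])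
    then obtain w where "l2 w" "N w < m + \<epsilon>" by auto
    then show ?thesis using False by (intro exI[of _ w]) simp
  qed
  then obtain w where w: "l2 w" "N w \<le> N (\<lambda>_. 0)" "N w \<le> m + \<epsilon>" by blast
  have "(cmod (l2_ip (T (interleave w \<delta>)) (T (interleave k (\<lambda>_. 0)))))\<^sup>2 \<le> \<epsilon> * sq_norm (T (interleave k (\<lambda>_. 0)))" if k: "l2 k" for k
  proof -
    define v where "v = T (interleave w \<delta>)"
    define u where "u = T (interleave k (\<lambda>_. 0))"
    define p where "p = l2_ip v u"
    define s where "s = sq_norm u"
    have lv: "l2 v" and lu: "l2 u" unfolding v_def u_def by (intro l2_T l2_interleave w k assms l2_zero)+
    show ?thesis
    proof (cases "s = 0")
      case True
      then have "u = (\<lambda>_. 0)" using sq_norm_eq_0[OF lu] by (simp add: s_def)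
      then have "p = 0" by (simp add: p_def l2_ip_def)
      then show ?thesis using assms(1) by (simp add: p_def u_def v_def)
    next
      case False
      then have s: "s > 0" by (simp add: s_def less_le)
      \<comment> \<open>The multiple of \<open>u\<close> that shortens \<open>v\<close> most: it
        lowers the squared norm by \<open>(cmod p)\<^sup>2 / s\<close>. Since \<open>w\<close> is
        within \<epsilon> of the infimum, this gain is at most \<epsilon>.\<close>
      define c where "c = - p / of_real s"
      have "(\<lambda>n. v n + c * u n) = T (interleave (\<lambda>n. w n + c * k n) \<delta>)"
      proof -
        have "interleave (\<lambda>n. w n + c * k n) \<delta> = (\<lambda>n. interleave w \<delta> n + c * interleave k (\<lambda>_. 0) n)"
          by (auto simp: interleave_def fun_eq_iff)
        then show ?thesis
          by (simp add: T_add T_scale l2_interleave l2_scale w(1) k assms(2) v_def u_def)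
      qed
      then have "m \<le> sq_norm (\<lambda>n. v n + c * u n)"
        using m_le[of "\<lambda>n. w n + c * k n"] by (simp add: N_def l2_add l2_scale w(1) k)
      also have "\<dots> = sq_norm v + (cmod c)\<^sup>2 * s + 2 * Re (cnj c * p)"
        using sq_norm_add_expand[OF lv l2_scale[OF lu]] by (simp add: sq_norm_scale l2_ip_scale_right s_def p_def)
      also have "cnj c * p = - of_real ((cmod p)\<^sup>2 / s)"
      proof -
        have "cnj c * p = - (p * cnj p) / of_real s" by (simp add: c_def)
        also have "\<dots> = - of_real ((cmod p)\<^sup>2) / of_real s" by (simp only: complex_norm_square)
        finally show ?thesis by simp
      qed
      also have "(cmod c)\<^sup>2 * s = (cmod p)\<^sup>2 / s"
        using s by (simp add: c_def norm_divide power_divide power2_eq_square)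
      finally have "m \<le> sq_norm v - (cmod p)\<^sup>2 / s" by simp
      then have "(cmod p)\<^sup>2 / s \<le> \<epsilon>" using w(3) by (simp add: N_def v_def)
      then show ?thesis using s by (simp add: p_def u_def v_def s_def divide_le_eq)
    qed
  qed
  then show ?thesis using w(1,2) unfolding N_def by blast
qed

text \<open>If the invariant complement is the graph of an operator with column \<open>w\<close> at
  \<open>\<one>\<close>, then invariance forces its column at \<open>x\<close> to be
  \<open>translate w x\<close>.\<close>

definition translate :: "(nat \<Rightarrow> complex) \<Rightarrow> nat \<Rightarrow> nat \<Rightarrow> complex" where
  "translate w x y = w (y \<otimes> inv x) + of_real (f x y - f \<one> (y \<otimes> inv x))"

lemma act_interleave_unit_vec: "act (inv x) (interleave w (unit_vec \<one>)) = interleave (translate w x) (unit_vec x)"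
proof -
  have unit_vec: "rho (inv x) (unit_vec \<one>) = unit_vec x"
  proof
    fix y
    have "y \<otimes> inv x = \<one> \<longleftrightarrow> y = x"
      by (metis carrier_UNIV UNIV_I inv_inv inv_equality r_inv inv_closed)
    then show "rho (inv x) (unit_vec \<one>) y = unit_vec x y" by (simp add: rho_def unit_vec_def)
  qed
  have "cross (inv x) (unit_vec x) y = ker (inv x) y x" for y
  proof -
    have "((\<lambda>z. ker (inv x) y z * unit_vec x z) has_sum (\<Sum>z\<in>{x}. ker (inv x) y z * unit_vec x z)) UNIV"
      by (rule has_sum_finite_neutralI[where B = "{x}"]) (auto simp: unit_vec_def)
    then show ?thesis unfolding cross_def by (simp add: infsumI unit_vec_def)
  qed
  then show ?thesis
    unfolding act_def by (simp add: unit_vec translate_def[abs_def] rho_def ker_def)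
qed

lemma l2_translate: "l2 w \<Longrightarrow> l2 (translate w x)"
  using l2_even_part[OF l2_act[OF l2_interleave[OF _ l2_unit_vec]], of w "inv x" \<one>] by (simp add: act_interleave_unit_vec)

text \<open>The operator with columns \<open>translate w x\<close> has, up to a controlled error, a
  graph orthogonal to the first summand, hence is bounded. Testing it on the conjugates of its
  entries in row \<open>\<one>\<close> bounds the square sum \<alpha> of these entries, because
  \<alpha> squared is at most a constant times \<alpha>.\<close>

lemma row_bound:
  assumes "finite Z"
  shows "\<exists>w. l2 w \<and> sq_norm w \<le> c2 * c1 \<and> (\<Sum>x\<in>Z. (cmod (translate w x \<one>))\<^sup>2) \<le> c2 * (2 + 2 * c1)"
proof -
  \<comment> \<open>The errors of the \<open>card Z\<close> columns then add up to at most 1, and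
    the summand 1 keeps \<epsilon> positive for empty \<open>Z\<close>.\<close>
  define \<epsilon> :: real where "\<epsilon> = 1 / (card Z + 1)"
  have \<epsilon>: "\<epsilon> > 0" by (simp add: \<epsilon>_def)
  obtain w where w: "l2 w" "sq_norm (T (interleave w (unit_vec \<one>))) \<le> sq_norm (T (interleave (\<lambda>_. 0) (unit_vec \<one>)))"
    and orth: "\<forall>k. l2 k \<longrightarrow> (cmod (l2_ip (T (interleave w (unit_vec \<one>))) (T (interleave k (\<lambda>_. 0)))))\<^sup>2 \<le> \<epsilon> * sq_norm (T (interleave k (\<lambda>_. 0)))"
    using almost_orthogonal[OF \<epsilon> l2_unit_vec] by blast
  have "sq_norm w \<le> sq_norm (interleave w (unit_vec \<one>))" by (simp add: sq_norm_interleave w(1) l2_unit_vec)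
  also have "\<dots> \<le> c2 * sq_norm (T (interleave w (unit_vec \<one>)))" by (intro T_lower l2_interleave w(1) l2_unit_vec)
  also have "\<dots> \<le> c2 * (c1 * sq_norm (interleave (\<lambda>_. 0) (unit_vec \<one>)))"
    by (intro mult_left_mono c2_nonneg order_trans[OF w(2)] T_upper l2_interleave l2_zero l2_unit_vec)
  finally have sq_norm_w: "sq_norm w \<le> c2 * c1" by (simp add: sq_norm_interleave l2_unit_vec sq_norm_unit_vec)
  define b where "b x = translate w x" for x
  have lb: "l2 (b x)" for x unfolding b_def by (rule l2_translate[OF w(1)])
  \<comment> \<open>The action preserves both the form and the first summand, so the
    near-orthogonality of the column at \<open>\<one>\<close> passes to every column with the same
    \<epsilon>.\<close>
  have orth_b: "(cmod (l2_ip (T (interleave (b x) (unit_vec x))) (T (interleave k (\<lambda>_. 0)))))\<^sup>2 \<le> \<epsilon> * sq_norm (T (interleave k (\<lambda>_. 0)))"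
    if k: "l2 k" for x k
  proof -
    have K: "act (inv x) (interleave (rho x k) (\<lambda>_. 0)) = interleave k (\<lambda>_. 0)"
    proof -
      have z: "rho t (\<lambda>_. 0) = (\<lambda>_. 0)" "cross t (\<lambda>_. 0) y = 0" for t y
        by (simp_all add: rho_def fun_eq_iff cross_def)
      have "rho (inv x) (rho x k) = k" by (simp add: rho_rho) (simp add: rho_def fun_eq_iff)
      then show ?thesis unfolding act_def by (simp add: z)
    qed
    have lk: "l2 (interleave (rho x k) (\<lambda>_. 0))" by (intro l2_interleave l2_rho k l2_zero)
    have "l2_ip (T (interleave (b x) (unit_vec x))) (T (interleave k (\<lambda>_. 0))) = l2_ip (T (interleave w (unit_vec \<one>))) (T (interleave (rho x k) (\<lambda>_. 0)))"
      using T_invariant[OF l2_interleave[OF w(1) l2_unit_vec[of \<one>]] lk, of "inv x"] unfolding act_interleave_unit_vec K b_def .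
    moreover have "sq_norm (T (interleave (rho x k) (\<lambda>_. 0))) = sq_norm (T (interleave k (\<lambda>_. 0)))"
    proof -
      have "l2_ip (T (interleave k (\<lambda>_. 0))) (T (interleave k (\<lambda>_. 0))) = l2_ip (T (interleave (rho x k) (\<lambda>_. 0))) (T (interleave (rho x k) (\<lambda>_. 0)))"
        using T_invariant[OF lk lk, of "inv x"] unfolding K .
      then show ?thesis using l2_T[OF lk] l2_T[OF l2_interleave[OF k l2_zero]] by (simp add: l2_ip_self)
    qed
    ultimately show ?thesis using orth l2_rho[OF k] by metis
  qed
  \<comment> \<open>With these coefficients the value of the combination \<beta> at
    \<open>\<one>\<close> is the sum of squares \<alpha>.\<close>
  define a where "a x = cnj (b x \<one>)" for x
  define \<alpha> where "\<alpha> = (\<Sum>x\<in>Z. (cmod (a x))\<^sup>2)"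
  have \<alpha>: "0 \<le> \<alpha>" by (simp add: \<alpha>_def sum_nonneg)
  define \<beta> where "\<beta> n = (\<Sum>x\<in>Z. a x * b x n)" for n
  define \<gamma> where "\<gamma> n = (\<Sum>x\<in>Z. a x * unit_vec x n)" for n
  have l\<beta>: "l2 \<beta>" unfolding \<beta>_def[abs_def] by (intro l2_sum assms l2_scale lb)
  have l\<gamma>: "l2 \<gamma>" and sq_norm_\<gamma>: "sq_norm \<gamma> = \<alpha>"
    unfolding \<gamma>_def[abs_def] \<alpha>_def using sq_norm_unit_vec_sum[OF assms, of a] by auto
  define B where "B = T (interleave \<beta> (\<lambda>_. 0))"
  define A where "A = T (interleave (\<lambda>_. 0) \<gamma>)"
  have lB: "l2 B" and lA: "l2 A" unfolding A_def B_def by (intro l2_T l2_interleave l\<beta> l\<gamma> l2_zero)+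
  define P where "P = (\<lambda>n. B n + A n)"
  have P: "P = (\<lambda>n. \<Sum>x\<in>Z. a x * T (interleave (b x) (unit_vec x)) n)"
  proof -
    have "P = T (\<lambda>n. interleave \<beta> (\<lambda>_. 0) n + interleave (\<lambda>_. 0) \<gamma> n)"
      unfolding P_def A_def B_def by (rule T_add[symmetric]) (intro l2_interleave l\<beta> l\<gamma> l2_zero)+
    also have "(\<lambda>n. interleave \<beta> (\<lambda>_. 0) n + interleave (\<lambda>_. 0) \<gamma> n) = (\<lambda>n. \<Sum>x\<in>Z. a x * interleave (b x) (unit_vec x) n)"
      by (simp add: interleave_add interleave_sum interleave_scale \<beta>_def \<gamma>_def flip: interleave_scale) (auto simp: interleave_def \<beta>_def \<gamma>_def fun_eq_iff)
    also have "T \<dots> = (\<lambda>n. \<Sum>x\<in>Z. T (\<lambda>n. a x * interleave (b x) (unit_vec x) n) n)"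
      by (rule T_sum[OF assms]) (intro l2_scale l2_interleave lb l2_unit_vec)
    also have "\<dots> = (\<lambda>n. \<Sum>x\<in>Z. a x * T (interleave (b x) (unit_vec x)) n)"
      by (simp add: T_scale l2_interleave lb l2_unit_vec)
    finally show ?thesis .
  qed
  define s where "s = sq_norm B"
  have s: "0 \<le> s" by (simp add: s_def)
  have PB: "(cmod (l2_ip P B))\<^sup>2 \<le> \<alpha> * s"
  proof -
    have "l2_ip P B = (\<Sum>x\<in>Z. a x * l2_ip (T (interleave (b x) (unit_vec x))) B)"
      unfolding P using l2_ip_sum_left[OF assms, of "\<lambda>x n. a x * T (interleave (b x) (unit_vec x)) n" B]
      by (simp add: l2_ip_scale_left l2_scale l2_T l2_interleave lb l2_unit_vec lB)
    then have "cmod (l2_ip P B) \<le> (\<Sum>x\<in>Z. cmod (a x) * cmod (l2_ip (T (interleave (b x) (unit_vec x))) B))"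
      using norm_sum[of "\<lambda>x. a x * l2_ip (T (interleave (b x) (unit_vec x))) B" Z] by (simp add: norm_mult)
    then have "(cmod (l2_ip P B))\<^sup>2 \<le> (\<Sum>x\<in>Z. cmod (a x) * cmod (l2_ip (T (interleave (b x) (unit_vec x))) B))\<^sup>2"
      by (rule power_mono) simp
    also have "\<dots> \<le> \<alpha> * (\<Sum>x\<in>Z. (cmod (l2_ip (T (interleave (b x) (unit_vec x))) B))\<^sup>2)"
      unfolding \<alpha>_def by (rule Cauchy_Schwarz_ineq_sum)
    also have "\<dots> \<le> \<alpha> * (\<Sum>x\<in>Z. \<epsilon> * s)"
      unfolding s_def B_def by (intro mult_left_mono[OF _ \<alpha>] sum_mono orth_b l\<beta>)
    also have "\<dots> = \<alpha> * ((card Z * \<epsilon>) * s)" by simp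
    also have "\<dots> \<le> \<alpha> * (1 * s)"
      by (intro mult_left_mono[OF _ \<alpha>] mult_right_mono s) (simp add: \<epsilon>_def)
    finally show ?thesis by simp
  qed
  \<comment> \<open>\<open>s\<close> is the real part of the product of \<open>P\<close> and
    \<open>B\<close> minus that of \<open>A\<close> and \<open>B\<close>. The first is at most
    \<open>\<alpha> + s / 4\<close> by near-orthogonality, the second at least
    \<open>- sq_norm A - s / 4\<close>, and \<open>s / 2\<close> is absorbed.\<close>
  have "s \<le> 2 * \<alpha> + 2 * sq_norm A"
  proof -
    have "(cmod (l2_ip P B))\<^sup>2 \<le> (\<alpha> + s / 4)\<^sup>2"
    proof -
      have "\<alpha> * s \<le> (\<alpha> + s / 4)\<^sup>2"
        using zero_le_power2[of "\<alpha> - s / 4"] by (simp add: power2_sum power2_diff)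
      then show ?thesis using PB by linarith
    qed
    then have "cmod (l2_ip P B) \<le> \<alpha> + s / 4" by (rule power2_le_imp_le) (use \<alpha> s in simp)
    then have 1: "Re (l2_ip P B) \<le> \<alpha> + s / 4" using complex_Re_le_cmod order_trans by blast
    have "l2_ip P B = of_real s + l2_ip A B"
      unfolding P_def s_def using lA lB by (simp add: l2_ip_add_left l2_ip_self)
    then have 2: "Re (l2_ip P B) = s + Re (l2_ip A B)" by simp
    have "0 \<le> sq_norm (\<lambda>n. A n + (1/2) * B n)" by simp
    also have "\<dots> = sq_norm A + s / 4 + Re (l2_ip A B)"
      unfolding sq_norm_add_expand[OF lA l2_scale[OF lB]] sq_norm_scale l2_ip_scale_right s_def
      by (simp add: power2_eq_square)
    finally show ?thesis using 1 2 by linarith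
  qed
  also have "\<dots> \<le> 2 * \<alpha> + 2 * (c1 * \<alpha>)"
  proof -
    have "sq_norm A \<le> c1 * sq_norm (interleave (\<lambda>_. 0) \<gamma>)" unfolding A_def by (intro T_upper l2_interleave l2_zero l\<gamma>)
    then show ?thesis by (simp add: sq_norm_interleave l\<gamma> sq_norm_\<gamma>)
  qed
  finally have s_le: "s \<le> (2 + 2 * c1) * \<alpha>" by (simp add: algebra_simps)
  have "sq_norm \<beta> = sq_norm (interleave \<beta> (\<lambda>_. 0))" by (simp add: sq_norm_interleave l\<beta>)
  also have "\<dots> \<le> c2 * s" unfolding s_def B_def by (intro T_lower l2_interleave l\<beta> l2_zero)
  also have "\<dots> \<le> c2 * ((2 + 2 * c1) * \<alpha>)" by (rule mult_left_mono[OF s_le c2_nonneg])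
  finally have \<beta>_le: "sq_norm \<beta> \<le> c2 * (2 + 2 * c1) * \<alpha>" by (simp add: mult.assoc)
  have "\<beta> \<one> = of_real \<alpha>"
    unfolding \<beta>_def \<alpha>_def a_def by (simp add: complex_norm_square[symmetric] mult.commute)
  then have "\<alpha>\<^sup>2 = (cmod (\<beta> \<one>))\<^sup>2" by simp
  also have "\<dots> \<le> c2 * (2 + 2 * c1) * \<alpha>" using coord_le_sq_norm[OF l\<beta>, of \<one>] \<beta>_le by linarith
  finally have "\<alpha> * \<alpha> \<le> c2 * (2 + 2 * c1) * \<alpha>" by (simp add: power2_eq_square)
  then have "\<alpha> \<le> c2 * (2 + 2 * c1)"
    using \<alpha> c1_nonneg c2_nonneg by (cases "\<alpha> = 0") (auto simp: mult_le_cancel_right)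
  then show ?thesis using w(1) sq_norm_w by (intro exI[of _ w]) (simp add: \<alpha>_def a_def b_def)
qed

text \<open>\<open>\<phi> (inv x)\<close> is a sum of four entries: one in the row bounded by
  \<open>row_bound\<close>, one of the column \<open>w\<close>, one in a row of \<open>f\<close> and
  one in a column of \<open>g\<close>. Each of the four families is square summable with a bound
  independent of \<open>Z\<close>.\<close>

lemma square_summable:
  assumes "finite Z" shows "(\<Sum>z\<in>Z. (\<phi> z)\<^sup>2) \<le> 4 * (c2 * (2 + 2 * c1) + c2 * c1 + 2 * C\<^sup>2)"
proof -
  define Y where "Y = (\<lambda>z. inv z) ` Z"
  have finY: "finite Y" using assms by (simp add: Y_def)
  have inj: "inj_on (\<lambda>z. inv z) X" for X by (rule inj_onI) (metis inv_inv carrier_UNIV UNIV_I)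
  have Z: "Z = (\<lambda>x. inv x) ` Y" by (simp add: Y_def image_image)
  obtain w where w: "l2 w" "sq_norm w \<le> c2 * c1" "(\<Sum>x\<in>Y. (cmod (translate w x \<one>))\<^sup>2) \<le> c2 * (2 + 2 * c1)"
    using row_bound[OF finY] by blast
  have four: "\<bar>t\<bar>\<^sup>2 \<le> 4 * (p\<^sup>2 + q\<^sup>2 + (u\<^sup>2 + v\<^sup>2))" if "\<bar>t\<bar> \<le> p + q + (u + v)" for t p q u v :: real
  proof -
    have "\<bar>t\<bar>\<^sup>2 \<le> (p + q + (u + v))\<^sup>2" by (rule power_mono[OF that]) simp
    moreover have "(p + q + (u + v))\<^sup>2 + (p - q)\<^sup>2 + (p - u)\<^sup>2 + (p - v)\<^sup>2 + (q - u)\<^sup>2 + (q - v)\<^sup>2 + (u - v)\<^sup>2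
        = 4 * (p\<^sup>2 + q\<^sup>2 + (u\<^sup>2 + v\<^sup>2))" by (simp add: power2_eq_square algebra_simps)
    ultimately show ?thesis
      using zero_le_power2[of "p - q"] zero_le_power2[of "p - u"] zero_le_power2[of "p - v"]
        zero_le_power2[of "q - u"] zero_le_power2[of "q - v"] zero_le_power2[of "u - v"] by linarith
  qed
  have "(\<phi> (inv x))\<^sup>2 \<le> 4 * ((cmod (translate w x \<one>))\<^sup>2 + (cmod (w (inv x)))\<^sup>2 + ((f \<one> (inv x))\<^sup>2 + (g x \<one>)\<^sup>2))" for x
  proof -
    \<comment> \<open>The entry \<open>f x \<one>\<close> runs down a column of \<open>f\<close>,
      which has no bound. The definition of \<open>translate\<close> trades it for the entry
      \<open>f \<one> (inv x)\<close> in a row of \<open>f\<close>.\<close>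
    have "complex_of_real (\<phi> (inv x)) = translate w x \<one> - w (inv x) + (of_real (f \<one> (inv x)) + of_real (g x \<one>))"
      using split_eq[of x \<one>] by (simp add: translate_def algebra_simps flip: of_real_add)
    then have "cmod (complex_of_real (\<phi> (inv x))) \<le> cmod (translate w x \<one> - w (inv x)) + cmod (of_real (f \<one> (inv x)) + of_real (g x \<one>))"
      using norm_triangle_ineq by metis
    also have "\<dots> \<le> (cmod (translate w x \<one>) + cmod (w (inv x))) + (cmod (of_real (f \<one> (inv x))) + cmod (of_real (g x \<one>)))"
      by (intro add_mono norm_triangle_ineq4 norm_triangle_ineq)
    finally have "\<bar>\<phi> (inv x)\<bar> \<le> cmod (translate w x \<one>) + cmod (w (inv x)) + (f \<one> (inv x) + g x \<one>)"
      by (simp add: f_nonneg g_nonneg)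
    from four[OF this] show ?thesis by simp
  qed
  then have "(\<Sum>x\<in>Y. (\<phi> (inv x))\<^sup>2) \<le> (\<Sum>x\<in>Y. 4 * ((cmod (translate w x \<one>))\<^sup>2 + (cmod (w (inv x)))\<^sup>2 + ((f \<one> (inv x))\<^sup>2 + (g x \<one>)\<^sup>2)))"
    by (rule sum_mono)
  also have "\<dots> = 4 * ((\<Sum>x\<in>Y. (cmod (translate w x \<one>))\<^sup>2) + (\<Sum>x\<in>Y. (cmod (w (inv x)))\<^sup>2)
      + ((\<Sum>x\<in>Y. (f \<one> (inv x))\<^sup>2) + (\<Sum>x\<in>Y. (g x \<one>)\<^sup>2)))"
    by (simp only: sum_distrib_left[symmetric] sum.distrib)
  also have "(\<Sum>x\<in>Y. (cmod (w (inv x)))\<^sup>2) = (\<Sum>z\<in>Z. (cmod (w z))\<^sup>2)"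
    unfolding Z by (simp add: sum.reindex[OF inj])
  also have "(\<Sum>x\<in>Y. (f \<one> (inv x))\<^sup>2) = (\<Sum>z\<in>Z. (f \<one> z)\<^sup>2)"
    unfolding Z by (simp add: sum.reindex[OF inj])
  also have "4 * ((\<Sum>x\<in>Y. (cmod (translate w x \<one>))\<^sup>2) + (\<Sum>z\<in>Z. (cmod (w z))\<^sup>2)
      + ((\<Sum>z\<in>Z. (f \<one> z)\<^sup>2) + (\<Sum>x\<in>Y. (g x \<one>)\<^sup>2)))
    \<le> 4 * (c2 * (2 + 2 * c1) + c2 * c1 + (C\<^sup>2 + C\<^sup>2))"
    by (intro mult_left_mono add_mono w(3) order_trans[OF sum_le_sq_norm[OF w(1) assms] w(2)]
        sum_squares_le assms finY f_nonneg g_nonneg f_bound g_bound) simp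
  finally show ?thesis unfolding Z by (simp add: sum.reindex[OF inj])
qed

end

lemma (in split_group) not_unitarizable:
  assumes "\<And>K. \<exists>Z. finite Z \<and> (\<Sum>z\<in>Z. (\<phi> z)\<^sup>2) > K"
  shows "\<not> unitarizable TYPE(nat \<Rightarrow> complex) G"
proof
  assume "unitarizable TYPE(nat \<Rightarrow> complex) G"
  then have "unitarizable_representation G L2 triangular_rep"
    using hilbert_space_L2 representation_triangular_rep uniformly_bounded_triangular_rep
    unfolding unitarizable_def by blast
  from invariant_form_of_unitarizable[OF this] obtain T c1 c2 where
    T: "T \<in> carrier (bounded_operators L2)" "c1 \<ge> 0" "c2 \<ge> 0"
    "\<forall>\<xi>. l2 \<xi> \<longrightarrow> sq_norm (T \<xi>) \<le> c1 * sq_norm \<xi> \<and> sq_norm \<xi> \<le> c2 * sq_norm (T \<xi>)"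
    "\<forall>t \<xi> \<eta>. l2 \<xi> \<longrightarrow> l2 \<eta> \<longrightarrow> l2_ip (T (act t \<xi>)) (T (act t \<eta>)) = l2_ip (T \<xi>) (T \<eta>)"
    by blast
  interpret invariant_form G \<phi> f g C T c1 c2
    by unfold_locales (use T in simp_all)
  obtain Z where "finite Z" "(\<Sum>z\<in>Z. (\<phi> z)\<^sup>2) > 4 * (c2 * (2 + 2 * c1) + c2 * c1 + 2 * C\<^sup>2)"
    using assms by blast
  with square_summable show False by (meson not_le)
qed

theorem theorem1p2:
  shows "\<exists>G :: nat monoid.
    finitely_generated_group G \<and> torsion_group G \<and> \<not> unitarizable TYPE(nat \<Rightarrow> complex) G"
proof -
  obtain \<phi> f g C where "row_column_split limit_group \<phi> f g C"
    and unbounded: "\<forall>K. \<exists>Z. finite Z \<and> (\<Sum>z\<in>Z. (\<phi> z)\<^sup>2) > K"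
    using exists_row_column_split[OF sparse_limit_group] by blast
  then interpret split_group limit_group \<phi> f g C
    by (intro split_group.intro split_group_axioms.intro group_limit_group) simp_all
  have "\<not> unitarizable TYPE(nat \<Rightarrow> complex) limit_group"
    by (rule not_unitarizable) (use unbounded in blast)
  then show ?thesis using finitely_generated_limit_group torsion_limit_group by blast
qed

end
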